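(* For every integer $k\ge 2$, there is a homotopy equivalence \[\mathrm{VR}(T_{3k,3k};k)\simeq \bigvee_{6k^2-1} S^2.\]
   Context: For a metric space $X$ and $r\ge 0$, $\mathrm{VR}(X;r)$ is the simplicial complex on vertex set $X$ whose simplices are the finite nonempty subsets of diameter at most $r$. $T_{n,n}$ is the set $\{0,\dots,n-1\}^2$ with metric $d((i,j),(i',j'))=\min\{|i-i'|,n-|i-i'|\}+\min\{|j-j'|,n-|j-j'|\}$, i.e. the vertex set of the $n\times n$ torus grid graph with its shortest-path metric. *)

theory Defs
  imports "HOL-Analysis.Analysis"
begin

text \<open>Cyclic distance on Z/n, with representatives in {0..<n}.\<close>
definition cyc_dist :: "nat \<Rightarrow> nat \<Rightarrow> nat \<Rightarrow> nat" where
  "cyc_dist n a b = min (if a \<le> b then b - a else a - b) (n - (if a \<le> b then b - a else a - b))"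

text \<open>Vertex set of the n x n torus grid and its shortest-path metric.\<close>
definition torus_vertices :: "nat \<Rightarrow> (nat \<times> nat) set" where
  "torus_vertices n = {0..<n} \<times> {0..<n}"

definition torus_dist :: "nat \<Rightarrow> nat \<times> nat \<Rightarrow> nat \<times> nat \<Rightarrow> nat" where
  "torus_dist n p q = cyc_dist n (fst p) (fst q) + cyc_dist n (snd p) (snd q)"

definition vietoris_rips :: "'a set \<Rightarrow> ('a \<Rightarrow> 'a \<Rightarrow> 'b::linorder) \<Rightarrow> 'b \<Rightarrow> 'a set set" where
  "vietoris_rips X d r = {\<sigma>. \<sigma> \<subseteq> X \<and> finite \<sigma> \<and> \<sigma> \<noteq> {} \<and> (\<forall>x\<in>\<sigma>. \<forall>y\<in>\<sigma>. d x y \<le> r)}"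

text \<open>Geometric realization of a simplicial complex K on a finite vertex set V:
  barycentric coordinate functions V \<rightarrow> [0,1] summing to 1 whose support is a simplex,
  with the subspace topology of the product topology on 'a \<Rightarrow> real.\<close>
definition geometric_realization :: "'a set \<Rightarrow> 'a set set \<Rightarrow> ('a \<Rightarrow> real) topology" where
  "geometric_realization V K = subtopology euclidean
     {f. (\<forall>v. 0 \<le> f v) \<and> (\<forall>v. v \<notin> V \<longrightarrow> f v = 0) \<and> sum f V = 1 \<and> {v. f v \<noteq> 0} \<in> K}"

text \<open>Wedge of m copies of S^2, modelled in R^3 as the union of the spheres centred at
  (i,0,0) of radius i, i = 1..m; any two of them meet exactly in the origin (the wedge point).\<close>
definition wedge_of_2spheres :: "nat \<Rightarrow> (real^3) topology" where
  "wedge_of_2spheres m = subtopology euclidean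
     (\<Union>i\<in>{1..m}. sphere (vector [real i, 0, 0]) (real i))"

end

theory Submission
  imports Defs
begin

text \<open>
  If every simplex containing a face \<open>\<rho>\<close> can be enlarged by a vertex \<open>w \<notin> \<rho>\<close>, then the realization
  deformation retracts onto the complement of the open star of \<open>\<rho>\<close>. Apart from one explicit homeomorphism
  with a wedge of spheres, the whole argument is a sequence of such folds and their inverses.

  A simplex of \<open>VR(T; k)\<close> either lifts to the plane or is one of the \<open>6k\<^sup>2\<close> triangles winding around a row
  or a column. Each winding triangle is replaced by a cone over its whole row or column; such a
  replacement survives all folds inside rows and columns, whereas the triangle itself would block
  them. The planar edges are then folded away in order of decreasing length until the usual
  triangulation of the torus remains, still with \<open>k\<close> cones over each row and each column.

  Deleting one triangle from every cone, except one cone per row and one single column cone, and one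
  triangle from every strip between consecutive rows leaves a complex that folds to a point.
  These are \<open>6k\<^sup>2 - 1\<close> maximal triangles. Coning off the rest of the complex turns each of them
  into the boundary of a tetrahedron.
\<close>

section \<open>Folding simplicial complexes\<close>

text \<open>The constant arises as 6k^2 - (3k + 1) + 3k: one triangle from each cone except 3k + 1
  spared ones, and one from each of the 3k strips. The Euler characteristic agrees: the torus
  contributes 0 and each of the 6k^2 attached discs adds 1, giving 1 + (6k^2 - 1). The obstacle: a
  fold at \<rho> needs a vertex w that can be joined to every simplex containing \<rho>. At an edge
  of a winding triangle only the third vertex could serve, since the winding triangle is maximal,
  and that vertex is too far from the planar simplices on the same edge. A cone over the full
  subcomplex on a row causes no such conflict: if both ends of the edge lie in the row, it is enough
  to choose w in the row as well. The spared cones are dictated by what remains once the strips are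
  opened and folded away: 3k row circles joined along the edges of a single column. The row cones
  fill the row circles, and one column cone fills the circle formed by that column.\<close>

definition simplicial_complex :: "'a set set \<Rightarrow> bool" where
  "simplicial_complex K \<longleftrightarrow> (\<forall>\<sigma>\<in>K. finite \<sigma> \<and> \<sigma> \<noteq> {} \<and> (\<forall>s. s \<subseteq> \<sigma> \<and> s \<noteq> {} \<longrightarrow> s \<in> K))"

lemma simplicial_complexI:
  assumes "\<And>\<sigma>. \<sigma> \<in> K \<Longrightarrow> finite \<sigma>" "\<And>\<sigma>. \<sigma> \<in> K \<Longrightarrow> \<sigma> \<noteq> {}"
    and "\<And>\<sigma> s. \<sigma> \<in> K \<Longrightarrow> s \<subseteq> \<sigma> \<Longrightarrow> s \<noteq> {} \<Longrightarrow> s \<in> K"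
  shows "simplicial_complex K"
  unfolding simplicial_complex_def using assms by simp

lemma simplicial_complex_finite: "simplicial_complex K \<Longrightarrow> \<sigma> \<in> K \<Longrightarrow> finite \<sigma>"
  and simplicial_complex_nonempty: "simplicial_complex K \<Longrightarrow> \<sigma> \<in> K \<Longrightarrow> \<sigma> \<noteq> {}"
  unfolding simplicial_complex_def by auto

lemma simplicial_complex_face: "simplicial_complex K \<Longrightarrow> \<sigma> \<in> K \<Longrightarrow> s \<subseteq> \<sigma> \<Longrightarrow> s \<noteq> {} \<Longrightarrow> s \<in> K"
  unfolding simplicial_complex_def by (drule (1) bspec) simp

lemma simplicial_complex_diff_maximal:
  assumes "simplicial_complex K" "\<And>\<tau> \<sigma>. \<tau> \<in> M \<Longrightarrow> \<sigma> \<in> K \<Longrightarrow> \<tau> \<subseteq> \<sigma> \<Longrightarrow> \<sigma> = \<tau>"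
  shows "simplicial_complex (K - M)"
proof (rule simplicial_complexI)
  fix \<sigma> s assume \<sigma>: "\<sigma> \<in> K - M" and s: "s \<subseteq> \<sigma>" "s \<noteq> {}"
  have "s \<in> K" using simplicial_complex_face[OF assms(1) _ s] \<sigma> by simp
  moreover have "s \<notin> M" using assms(2)[of s \<sigma>] s(1) \<sigma> by auto
  ultimately show "s \<in> K - M" by simp
qed (use simplicial_complex_finite[OF assms(1)] simplicial_complex_nonempty[OF assms(1)] in simp_all)

text \<open>The normalising sum runs over the support, so no vertex set is fixed and complexes with
  and without auxiliary apexes are compared inside one function space.\<close>

definition realization :: "'a set set \<Rightarrow> ('a \<Rightarrow> real) set" where
  "realization K = {f. (\<forall>v. 0 \<le> f v) \<and> {v. f v \<noteq> 0} \<in> K \<and> (\<Sum>v | f v \<noteq> 0. f v) = 1}"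

lemma geometric_realization_eq_realization:
  assumes "finite V" "\<And>\<sigma>. \<sigma> \<in> K \<Longrightarrow> \<sigma> \<subseteq> V"
  shows "geometric_realization V K = top_of_set (realization K)"
proof -
  have "sum f V = (\<Sum>v | f v \<noteq> 0. f v)" if "{v. f v \<noteq> 0} \<subseteq> V" for f :: "'a \<Rightarrow> real"
    using that assms(1) by (intro sum.mono_neutral_right) auto
  moreover have "{v. f v \<noteq> 0} \<subseteq> V \<longleftrightarrow> (\<forall>v. v \<notin> V \<longrightarrow> f v = 0)" for f :: "'a \<Rightarrow> real"
    by auto
  ultimately have "(\<forall>v. 0 \<le> f v) \<and> (\<forall>v. v \<notin> V \<longrightarrow> f v = 0) \<and> sum f V = 1 \<and> {v. f v \<noteq> 0} \<in> K \<longleftrightarrow>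
      (\<forall>v. 0 \<le> f v) \<and> {v. f v \<noteq> 0} \<in> K \<and> (\<Sum>v | f v \<noteq> 0. f v) = 1" for f :: "'a \<Rightarrow> real"
    using assms(2)[of "{v. f v \<noteq> 0}"] by metis
  then show ?thesis
    unfolding geometric_realization_def realization_def by simp
qed

lemma realization_sum:
  assumes "f \<in> realization K" "finite S" "{v. f v \<noteq> 0} \<subseteq> S"
  shows "sum f S = 1"
proof -
  have "sum f S = (\<Sum>v | f v \<noteq> 0. f v)"
    using assms by (intro sum.mono_neutral_right) auto
  then show ?thesis
    using assms by (simp add: realization_def)
qed

lemma realizationI:
  assumes "\<And>v. 0 \<le> f v" "{v. f v \<noteq> 0} \<in> K" "finite S" "{v. f v \<noteq> 0} \<subseteq> S" "sum f S = 1"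
  shows "f \<in> realization K"
proof -
  have "sum f S = (\<Sum>v | f v \<noteq> 0. f v)"
    using assms by (intro sum.mono_neutral_right) auto
  then show ?thesis
    using assms by (simp add: realization_def)
qed

lemma continuous_on_Min_coord:
  assumes "finite \<rho>" "\<rho> \<noteq> {}"
  shows "continuous_on S (\<lambda>f :: 'a \<Rightarrow> real. Min (f ` \<rho>))"
  using assms
proof (induction \<rho> rule: finite_ne_induct)
  case (singleton x)
  then show ?case by (simp add: continuous_on_product_coordinates continuous_on_subset[OF continuous_on_product_coordinates])
next
  case (insert x F)
  have "continuous_on S (\<lambda>f. min (f x) (Min (f ` F)))"
    by (intro continuous_on_min insert continuous_on_subset[OF continuous_on_product_coordinates]) auto
  then show ?case using insert by (simp add: Min_insert)
qed

text \<open>The condition makes the link of \<open>\<rho>\<close> a cone with apex \<open>w\<close>,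
  and the step deletes the whole open star of \<open>\<rho>\<close> at once. If no simplex of
  \<open>K\<close> contains \<open>\<rho>\<close>, the step changes nothing.\<close>

definition fold_step :: "'a set set \<Rightarrow> 'a set set \<Rightarrow> bool" where
  "fold_step K L \<longleftrightarrow> (\<exists>\<rho> w. finite \<rho> \<and> \<rho> \<noteq> {} \<and> w \<notin> \<rho> \<and>
     (\<forall>\<sigma>\<in>K. \<rho> \<subseteq> \<sigma> \<longrightarrow> insert w \<sigma> \<in> K) \<and> L = {\<sigma>\<in>K. \<not> \<rho> \<subseteq> \<sigma>})"

abbreviation collapses :: "'a set set \<Rightarrow> 'a set set \<Rightarrow> bool" where
  "collapses \<equiv> fold_step\<^sup>*\<^sup>*"

lemma fold_step_subset: "fold_step K L \<Longrightarrow> L \<subseteq> K"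
  unfolding fold_step_def by (elim exE conjE) simp

lemma fold_step_asc:
  assumes "fold_step K L" "simplicial_complex K"
  shows "simplicial_complex L"
proof -
  obtain \<rho> where L: "L = {\<sigma>\<in>K. \<not> \<rho> \<subseteq> \<sigma>}"
    using assms(1) unfolding fold_step_def by (elim exE conjE) (rule that)
  show ?thesis
  proof (rule simplicial_complexI)
    fix \<sigma> s assume \<sigma>: "\<sigma> \<in> L" and s: "s \<subseteq> \<sigma>" "s \<noteq> {}"
    then have "s \<in> K" using simplicial_complex_face[OF assms(2) _ s] unfolding L by simp
    then show "s \<in> L" using \<sigma> s unfolding L by blast
  qed (use simplicial_complex_finite[OF assms(2)] simplicial_complex_nonempty[OF assms(2)] in \<open>simp_all add: L\<close>)
qed

lemma collapses_asc: "collapses K L \<Longrightarrow> simplicial_complex K \<Longrightarrow> simplicial_complex L"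
  by (induction rule: rtranclp_induct) (simp_all add: fold_step_asc)

lemma collapses_subset: "collapses K L \<Longrightarrow> L \<subseteq> K"
proof (induction rule: rtranclp_induct)
  case (step L M)
  then show ?case using fold_step_subset[of L M] by simp
qed simp

text \<open>The deformation decreases the barycentric coordinates at \<open>\<rho>\<close> by their minimum and moves
  the removed mass to \<open>w\<close>.\<close>
lemma fold_step_homotopy_equivalent:
  fixes K :: "'a set set"
  assumes K: "simplicial_complex K" and step: "fold_step K L"
  shows "top_of_set (realization K) homotopy_equivalent_space top_of_set (realization L)"
proof -
  obtain \<rho> w where \<rho>: "finite \<rho>" "\<rho> \<noteq> {}" "w \<notin> \<rho>"
    and ins: "\<And>\<sigma>. \<sigma> \<in> K \<Longrightarrow> \<rho> \<subseteq> \<sigma> \<Longrightarrow> insert w \<sigma> \<in> K" and L: "L = {\<sigma>\<in>K. \<not> \<rho> \<subseteq> \<sigma>}"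
    using step unfolding fold_step_def by blast
  define m where "m = (\<lambda>f :: 'a \<Rightarrow> real. Min (f ` \<rho>))"
  \<comment> \<open>\<open>g\<close> sums to 0 over \<open>insert w \<rho>\<close>, which keeps the
    total mass at 1 for every \<open>s\<close>.\<close>
  define g where "g = (\<lambda>v. (if v \<in> \<rho> then - 1 else if v = w then real (card \<rho>) else 0))"
  define h where "h = (\<lambda>(s, f). \<lambda>v. f v + s * m f * g v)"
  have m_le: "m f \<le> f t" if "t \<in> \<rho>" for f t
    using that \<rho> unfolding m_def by simp
  have m_ex: "\<exists>t\<in>\<rho>. m f = f t" for f
  proof -
    have "Min (f ` \<rho>) \<in> f ` \<rho>" using \<rho> by (intro Min_in) auto
    then show ?thesis unfolding m_def by (auto elim!: imageE)
  qed
  have fin: "finite {v. f v \<noteq> 0}" if "f \<in> realization K" for f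
    using that simplicial_complex_finite[OF K] unfolding realization_def by auto
  have m_nonneg: "0 \<le> m f" if "f \<in> realization K" for f
    using m_ex[of f] that unfolding realization_def by auto
  have sub: "\<rho> \<subseteq> {v. f v \<noteq> 0}" if "f \<in> realization K" "m f \<noteq> 0" for f
    using m_le[of _ f] m_nonneg[OF that(1)] that(2) by fastforce
  have cm: "continuous_on S m" for S
    unfolding m_def using \<rho> by (intro continuous_on_Min_coord) auto
  have ch: "continuous_on S h" for S
  proof -
    have "continuous_on S (\<lambda>x. h x v)" for v
    proof -
      have "continuous_on S (\<lambda>x. snd x v + fst x * m (snd x) * g v)"
        by (intro continuous_intros continuous_on_compose2[OF cm[of UNIV]]
              continuous_on_compose2[OF continuous_on_product_coordinates]) auto
      then show ?thesis by (simp add: h_def case_prod_unfold)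
    qed
    then show ?thesis by (rule continuous_on_coordinatewise_then_product)
  qed
  have nonneg: "0 \<le> h (s, f) v" if "f \<in> realization K" "0 \<le> s" "s \<le> 1" for s f v
  proof (cases "v \<in> \<rho>")
    case True
    have "s * m f \<le> m f" using that m_nonneg by (simp add: mult_left_le_one_le)
    also have "\<dots> \<le> f v" using m_le True by simp
    finally show ?thesis using True by (simp add: h_def g_def)
  next
    case False
    then show ?thesis using that m_nonneg[OF that(1)] by (auto simp: h_def g_def realization_def)
  qed
  have hK: "h (s, f) \<in> realization K" if f: "f \<in> realization K" and s: "0 \<le> s" "s \<le> 1" for s f
  proof (cases "m f = 0")
    case True
    then show ?thesis using f by (simp add: h_def)
  next
    case False
    have S: "insert w {v. f v \<noteq> 0} \<in> K"
      using ins sub[OF f False] f by (auto simp: realization_def)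
    have supp: "{v. h (s, f) v \<noteq> 0} \<subseteq> insert w {v. f v \<noteq> 0}"
      using sub[OF f False] by (auto simp: h_def g_def split: if_splits)
    have "sum g (insert w {v. f v \<noteq> 0}) = sum g (insert w \<rho>)"
      using sub[OF f False] fin[OF f] by (intro sum.mono_neutral_right) (auto simp: g_def)
    also have "\<dots> = 0" using \<rho> by (simp add: g_def)
    finally have "sum g (insert w {v. f v \<noteq> 0}) = 0" .
    moreover have "sum f (insert w {v. f v \<noteq> 0}) = 1"
      using realization_sum[OF f] fin[OF f] by blast
    ultimately have sum1: "sum (h (s, f)) (insert w {v. f v \<noteq> 0}) = 1"
      by (simp add: h_def sum.distrib flip: sum_distrib_left)
    have "{v. h (s, f) v \<noteq> 0} \<noteq> {}"
    proof
      assume "{v. h (s, f) v \<noteq> 0} = {}"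
      then have "\<And>v. h (s, f) v = 0" by blast
      then show False using sum1 by simp
    qed
    then have "{v. h (s, f) v \<noteq> 0} \<in> K" using simplicial_complex_face[OF K S supp] by simp
    then show ?thesis
      using nonneg[OF f s] fin[OF f] supp sum1 by (intro realizationI[where S = "insert w {v. f v \<noteq> 0}"]) auto
  qed
  have hL: "h (1, f) \<in> realization L" if f: "f \<in> realization K" for f
  proof -
    obtain t where "t \<in> \<rho>" "m f = f t" using m_ex by blast
    then have "h (1, f) t = 0" by (simp add: h_def g_def)
    then have "\<not> \<rho> \<subseteq> {v. h (1, f) v \<noteq> 0}" using \<open>t \<in> \<rho>\<close> by blast
    then show ?thesis using hK[OF f, of 1] by (auto simp: realization_def L)
  qed
  \<comment> \<open>A point of \<open>L\<close> has a zero coordinate on \<open>\<rho>\<close>, so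
    \<open>m\<close> vanishes there and the deformation fixes it throughout.\<close>
  have h0: "h (s, f) = f" if "f \<in> realization L" for s f
  proof -
    have f: "f \<in> realization K" "\<not> \<rho> \<subseteq> {v. f v \<noteq> 0}" using that by (auto simp: realization_def L)
    then have "m f = 0" using sub by blast
    then show ?thesis by (simp add: h_def)
  qed
  have LK: "realization L \<subseteq> realization K" by (auto simp: realization_def L)
  have cont1: "continuous_on S (\<lambda>f. h (1, f))" for S
    by (intro continuous_on_compose2[OF ch[of UNIV]] continuous_intros) auto
  have "homotopic_with (\<lambda>x. True) (top_of_set (realization K)) (top_of_set (realization K)) id (\<lambda>f. h (1, f))"
    unfolding homotopic_with_def
    using ch hK by (intro exI[of _ h]) (auto simp: prod_topology_subtopology subtopology_subtopology Int_absorb1 Int_absorb2 image_subset_iff h_def)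
  then have "homotopic_with (\<lambda>x. True) (top_of_set (realization K)) (top_of_set (realization K)) (\<lambda>f. h (1, f)) id"
    by (rule homotopic_with_symD)
  moreover have "retraction_maps (top_of_set (realization K)) (top_of_set (realization L)) (\<lambda>f. h (1, f)) id"
    using cont1 hL h0 LK by (auto simp: retraction_maps_def continuous_on_id)
  ultimately show ?thesis
    by (rule deformation_retract_imp_homotopy_equivalent_space)
qed

lemma collapses_homotopy_equivalent:
  "collapses K L \<Longrightarrow> simplicial_complex K \<Longrightarrow> top_of_set (realization K) homotopy_equivalent_space top_of_set (realization L)"
proof (induction rule: rtranclp_induct)
  case base
  show ?case using homotopy_equivalent_space_refl by blast
next
  case (step L M)
  then show ?case
    by (meson collapses_asc fold_step_homotopy_equivalent homotopy_eqv_trans)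
qed

text \<open>Faces are folded in order of increasing rank. When the turn of \<open>\<rho> j\<close>
  comes, the faces of smaller rank are gone, so its apex is tested only on simplices avoiding them.
  The enlarged simplex must not contain a face folded earlier, and only faces through
  \<open>w\<close> can be newly covered. Ties may be processed in any order, whence \<open><\<close>
  in the first condition and \<open>\<le>\<close> in the second.\<close>

lemma collapses_family:
  assumes "finite J"
    and "\<And>j. j \<in> J \<Longrightarrow> finite (\<rho> j) \<and> \<rho> j \<noteq> {}"
    and "\<And>j. j \<in> J \<Longrightarrow> \<exists>w. w \<notin> \<rho> j \<and> (\<forall>\<sigma>\<in>K. \<rho> j \<subseteq> \<sigma> \<longrightarrow>
           (\<forall>i\<in>J. rk i < rk j \<longrightarrow> \<not> \<rho> i \<subseteq> \<sigma>) \<longrightarrow> insert w \<sigma> \<in> K \<and>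
           (\<forall>i\<in>J. rk i \<le> (rk j :: int) \<longrightarrow> w \<in> \<rho> i \<longrightarrow> \<not> \<rho> i \<subseteq> insert w \<sigma>))"
  shows "collapses K {\<sigma>\<in>K. \<forall>j\<in>J. \<not> \<rho> j \<subseteq> \<sigma>}"
  using assms
proof (induction "card J" arbitrary: J)
  case 0
  then show ?case by simp
next
  case (Suc n)
  have "J \<noteq> {}" using Suc.hyps(2) by auto
  then have "Max (rk ` J) \<in> rk ` J" using Suc.prems(1) by simp
  \<comment> \<open>An element of largest rank is folded last; the induction hypothesis handles the
    others.\<close>
  then obtain j where "j \<in> J" "Max (rk ` J) = rk j" by blast
  then have j: "j \<in> J" "\<And>i. i \<in> J \<Longrightarrow> rk i \<le> rk j"
    using Max_ge[of "rk ` J"] Suc.prems(1) by auto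
  let ?J = "J - {j}"
  let ?L = "{\<sigma>\<in>K. \<forall>j\<in>?J. \<not> \<rho> j \<subseteq> \<sigma>}"
  have "collapses K ?L"
  proof (rule Suc.hyps(1))
    show "n = card ?J" using Suc.hyps(2) Suc.prems(1) j by simp
    fix i assume i: "i \<in> ?J"
    have lt: "(\<forall>a\<in>?J. rk a < rk i \<longrightarrow> \<not> \<rho> a \<subseteq> \<sigma>) \<Longrightarrow> (\<forall>a\<in>J. rk a < rk i \<longrightarrow> \<not> \<rho> a \<subseteq> \<sigma>)" for \<sigma>
      using i j(2)[of i] by force
    have iJ: "i \<in> J" using i by simp
    obtain w where w: "w \<notin> \<rho> i" "\<forall>\<sigma>\<in>K. \<rho> i \<subseteq> \<sigma> \<longrightarrow>
           (\<forall>a\<in>J. rk a < rk i \<longrightarrow> \<not> \<rho> a \<subseteq> \<sigma>) \<longrightarrow> insert w \<sigma> \<in> K \<and>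
           (\<forall>a\<in>J. rk a \<le> rk i \<longrightarrow> w \<in> \<rho> a \<longrightarrow> \<not> \<rho> a \<subseteq> insert w \<sigma>)"
      using Suc.prems(3)[OF iJ] by (elim exE conjE) (rule that)
    show "\<exists>w. w \<notin> \<rho> i \<and> (\<forall>\<sigma>\<in>K. \<rho> i \<subseteq> \<sigma> \<longrightarrow>
           (\<forall>a\<in>?J. rk a < rk i \<longrightarrow> \<not> \<rho> a \<subseteq> \<sigma>) \<longrightarrow> insert w \<sigma> \<in> K \<and>
           (\<forall>a\<in>?J. rk a \<le> rk i \<longrightarrow> w \<in> \<rho> a \<longrightarrow> \<not> \<rho> a \<subseteq> insert w \<sigma>))"
    proof (intro exI[of _ w] conjI ballI impI)
      fix \<sigma> assume \<sigma>: "\<sigma> \<in> K" "\<rho> i \<subseteq> \<sigma>" "\<forall>a\<in>?J. rk a < rk i \<longrightarrow> \<not> \<rho> a \<subseteq> \<sigma>"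
      show "insert w \<sigma> \<in> K" using w(2) \<sigma>(1,2) lt[OF \<sigma>(3)] by simp
      fix a assume "a \<in> ?J" "rk a \<le> rk i" "w \<in> \<rho> a"
      then show "\<not> \<rho> a \<subseteq> insert w \<sigma>" using w(2) \<sigma>(1,2) lt[OF \<sigma>(3)] by simp
    qed (rule w(1))
  qed (use Suc.prems in auto)
  moreover have "fold_step ?L {\<sigma>\<in>K. \<forall>j\<in>J. \<not> \<rho> j \<subseteq> \<sigma>}"
  proof -
    obtain w where w: "w \<notin> \<rho> j" "\<forall>\<sigma>\<in>K. \<rho> j \<subseteq> \<sigma> \<longrightarrow>
           (\<forall>i\<in>J. rk i < rk j \<longrightarrow> \<not> \<rho> i \<subseteq> \<sigma>) \<longrightarrow> insert w \<sigma> \<in> K \<and>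
           (\<forall>i\<in>J. rk i \<le> rk j \<longrightarrow> w \<in> \<rho> i \<longrightarrow> \<not> \<rho> i \<subseteq> insert w \<sigma>)"
      using Suc.prems(3)[OF j(1)] by (elim exE conjE) (rule that)
    have "insert w \<sigma> \<in> ?L" if \<sigma>: "\<sigma> \<in> ?L" "\<rho> j \<subseteq> \<sigma>" for \<sigma>
    proof -
      have "\<forall>i\<in>J. rk i < rk j \<longrightarrow> \<not> \<rho> i \<subseteq> \<sigma>" using \<sigma> by blast
      then have *: "insert w \<sigma> \<in> K" "\<And>i. i \<in> J \<Longrightarrow> w \<in> \<rho> i \<Longrightarrow> \<not> \<rho> i \<subseteq> insert w \<sigma>"
        using w(2) \<sigma> j(2) by simp_all
      moreover have "\<not> \<rho> i \<subseteq> insert w \<sigma>" if "i \<in> ?J" for i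
        using *(2)[of i] \<sigma> that by (cases "w \<in> \<rho> i") auto
      ultimately show ?thesis by blast
    qed
    then show ?thesis unfolding fold_step_def using w(1) Suc.prems(2) j(1)
      by (intro exI[of _ "\<rho> j"] exI[of _ w]) auto
  qed
  ultimately show ?case by (rule rtranclp.rtrancl_into_rtrancl)
qed

text \<open>Apexes lying in none of the faces can never create a new member of the family, so a
  constant rank suffices.\<close>

lemma collapses_family_apex:
  assumes "finite J"
    and "\<And>j. j \<in> J \<Longrightarrow> finite (\<rho> j) \<and> \<rho> j \<noteq> {}"
    and "\<And>j. j \<in> J \<Longrightarrow> \<exists>w. (\<forall>i\<in>J. w \<notin> \<rho> i) \<and> (\<forall>\<sigma>\<in>K. \<rho> j \<subseteq> \<sigma> \<longrightarrow> insert w \<sigma> \<in> K)"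
  shows "collapses K {\<sigma>\<in>K. \<forall>j\<in>J. \<not> \<rho> j \<subseteq> \<sigma>}"
proof (rule collapses_family[where rk = "\<lambda>_. 0", OF assms(1,2)])
  fix j assume j: "j \<in> J"
  obtain w where w: "\<forall>i\<in>J. w \<notin> \<rho> i" "\<forall>\<sigma>\<in>K. \<rho> j \<subseteq> \<sigma> \<longrightarrow> insert w \<sigma> \<in> K"
    using assms(3)[OF j] by (elim exE conjE) (rule that)
  then show "\<exists>w. w \<notin> \<rho> j \<and> (\<forall>\<sigma>\<in>K. \<rho> j \<subseteq> \<sigma> \<longrightarrow>
      (\<forall>i\<in>J. 0 < (0::int) \<longrightarrow> \<not> \<rho> i \<subseteq> \<sigma>) \<longrightarrow> insert w \<sigma> \<in> K \<and>
      (\<forall>i\<in>J. 0 \<le> (0::int) \<longrightarrow> w \<in> \<rho> i \<longrightarrow> \<not> \<rho> i \<subseteq> insert w \<sigma>))"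
    using j by (intro exI[of _ w]) simp
qed

section \<open>Cones with fresh apexes, and folds of their bases\<close>

definition cones :: "'a set set \<Rightarrow> 'a set \<Rightarrow> ('a \<Rightarrow> 'a set set) \<Rightarrow> 'a set set" where
  "cones K I R = K \<union> (\<Union>c\<in>I. insert c ` insert {} (R c))"

lemma simplicial_complex_cones:
  assumes "simplicial_complex K" "\<And>c. c \<in> I \<Longrightarrow> simplicial_complex (R c) \<and> R c \<subseteq> K"
  shows "simplicial_complex (cones K I R)"
proof (rule simplicial_complexI)
  fix \<sigma> assume "\<sigma> \<in> cones K I R"
  then consider "\<sigma> \<in> K" | c t where "c \<in> I" "t \<in> insert {} (R c)" "\<sigma> = insert c t"
    unfolding cones_def by blast
  note \<sigma> = this
  show "finite \<sigma>" "\<sigma> \<noteq> {}"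
    using \<sigma> simplicial_complex_finite assms simplicial_complex_nonempty[OF assms(1)] by (metis finite.emptyI finite_insert insertE insert_not_empty)+
  fix s assume s: "s \<subseteq> \<sigma>" "s \<noteq> {}"
  show "s \<in> cones K I R"
    using \<sigma>
  proof cases
    case 1
    then show ?thesis using simplicial_complex_face[OF assms(1) _ s] by (simp add: cones_def)
  next
    case 2
    have R: "simplicial_complex (R c)" "R c \<subseteq> K" using assms(2)[OF 2(1)] by auto
    have down: "s' \<in> insert {} (R c)" if "s' \<subseteq> t" for s'
      using that 2(2) simplicial_complex_face[OF R(1)] by (cases "s' = {}") auto
    show ?thesis
    proof (cases "c \<in> s")
      case True
      have "s - {c} \<subseteq> t" using s 2(3) by blast
      from down[OF this] have "insert c (s - {c}) \<in> insert c ` insert {} (R c)" by (rule imageI)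
      then show ?thesis using 2(1) True by (auto simp: cones_def insert_absorb)
    next
      case False
      then have "s \<subseteq> t" using s 2(3) by blast
      then have "s \<in> K" using down s R(2) by blast
      then show ?thesis by (simp add: cones_def)
    qed
  qed
qed

text \<open>A fold of the base at \<open>\<rho>\<close> becomes a fold of the cone at
  \<open>insert c \<rho>\<close> with the same \<open>w\<close>. Simplices of \<open>K\<close> are
  untouched because none contains \<open>c\<close>; only the cone shrinks, while its former base
  stays in \<open>K\<close>.\<close>

lemma collapses_cone:
  assumes "collapses R R'" "simplicial_complex R" "R \<subseteq> K" "c \<notin> \<Union>K"
  shows "collapses (K \<union> insert c ` insert {} R) (K \<union> insert c ` insert {} R')"
  using assms(1)
proof (induction rule: rtranclp_induct)
  case base
  show ?case by (rule rtranclp.rtrancl_refl)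
next
  case (step R1 R2)
  have c: "c \<notin> \<sigma>" if "\<sigma> \<in> K" for \<sigma> using assms(4) that by blast
  have R1: "R1 \<subseteq> K" using collapses_subset[OF step(1)] assms(3) by simp
  have R2: "R2 \<subseteq> R1" by (rule fold_step_subset) fact
  obtain \<rho> w where \<rho>: "finite \<rho>" "\<rho> \<noteq> {}" "w \<notin> \<rho>"
    and ins: "\<forall>\<sigma>\<in>R1. \<rho> \<subseteq> \<sigma> \<longrightarrow> insert w \<sigma> \<in> R1" and R2_eq: "R2 = {\<sigma>\<in>R1. \<not> \<rho> \<subseteq> \<sigma>}"
    using step(2) unfolding fold_step_def by (elim exE conjE) (rule that)
  let ?Y = "\<lambda>R. K \<union> insert c ` insert {} R"
  show ?case
  \<comment> \<open>A vacuous fold is treated apart: that \<open>c\<close> differs from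
    \<open>w\<close> and lies outside \<open>\<rho>\<close> is read off from a simplex of
    \<open>R1\<close> containing \<open>\<rho>\<close>.\<close>
  proof (cases "\<exists>\<sigma>\<in>R1. \<rho> \<subseteq> \<sigma>")
    case False
    then have "R2 = R1" unfolding R2_eq by blast
    then show ?thesis using step(3) by simp
  next
    case True
    then obtain \<sigma>0 where \<sigma>0: "\<sigma>0 \<in> R1" "\<rho> \<subseteq> \<sigma>0" by (elim bexE)
    then have "insert w \<sigma>0 \<in> K" using ins R1 by (simp add: subsetD)
    from c[OF this] have cw: "c \<noteq> w" "c \<notin> \<rho>" using \<sigma>0(2) by auto
    have tc: "insert c \<rho> \<subseteq> insert c t \<longleftrightarrow> \<rho> \<subseteq> t" for t using cw by blast
    have "fold_step (?Y R1) (?Y R2)"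
      unfolding fold_step_def
    proof (intro exI[of _ "insert c \<rho>"] exI[of _ w] conjI ballI impI)
      fix \<sigma> assume \<sigma>: "\<sigma> \<in> ?Y R1" "insert c \<rho> \<subseteq> \<sigma>"
      then have "\<sigma> \<notin> K" using c by blast
      then obtain t where t: "t \<in> insert {} R1" "\<sigma> = insert c t" using \<sigma>(1) by blast
      then have "\<rho> \<subseteq> t" using \<sigma>(2) tc by simp
      then have "insert w t \<in> R1" using ins t(1) \<rho>(2) by auto
      then show "insert w \<sigma> \<in> ?Y R1" unfolding t(2) insert_commute[of w] by blast
    next
      have "\<sigma> \<in> ?Y R2 \<longleftrightarrow> \<sigma> \<in> ?Y R1 \<and> \<not> insert c \<rho> \<subseteq> \<sigma>" for \<sigma>
      proof (cases "\<sigma> \<in> K")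
        case True
        then show ?thesis using c[of \<sigma>] by blast
      next
        case False
        show ?thesis
        proof
          assume "\<sigma> \<in> ?Y R2"
          then obtain t where t: "t \<in> insert {} R2" "\<sigma> = insert c t" using False by blast
          then have "t \<in> insert {} R1 \<and> \<not> \<rho> \<subseteq> t" using \<rho>(2) unfolding R2_eq by auto
          then show "\<sigma> \<in> ?Y R1 \<and> \<not> insert c \<rho> \<subseteq> \<sigma>" unfolding t(2) tc by blast
        next
          assume *: "\<sigma> \<in> ?Y R1 \<and> \<not> insert c \<rho> \<subseteq> \<sigma>"
          then obtain t where t: "t \<in> insert {} R1" "\<sigma> = insert c t" using False by blast
          then have "t \<in> insert {} R2" using * tc unfolding R2_eq by auto
          then show "\<sigma> \<in> ?Y R2" unfolding t(2) by blast
        qed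
      qed
      then show "?Y R2 = {\<sigma> \<in> ?Y R1. \<not> insert c \<rho> \<subseteq> \<sigma>}" by blast
    qed (use \<rho> cw in auto)
    with step(3) show ?thesis by (rule rtranclp.rtrancl_into_rtrancl)
  qed
qed

text \<open>One apex is treated at a time; the cones over the other apexes then count as part of the
  ambient complex, in which the current apex does not occur.\<close>

lemma collapses_cones:
  assumes "finite I" "simplicial_complex K" "\<And>c. c \<in> I \<Longrightarrow> simplicial_complex (R c) \<and> R c \<subseteq> K \<and> collapses (R c) (R' c)" "I \<inter> \<Union>K = {}"
  shows "collapses (cones K I R) (cones K I R')"
proof -
  have "collapses (cones K I R) (cones K I (\<lambda>c. if c \<in> J then R' c else R c))" if "finite J" "J \<subseteq> I" for J
    using that
  proof (induction J rule: finite_induct)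
    case empty
    then show ?case by simp
  next
    case (insert j J)
    define S where "S = (\<lambda>c. if c \<in> J then R' c else R c)"
    define S' where "S' = (\<lambda>c. if c \<in> insert j J then R' c else R c)"
    have j: "j \<in> I" "j \<notin> J" using insert by auto
    have IH: "collapses (cones K I R) (cones K I S)" using insert unfolding S_def by simp
    define L where "L = cones K (I - {j}) S"
    have sub: "S c \<subseteq> K" if "c \<in> I" for c
      using assms(3)[OF that] collapses_subset[of "R c" "R' c"] unfolding S_def by auto
    have jK: "j \<notin> \<Union>K" using j(1) assms(4) by blast
    have "j \<notin> \<sigma>" if "\<sigma> \<in> L" for \<sigma>
      using that sub jK unfolding L_def cones_def by blast
    then have "j \<notin> \<Union>L" by blast
    moreover have "R j \<subseteq> L" using assms(3)[OF j(1)] unfolding L_def cones_def by auto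
    ultimately have "collapses (L \<union> insert j ` insert {} (R j)) (L \<union> insert j ` insert {} (R' j))"
      using assms(3)[OF j(1)] by (intro collapses_cone) auto
    moreover have I: "I = insert j (I - {j})" using j(1) by blast
    have "cones K I S = L \<union> insert j ` insert {} (S j)"
      unfolding L_def cones_def by (subst I) (simp only: UN_insert Un_ac)
    moreover have "cones K I S' = L \<union> insert j ` insert {} (S' j)"
    proof -
      have "(\<Union>c\<in>I - {j}. insert c ` insert {} (S c)) = (\<Union>c\<in>I - {j}. insert c ` insert {} (S' c))"
        unfolding S_def S'_def by (intro SUP_cong) auto
      then show ?thesis
        unfolding L_def cones_def by (subst I) (simp only: UN_insert Un_ac)
    qed
    moreover have "S j = R j" "S' j = R' j" using j unfolding S_def S'_def by auto
    ultimately have "collapses (cones K I S) (cones K I S')" by simp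
    with IH show ?case unfolding S'_def[symmetric] by (rule rtranclp_trans)
  qed
  from this[of I] have "collapses (cones K I R) (cones K I (\<lambda>c. if c \<in> I then R' c else R c))"
    using assms(1) by simp
  moreover have "cones K I (\<lambda>c. if c \<in> I then R' c else R c) = cones K I R'"
    unfolding cones_def by simp
  ultimately show ?thesis by simp
qed

section \<open>Wedges of tetrahedron boundaries\<close>

text \<open>In barycentric terms 1 - (x$1 + x$2 + x$3) is the fourth coordinate, at the vertex 0,
  and the boundary consists of the points with some vanishing coordinate.\<close>

lemma frontier_std_simplex_3:
  "rel_frontier (convex hull (insert 0 Basis) :: (real^3) set) =
     {x. 0 \<le> x$1 \<and> 0 \<le> x$2 \<and> 0 \<le> x$3 \<and> x$1 + x$2 + x$3 \<le> 1 \<and>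
         (x$1 = 0 \<or> x$2 = 0 \<or> x$3 = 0 \<or> x$1 + x$2 + x$3 = 1)}"
proof -
  let ?S = "convex hull (insert 0 Basis) :: (real^3) set"
  have basis: "(\<forall>i\<in>Basis. 0 \<le> x \<bullet> i) \<longleftrightarrow> 0 \<le> x$1 \<and> 0 \<le> x$2 \<and> 0 \<le> x$3"
    "(\<forall>i\<in>Basis. 0 < x \<bullet> i) \<longleftrightarrow> 0 < x$1 \<and> 0 < x$2 \<and> 0 < x$3" for x :: "real^3"
    by (simp_all add: Basis_vec_def inner_axis forall_3)
  have inj: "inj (\<lambda>k. axis k (1::real) :: real^3)" by (auto simp: inj_on_def axis_eq_axis)
  have Basis: "(Basis :: (real^3) set) = range (\<lambda>k. axis k 1)" by (auto simp: Basis_vec_def)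
  have sum: "(\<Sum>i\<in>Basis. x \<bullet> i) = x$1 + x$2 + x$3" for x :: "real^3"
    unfolding Basis sum.reindex[OF inj] by (simp add: inner_axis sum_3)
  have "compact ?S" by (intro finite_imp_compact_convex_hull) simp
  then have cl: "closure ?S = ?S" by (simp add: compact_imp_closed)
  have "interior ?S \<noteq> {}" using interior_std_simplex_nonempty by blast
  then have "rel_frontier ?S = frontier ?S" by (rule rel_frontier_nonempty_interior)
  also have "\<dots> = ?S - interior ?S" unfolding frontier_def cl ..
  also have "\<dots> = {x. 0 \<le> x$1 \<and> 0 \<le> x$2 \<and> 0 \<le> x$3 \<and> x$1 + x$2 + x$3 \<le> 1 \<and>
         (x$1 = 0 \<or> x$2 = 0 \<or> x$3 = 0 \<or> x$1 + x$2 + x$3 = 1)}"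
    unfolding interior_std_simplex unfolding std_simplex basis sum
    by (rule set_eqI) (simp, linarith)
  finally show ?thesis .
qed

text \<open>Frontiers of convex bodies of equal dimension are homeomorphic, but such a homeomorphism
  may send the vertex \<open>p\<close> anywhere on the sphere. An orthogonal map about the centre
  \<open>z\<close> moves its image to the origin, the future wedge point.\<close>

lemma tetrahedron_boundary_homeomorphism:
  fixes a b c p :: 'a and z :: "real^3"
  assumes abc: "distinct [p, a, b, c]" and r: "norm z = r" "r > 0"
  defines "B \<equiv> realization {\<sigma>. \<sigma> \<noteq> {} \<and> \<sigma> \<subset> {p, a, b, c}}"
  shows "\<exists>h g. homeomorphism B (sphere z r) h g \<and> h (\<lambda>v. if v = p then 1 else 0) = 0"
proof -
  let ?S = "convex hull (insert 0 Basis) :: (real^3) set"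
  let ?F = "rel_frontier ?S"
  define \<phi> where "\<phi> = (\<lambda>(x::real^3) v. if v = a then x$1 else if v = b then x$2 else if v = c then x$3
      else if v = p then 1 - (x$1 + x$2 + x$3) else (0::real))"
  define \<psi> where "\<psi> = (\<lambda>f. vector [f a, f b, f c] :: real^3)"
  have ne: "a \<noteq> b" "a \<noteq> c" "b \<noteq> c" "p \<noteq> a" "p \<noteq> b" "p \<noteq> c" using abc by auto
  have sum4: "sum f {p, a, b, c} = f p + f a + f b + f c" for f :: "'a \<Rightarrow> real"
    using ne by simp
  have B: "f \<in> B \<longleftrightarrow> (\<forall>v. 0 \<le> f v) \<and> (\<forall>v. v \<notin> {p, a, b, c} \<longrightarrow> f v = 0) \<and>
      f p + f a + f b + f c = 1 \<and> (f p = 0 \<or> f a = 0 \<or> f b = 0 \<or> f c = 0)" (is "_ \<longleftrightarrow> ?R") for f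
  proof
    assume f: "f \<in> B"
    then have "\<forall>v. 0 \<le> f v" "{v. f v \<noteq> 0} \<subset> {p, a, b, c}" unfolding B_def realization_def by auto
    moreover have "sum f {p, a, b, c} = 1"
      using f calculation(2) unfolding B_def by (intro realization_sum) auto
    ultimately show ?R unfolding sum4 by auto
  next
    assume f: ?R
    show "f \<in> B" unfolding B_def
    proof (rule realizationI[of _ _ "{p, a, b, c}"])
      show "{v. f v \<noteq> 0} \<in> {\<sigma>. \<sigma> \<noteq> {} \<and> \<sigma> \<subset> {p, a, b, c}}"
      proof -
        have "\<exists>v. f v \<noteq> 0"
        proof (rule ccontr)
          assume "\<not> ?thesis"
          then have "f p + f a + f b + f c = 0" by simp
          then show False using f by simp
        qed
        moreover have "{v. f v \<noteq> 0} \<subseteq> {p, a, b, c}" "{v. f v \<noteq> 0} \<noteq> {p, a, b, c}" using f by blast+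
        ultimately show ?thesis by blast
      qed
    qed (use f in \<open>auto simp: sum4 simp del: sum.insert\<close>)
  qed
  have F: "x \<in> ?F \<longleftrightarrow> 0 \<le> x$1 \<and> 0 \<le> x$2 \<and> 0 \<le> x$3 \<and> x$1 + x$2 + x$3 \<le> 1 \<and>
         (x$1 = 0 \<or> x$2 = 0 \<or> x$3 = 0 \<or> x$1 + x$2 + x$3 = 1)" for x
    unfolding frontier_std_simplex_3 by simp
  have hom1: "homeomorphism B ?F \<psi> \<phi>"
  proof (rule homeomorphismI)
    have \<psi>: "\<psi> = (\<lambda>f. \<chi> i. if i = 1 then f a else if i = 2 then f b else f c)"
      unfolding \<psi>_def by (rule ext) (simp add: vec_eq_iff forall_3)
    have cp: "continuous_on B (\<lambda>f. f v)" for v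
      by (rule continuous_on_subset[OF continuous_on_product_coordinates]) simp
    have "continuous_on B (\<lambda>f. if i = 1 then f a else if i = 2 then f b else f c)" for i :: 3
      by (cases "i = 1"; cases "i = 2") (simp_all add: cp)
    then show "continuous_on B \<psi>" unfolding \<psi> by (intro continuous_on_vec_lambda)
    have "continuous_on ?F (\<lambda>x. \<phi> x v)" for v
      unfolding \<phi>_def
      by (cases "v = a"; cases "v = b"; cases "v = c"; cases "v = p") (auto intro!: continuous_intros)
    then show "continuous_on ?F \<phi>" by (rule continuous_on_coordinatewise_then_product)
    show "\<psi> ` B \<subseteq> ?F"
    proof
      fix x assume "x \<in> \<psi> ` B"
      then obtain f where f: "f \<in> B" "x = \<psi> f" by blast
      have "0 \<le> f p" "0 \<le> f a" "0 \<le> f b" "0 \<le> f c" using f(1) unfolding B by blast+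
      moreover have "f p + f a + f b + f c = 1" "f p = 0 \<or> f a = 0 \<or> f b = 0 \<or> f c = 0"
        using f(1) unfolding B by blast+
      moreover have "x$1 = f a" "x$2 = f b" "x$3 = f c" using f(2) by (simp_all add: \<psi>_def)
      ultimately show "x \<in> ?F" unfolding F by auto
    qed
    show "\<phi> ` ?F \<subseteq> B"
    proof
      fix f assume "f \<in> \<phi> ` ?F"
      then obtain x where x: "x \<in> ?F" "f = \<phi> x" by blast
      then show "f \<in> B" unfolding B F using ne by (auto simp: \<phi>_def)
    qed
    show "\<phi> (\<psi> f) = f" if "f \<in> B" for f
    proof
      fix v
      show "\<phi> (\<psi> f) v = f v" using that ne unfolding B by (auto simp: \<phi>_def \<psi>_def)
    qed
    show "\<psi> (\<phi> x) = x" if "x \<in> ?F" for x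
      using ne by (simp add: \<psi>_def \<phi>_def vec_eq_iff forall_3)
  qed
  have "?F homeomorphic rel_frontier (cball z r)"
  proof (rule homeomorphic_rel_frontiers_convex_bounded_sets)
    have "interior ?S \<noteq> {}" using interior_std_simplex_nonempty by blast
    then show "aff_dim ?S = aff_dim (cball z r)"
      using r by (simp add: aff_dim_nonempty_interior aff_dim_cball)
    have "compact ?S" by (intro finite_imp_compact_convex_hull) simp
    then show "bounded ?S" by (rule compact_imp_bounded)
  qed auto
  then obtain h1 g1 where hom2: "homeomorphism ?F (sphere z r) h1 g1"
    using r by (auto simp: homeomorphic_def)
  have "0 \<in> ?F" by (simp add: F)
  then have "h1 0 \<in> sphere z r" using hom2 unfolding homeomorphism_def by blast
  \<comment> \<open>Here \<open>norm z = r\<close> enters: the origin lies on the sphere, at the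
    same distance from \<open>z\<close> as the image of the vertex \<open>p\<close>.\<close>
  then have "norm (h1 0 - z) = norm (0 - z)" using r by (simp add: dist_norm norm_minus_commute)
  then obtain q where q: "orthogonal_transformation q" "q (h1 0 - z) = 0 - z"
    by (rule orthogonal_transformation_exists)
  have iq: "orthogonal_transformation (inv q)" by (rule orthogonal_transformation_inv[OF q(1)])
  have bq: "bij q" using orthogonal_transformation_bij q(1) by blast
  have hom3: "homeomorphism (sphere z r) (sphere z r) (\<lambda>x. z + q (x - z)) (\<lambda>x. z + inv q (x - z))"
  proof (rule homeomorphismI)
    have cont: "continuous_on (sphere z r) (\<lambda>x. z + u (x - z))" if "orthogonal_transformation u" for u
    proof -
      have "bounded_linear u"
        using that unfolding orthogonal_transformation_def using linear_conv_bounded_linear by blast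
      then show ?thesis
        by (intro continuous_on_add[OF continuous_on_const bounded_linear.continuous_on[of u]])
          (simp_all add: continuous_on_diff)
    qed
    show "continuous_on (sphere z r) (\<lambda>x. z + q (x - z))" by (rule cont[OF q(1)])
    show "continuous_on (sphere z r) (\<lambda>x. z + inv q (x - z))" by (rule cont[OF iq])
    have sph: "z + y \<in> sphere z r \<longleftrightarrow> norm y = r" for y by (simp add: dist_norm)
    have "norm (x - z) = r" if "x \<in> sphere z r" for x
      using that by (simp add: dist_norm norm_minus_commute)
    then show "(\<lambda>x. z + q (x - z)) ` sphere z r \<subseteq> sphere z r"
      "(\<lambda>x. z + inv q (x - z)) ` sphere z r \<subseteq> sphere z r"
      unfolding image_subset_iff sph
      by (simp_all add: orthogonal_transformation_norm[OF q(1)] orthogonal_transformation_norm[OF iq])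
  qed (simp_all add: inv_f_f[OF bij_is_inj[OF bq]] surj_f_inv_f[OF bij_is_surj[OF bq]])
  have "homeomorphism B (sphere z r) ((\<lambda>x. z + q (x - z)) \<circ> (h1 \<circ> \<psi>)) ((\<phi> \<circ> g1) \<circ> (\<lambda>x. z + inv q (x - z)))"
    by (intro homeomorphism_compose[OF homeomorphism_compose[OF hom1 hom2] hom3])
  moreover have "\<psi> (\<lambda>v. if v = p then 1 else 0) = 0"
    using ne by (auto simp: \<psi>_def vec_eq_iff forall_3)
  then have "((\<lambda>x. z + q (x - z)) \<circ> (h1 \<circ> \<psi>)) (\<lambda>v. if v = p then 1 else 0) = 0"
    using q(2) by simp
  ultimately show ?thesis by blast
qed

text \<open>Disjointness of the triangles makes two tetrahedron boundaries meet only in the vertex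
  \<open>p\<close>, just as two model spheres meet only in the origin. The pieces are closed and
  finite in number, so homeomorphisms matching these points glue in both directions.\<close>

lemma realization_wedge_homeomorphic:
  fixes T :: "'a set set"
  assumes T: "finite T" "\<And>\<tau>. \<tau> \<in> T \<Longrightarrow> card \<tau> = 3 \<and> p \<notin> \<tau>"
    "\<And>\<tau> \<tau>'. \<tau> \<in> T \<Longrightarrow> \<tau>' \<in> T \<Longrightarrow> \<tau> \<noteq> \<tau>' \<Longrightarrow> \<tau> \<inter> \<tau>' = {}"
  shows "top_of_set (realization {\<sigma>. \<sigma> \<noteq> {} \<and> (\<exists>\<tau>\<in>T. \<sigma> \<subset> insert p \<tau>)}) homeomorphic_space
    wedge_of_2spheres (card T)"
proof -
  define m where "m = card T"
  let ?W = "realization {\<sigma>. \<sigma> \<noteq> {} \<and> (\<exists>\<tau>\<in>T. \<sigma> \<subset> insert p \<tau>)}"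
  define S where "S = (\<lambda>i::nat. sphere (vector [real i, 0, 0] :: real^3) (real i))"
  define \<delta> where "\<delta> = (\<lambda>v. if v = p then 1 else (0::real))"
  obtain e where e: "bij_betw e {1..m} T"
    using ex_bij_betw_nat_finite_1[OF T(1)] unfolding m_def by blast
  define B where "B = (\<lambda>i. realization {\<sigma>. \<sigma> \<noteq> {} \<and> \<sigma> \<subset> insert p (e i)})"
  have eT: "e i \<in> T" if "i \<in> {1..m}" for i using e that bij_betwE by blast
  have "\<exists>h g. homeomorphism (B i) (S i) h g \<and> h \<delta> = 0" if i: "i \<in> {1..m}" for i
  proof -
    obtain a b c where abc: "e i = {a, b, c}" "a \<noteq> b" "a \<noteq> c" "b \<noteq> c"
      using T(2)[OF eT[OF i]] card_3_iff by metis
    have "norm (vector [real i, 0, 0] :: real^3) = real i"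
      by (simp add: norm_vec_def L2_set_def sum_3)
    then show ?thesis
      unfolding B_def S_def \<delta>_def abc(1)
      using T(2)[OF eT[OF i]] abc i by (intro tetrahedron_boundary_homeomorphism) auto
  qed
  then obtain h g where hg: "\<And>i. i \<in> {1..m} \<Longrightarrow> homeomorphism (B i) (S i) (h i) (g i) \<and> h i \<delta> = 0"
    by metis
  have \<delta>B: "\<delta> \<in> B i" if "i \<in> {1..m}" for i
    unfolding B_def
  proof (rule realizationI[of _ _ "{p}"])
    have "e i \<noteq> {}" "p \<notin> e i" using T(2)[OF eT[OF that]] by auto
    then show "{v. \<delta> v \<noteq> 0} \<in> {\<sigma>. \<sigma> \<noteq> {} \<and> \<sigma> \<subset> insert p (e i)}" unfolding \<delta>_def by auto
  qed (auto simp: \<delta>_def)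
  have WB: "?W = (\<Union>i\<in>{1..m}. B i)"
  proof -
    have T_eq: "T = e ` {1..m}" using e by (simp add: bij_betw_def)
    show ?thesis unfolding realization_def B_def T_eq by auto
  qed
  have e_disj: "e i \<inter> e j = {}" if "i \<in> {1..m}" "j \<in> {1..m}" "i \<noteq> j" for i j
  proof -
    have "e i \<noteq> e j" using inj_onD[OF bij_betw_imp_inj_on[OF e] _ that(1,2)] that(3) by blast
    then show ?thesis using T(3) eT that by blast
  qed
  have B_int: "f = \<delta>" if "f \<in> B i" "f \<in> B j" "i \<in> {1..m}" "j \<in> {1..m}" "i \<noteq> j" for f i j
  proof -
    have "e i \<inter> e j = {}" using e_disj that(3-5) by blast
    then have supp: "{v. f v \<noteq> 0} \<subseteq> {p}"
      using that(1,2) unfolding B_def realization_def by blast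
    then have "sum f {p} = 1" using that(1) unfolding B_def by (intro realization_sum) auto
    then show ?thesis using supp unfolding \<delta>_def by (auto simp: fun_eq_iff)
  qed
  \<comment> \<open>Each sphere passes through the origin, so its equation has no constant term;
    comparing two of them forces x$1 = 0 and hence x = 0.\<close>
  have S_eq: "x \<in> S i \<longleftrightarrow> x \<bullet> x = 2 * real i * x$1" for x i
  proof -
    have "x \<in> S i \<longleftrightarrow> (norm (x - vector [real i, 0, 0]))\<^sup>2 = (real i)\<^sup>2"
      unfolding S_def by (auto simp: dist_norm norm_minus_commute power2_eq_iff_nonneg)
    also have "\<dots> \<longleftrightarrow> x \<bullet> x = 2 * real i * x$1"
      unfolding power2_norm_eq_inner by (simp add: inner_vec_def sum_3 power2_eq_square algebra_simps)
    finally show ?thesis .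
  qed
  have S_int: "x = 0" if "x \<in> S i" "x \<in> S j" "i \<noteq> j" for x i j
  proof -
    have "real i * x$1 = real j * x$1" using that(1,2) by (simp add: S_eq)
    then have "x$1 = 0" using that(3) by simp
    then show ?thesis using that(1) by (simp add: S_eq)
  qed
  have g0: "g i 0 = \<delta>" if "i \<in> {1..m}" for i
    using hg[OF that] \<delta>B[OF that] unfolding homeomorphism_def by metis
  have Wedge: "wedge_of_2spheres m = top_of_set (\<Union>i\<in>{1..m}. S i)"
    unfolding wedge_of_2spheres_def S_def by simp
  let ?X = "top_of_set ?W" and ?Y = "top_of_set (\<Union>i\<in>{1..m}. S i)"
  have closB: "closedin ?X (B i)" if i: "i \<in> {1..m}" for i
  proof -
    \<comment> \<open>Closedness of a piece: it is cut out of the union by the vanishing of all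
      coordinates outside its four vertices, a condition that the other pieces meet only at the
      common point \<open>\<delta>\<close>.\<close>
    have B_eq: "B i = ?W \<inter> {f. \<forall>v. v \<notin> insert p (e i) \<longrightarrow> f v = 0}"
    proof
      show "B i \<subseteq> ?W \<inter> {f. \<forall>v. v \<notin> insert p (e i) \<longrightarrow> f v = 0}"
        using i unfolding WB by (auto simp: B_def realization_def)
      show "?W \<inter> {f. \<forall>v. v \<notin> insert p (e i) \<longrightarrow> f v = 0} \<subseteq> B i"
      proof
        fix f assume f: "f \<in> ?W \<inter> {f. \<forall>v. v \<notin> insert p (e i) \<longrightarrow> f v = 0}"
        then obtain j where j: "j \<in> {1..m}" "f \<in> B j" unfolding WB by blast
        show "f \<in> B i"
        proof (cases "i = j")
          case False
          have "e i \<inter> e j = {}" using e_disj i j(1) False by blast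
          moreover have "{v. f v \<noteq> 0} \<subseteq> insert p (e i)" using f by blast
          moreover have "{v. f v \<noteq> 0} \<subseteq> insert p (e j)" using j(2) unfolding B_def realization_def by blast
          ultimately have supp: "{v. f v \<noteq> 0} \<subseteq> {p}" by blast
          then have "sum f {p} = 1" using j(2) unfolding B_def by (intro realization_sum) auto
          then have "f = \<delta>" using supp unfolding \<delta>_def by (auto simp: fun_eq_iff)
          then show ?thesis using \<delta>B[OF i] by simp
        qed (use j in simp)
      qed
    qed
    have "closed {f :: 'a \<Rightarrow> real. \<forall>v. v \<notin> insert p (e i) \<longrightarrow> f v = 0}"
    proof -
      have "closed {f :: 'a \<Rightarrow> real. f v = 0}" for v
        by (rule closed_Collect_eq[OF continuous_on_product_coordinates continuous_on_const])
      then have "closed (\<Inter>v\<in>- insert p (e i). {f :: 'a \<Rightarrow> real. f v = 0})" by (intro closed_INT ballI)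
      moreover have "(\<Inter>v\<in>- insert p (e i). {f :: 'a \<Rightarrow> real. f v = 0}) = {f. \<forall>v. v \<notin> insert p (e i) \<longrightarrow> f v = 0}"
        by auto
      ultimately show ?thesis by (simp only:)
    qed
    then show ?thesis unfolding B_eq by (intro closedin_closed_Int)
  qed
  have closS: "closedin ?Y (S i)" if "i \<in> {1..m}" for i
    using that unfolding S_def by (intro closed_subset) auto
  have subB: "B i \<subseteq> ?W" and subS: "S i \<subseteq> (\<Union>i\<in>{1..m}. S i)" if "i \<in> {1..m}" for i
    unfolding WB using that by blast+
  have subX: "subtopology ?X (B i) = top_of_set (B i)" and subY: "subtopology ?Y (S i) = top_of_set (S i)"
    if "i \<in> {1..m}" for i
    using subB[OF that] subS[OF that] by (simp_all only: subtopology_subtopology Int_absorb1)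
  obtain H where H: "continuous_map ?X ?Y H" "\<And>f i. i \<in> {1..m} \<Longrightarrow> f \<in> topspace ?X \<inter> B i \<Longrightarrow> H f = h i f"
  proof (rule pasting_lemma_exists_closed[of "{1..m}" ?X B ?Y h])
    show "topspace ?X \<subseteq> \<Union>(B ` {1..m})" using WB by simp
    fix i assume i: "i \<in> {1..m}"
    show "continuous_map (subtopology ?X (B i)) ?Y (h i)"
    proof -
      have "continuous_on (B i) (h i)" "h i ` B i = S i" using hg[OF i] unfolding homeomorphism_def by simp_all
      then show ?thesis using subS[OF i] unfolding subX[OF i] by auto
    qed
    fix j f assume "j \<in> {1..m}" "f \<in> topspace ?X \<inter> B i \<inter> B j"
    then show "h i f = h j f" using B_int[of f i j] hg i by (cases "i = j") auto
  qed (use closB that in auto)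
  obtain G where G: "continuous_map ?Y ?X G" "\<And>x i. i \<in> {1..m} \<Longrightarrow> x \<in> topspace ?Y \<inter> S i \<Longrightarrow> G x = g i x"
  proof (rule pasting_lemma_exists_closed[of "{1..m}" ?Y S ?X g])
    fix i assume i: "i \<in> {1..m}"
    show "continuous_map (subtopology ?Y (S i)) ?X (g i)"
    proof -
      have "continuous_on (S i) (g i)" "g i ` S i = B i" using hg[OF i] unfolding homeomorphism_def by simp_all
      then show ?thesis using subB[OF i] unfolding subY[OF i] by auto
    qed
    fix j x assume "j \<in> {1..m}" "x \<in> topspace ?Y \<inter> S i \<inter> S j"
    then show "g i x = g j x" using S_int[of x i j] g0 i by (cases "i = j") auto
  qed (use closS that in auto)
  have "homeomorphic_maps ?X ?Y H G"
    unfolding homeomorphic_maps_def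
  proof (intro conjI ballI)
    fix f assume "f \<in> topspace ?X"
    then obtain i where i: "i \<in> {1..m}" "f \<in> B i" using WB by auto
    then have "h i f \<in> S i" "g i (h i f) = f" using hg[OF i(1)] unfolding homeomorphism_def by blast+
    moreover have "H f = h i f" using i subB[OF i(1)] by (intro H(2)) auto
    moreover have "G (h i f) = g i (h i f)" using i subS[OF i(1)] calculation(1) by (intro G(2)) auto
    ultimately show "G (H f) = f" by simp
  next
    fix x assume "x \<in> topspace ?Y"
    then obtain i where i: "i \<in> {1..m}" "x \<in> S i" by auto
    then have "g i x \<in> B i" "h i (g i x) = x" using hg[OF i(1)] unfolding homeomorphism_def by blast+
    moreover have "G x = g i x" using i subS[OF i(1)] by (intro G(2)) auto
    moreover have "H (g i x) = h i (g i x)" using i subB[OF i(1)] calculation(1) by (intro H(2)) auto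
    ultimately show "H (G x) = x" by simp
  qed (use H(1) G(1) in auto)
  then show ?thesis unfolding m_def[symmetric] Wedge homeomorphic_space_def by blast
qed

section \<open>Collapsible complexes with triangles attached\<close>

lemma collapses_fold:
  assumes "finite \<rho>" "\<rho> \<noteq> {}" "w \<notin> \<rho>" "\<And>\<sigma>. \<sigma> \<in> K \<Longrightarrow> \<rho> \<subseteq> \<sigma> \<Longrightarrow> insert w \<sigma> \<in> K" "L = {\<sigma>\<in>K. \<not> \<rho> \<subseteq> \<sigma>}"
  shows "collapses K L"
proof (rule r_into_rtranclp)
  show "fold_step K L"
    unfolding fold_step_def using assms by (intro exI[of _ \<rho>] exI[of _ w]) simp
qed

lemma collapses_common_homotopy_equivalent:
  assumes "collapses K L" "collapses K M" "simplicial_complex K"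
  shows "top_of_set (realization L) homotopy_equivalent_space top_of_set (realization M)"
  using collapses_homotopy_equivalent[OF assms(1,3), THEN homotopy_equivalent_space_sym[THEN iffD1]]
    collapses_homotopy_equivalent[OF assms(2,3)]
  by (rule homotopy_eqv_trans)

text \<open>A combinatorial certificate for a wedge of \<open>card T\<close> two-spheres:
  \<open>T\<close> consists of maximal triangles whose removal leaves a complex that folds to a
  vertex.\<close>

definition spherical :: "'a set set \<Rightarrow> 'a set set \<Rightarrow> bool" where
  "spherical K T \<longleftrightarrow> simplicial_complex K \<and> finite K \<and> T \<subseteq> K \<and>
     (\<forall>\<tau>\<in>T. card \<tau> = 3 \<and> (\<forall>\<sigma>\<in>K. \<tau> \<subseteq> \<sigma> \<longrightarrow> \<sigma> = \<tau>)) \<and> (\<exists>q. collapses (K - T) {{q}})"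

lemma sphericalD:
  assumes "spherical K T"
  shows "simplicial_complex K" "finite K" "T \<subseteq> K" "\<tau> \<in> T \<Longrightarrow> card \<tau> = 3"
    "\<tau> \<in> T \<Longrightarrow> \<sigma> \<in> K \<Longrightarrow> \<tau> \<subseteq> \<sigma> \<Longrightarrow> \<sigma> = \<tau>" "\<exists>q. collapses (K - T) {{q}}"
  using assms unfolding spherical_def by simp_all

lemma simplicial_complex_diff_spherical: "spherical K T \<Longrightarrow> simplicial_complex (K - T)"
  by (rule simplicial_complex_diff_maximal) (simp_all add: sphericalD)

text \<open>Starring the triangle at \<open>v\<close> produces three triangles, of which only
  \<open>{v, y, z}\<close> is marked; the other two belong to what folds to a point. The marked
  triangle thus trades \<open>x\<close> for the fresh vertex \<open>v\<close>. The homotopy type is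
  kept because both complexes are folds of a third one that contains the full tetrahedron.\<close>

lemma stellar_subdivision:
  fixes K :: "'a set set"
  assumes sph: "spherical K T" and \<tau>: "{x, y, z} \<in> T" and v: "v \<notin> \<Union>K"
  shows "\<exists>K'. spherical K' (insert {v, y, z} (T - {{x, y, z}})) \<and>
    top_of_set (realization K') homotopy_equivalent_space top_of_set (realization K)"
proof -
  note K = sphericalD[OF sph]
  let ?\<tau> = "{x, y, z}"
  have ne: "x \<noteq> y" "x \<noteq> z" "y \<noteq> z" using K(4)[OF \<tau>] by (auto simp: card_insert_if split: if_splits)
  have vK: "v \<notin> \<sigma>" if "\<sigma> \<in> K" for \<sigma> using v that by blast
  have \<tau>K: "?\<tau> \<in> K" using \<tau> K(3) by blast
  have v\<tau>: "v \<noteq> x" "v \<noteq> y" "v \<noteq> z" using vK[OF \<tau>K] by auto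
  have face: "s \<in> K" if "s \<subseteq> ?\<tau>" "s \<noteq> {}" for s using simplicial_complex_face[OF K(1) \<tau>K that] .
  have small: "s \<in> K - T" if "s \<subset> ?\<tau>" "s \<noteq> {}" for s
  proof -
    have "s \<notin> T" using K(5)[of s ?\<tau>] \<tau>K that by blast
    then show ?thesis using face that by blast
  qed
  \<comment> \<open>The common source: folding \<open>v\<close> into \<open>x\<close> gives back
    \<open>K\<close>, while folding the triangle into \<open>v\<close> gives the
    subdivision.\<close>
  define Kp where "Kp = cones K {v} (\<lambda>_. {s. s \<subseteq> ?\<tau> \<and> s \<noteq> {}})"
  define K' where "K' = {\<sigma> \<in> Kp. \<not> ?\<tau> \<subseteq> \<sigma>}"
  define T' where "T' = insert {v, y, z} (T - {?\<tau>})"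
  have Kp: "\<sigma> \<in> Kp \<longleftrightarrow> \<sigma> \<in> K \<or> (\<exists>s. s \<subseteq> ?\<tau> \<and> \<sigma> = insert v s)" for \<sigma>
    unfolding Kp_def cones_def by auto
  have "simplicial_complex {s. s \<subseteq> ?\<tau> \<and> s \<noteq> {}}"
    by (rule simplicial_complexI) (auto intro: finite_subset)
  then have ascKp: "simplicial_complex Kp"
    unfolding Kp_def using K(1) face by (intro simplicial_complex_cones) auto
  have "collapses Kp K"
  proof (rule collapses_fold[of "{v}" x])
    fix \<sigma> assume \<sigma>: "\<sigma> \<in> Kp" "{v} \<subseteq> \<sigma>"
    then obtain s where s: "s \<subseteq> ?\<tau>" "\<sigma> = insert v s" using vK[of \<sigma>] Kp by auto
    then have "insert x s \<subseteq> ?\<tau>" "insert x \<sigma> = insert v (insert x s)" by auto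
    then show "insert x \<sigma> \<in> Kp" unfolding Kp by blast
  next
    show "K = {\<sigma> \<in> Kp. \<not> {v} \<subseteq> \<sigma>}"
    proof (rule set_eqI)
      fix \<sigma> show "\<sigma> \<in> K \<longleftrightarrow> \<sigma> \<in> {\<sigma> \<in> Kp. \<not> {v} \<subseteq> \<sigma>}"
        using vK[of \<sigma>] by (auto simp: Kp)
    qed
  qed (use v\<tau> in auto)
  moreover have KpK': "collapses Kp K'"
  proof (rule collapses_fold[of ?\<tau> v])
    fix \<sigma> assume \<sigma>: "\<sigma> \<in> Kp" "?\<tau> \<subseteq> \<sigma>"
    have "insert v \<sigma> = insert v ?\<tau>"
      using \<sigma> K(5)[OF \<tau>, of \<sigma>] by (auto simp: Kp)
    then show "insert v \<sigma> \<in> Kp" unfolding Kp by blast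
  qed (use v\<tau> in \<open>auto simp: K'_def\<close>)
  ultimately have heq: "top_of_set (realization K') homotopy_equivalent_space top_of_set (realization K)"
    using collapses_common_homotopy_equivalent[OF KpK' _ ascKp] by simp
  have ascK': "simplicial_complex K'" by (rule collapses_asc[OF KpK' ascKp])
  have K': "\<sigma> \<in> K' \<longleftrightarrow> \<sigma> \<in> K - {?\<tau>} \<or> (\<exists>s. s \<subset> ?\<tau> \<and> \<sigma> = insert v s)" for \<sigma>
  proof
    assume \<sigma>: "\<sigma> \<in> K'"
    show "\<sigma> \<in> K - {?\<tau>} \<or> (\<exists>s. s \<subset> ?\<tau> \<and> \<sigma> = insert v s)"
    proof (cases "\<sigma> \<in> K")
      case False
      then obtain s where "s \<subseteq> ?\<tau>" "\<sigma> = insert v s" using \<sigma> unfolding K'_def Kp by blast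
      moreover have "s \<noteq> ?\<tau>" using \<sigma> calculation(2) unfolding K'_def by blast
      ultimately show ?thesis by blast
    qed (use \<sigma> in \<open>auto simp: K'_def\<close>)
  next
    assume "\<sigma> \<in> K - {?\<tau>} \<or> (\<exists>s. s \<subset> ?\<tau> \<and> \<sigma> = insert v s)"
    then show "\<sigma> \<in> K'"
    proof (elim disjE exE conjE)
      assume "\<sigma> \<in> K - {?\<tau>}"
      then show ?thesis using K(5)[OF \<tau>, of \<sigma>] by (auto simp: K'_def Kp)
    next
      fix s assume s: "s \<subset> ?\<tau>" "\<sigma> = insert v s"
      then have "\<not> ?\<tau> \<subseteq> \<sigma>" using v\<tau> by blast
      then show ?thesis using s unfolding K'_def Kp by blast
    qed
  qed
  \<comment> \<open>The path y - x - z is the link of \<open>v\<close> once the triangle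
    \<open>{v, y, z}\<close> has been deleted.\<close>
  let ?R = "{s. s \<noteq> {} \<and> (s \<subseteq> {x, y} \<or> s \<subseteq> {x, z})}"
  have ascR: "simplicial_complex ?R" by (rule simplicial_complexI) (auto intro: finite_subset)
  have RK: "?R \<subseteq> K - T"
  proof
    fix s assume s: "s \<in> ?R"
    then have "s \<subset> ?\<tau>" using ne by blast
    then show "s \<in> K - T" using small s by blast
  qed
  have s_iff: "s \<subset> ?\<tau> \<and> s \<noteq> {y, z} \<longleftrightarrow> s \<subseteq> {x, y} \<or> s \<subseteq> {x, z}" for s
  proof
    assume "s \<subset> ?\<tau> \<and> s \<noteq> {y, z}"
    then show "s \<subseteq> {x, y} \<or> s \<subseteq> {x, z}" by (cases "y \<in> s"; cases "z \<in> s") blast+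
  next
    assume "s \<subseteq> {x, y} \<or> s \<subseteq> {x, z}"
    then show "s \<subset> ?\<tau> \<and> s \<noteq> {y, z}" using ne by blast
  qed
  have vins: "insert v s = insert v s' \<longleftrightarrow> s = s'" if "s \<subseteq> ?\<tau>" "s' \<subseteq> ?\<tau>" for s s'
    using that v\<tau> by (intro insert_ident) auto
  have KT: "K' - T' = (K - T) \<union> insert v ` insert {} ?R"
  proof (rule set_eqI)
    fix \<sigma>
    show "\<sigma> \<in> K' - T' \<longleftrightarrow> \<sigma> \<in> (K - T) \<union> insert v ` insert {} ?R"
    proof (cases "v \<in> \<sigma>")
      case False
      then have "\<sigma> \<in> K' \<longleftrightarrow> \<sigma> \<in> K - {?\<tau>}" "\<sigma> \<in> T' \<longleftrightarrow> \<sigma> \<in> T - {?\<tau>}" "\<sigma> \<notin> insert v ` insert {} ?R"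
        unfolding K' T'_def by blast+
      then show ?thesis using \<tau> by blast
    next
      case True
      then have nK: "\<sigma> \<notin> K" using vK by blast
      have T'_iff: "\<sigma> \<in> T' \<longleftrightarrow> \<sigma> = insert v {y, z}" unfolding T'_def using nK K(3) by blast
      have K'_iff: "\<sigma> \<in> K' \<longleftrightarrow> (\<exists>s. s \<subset> ?\<tau> \<and> \<sigma> = insert v s)" using nK unfolding K' by simp
      have "\<sigma> \<in> K' - T' \<longleftrightarrow> (\<exists>s. (s \<subset> ?\<tau> \<and> s \<noteq> {y, z}) \<and> \<sigma> = insert v s)"
      proof
        assume *: "\<sigma> \<in> K' - T'"
        then have "\<exists>s. s \<subset> ?\<tau> \<and> \<sigma> = insert v s" using K'_iff by simp
        then obtain s where s: "s \<subset> ?\<tau>" "\<sigma> = insert v s" by (elim exE conjE)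
        have "\<sigma> \<noteq> insert v {y, z}" using * T'_iff by simp
        then have "s \<noteq> {y, z}" using s(2) by auto
        with s show "\<exists>s. (s \<subset> ?\<tau> \<and> s \<noteq> {y, z}) \<and> \<sigma> = insert v s" by (intro exI[of _ s]) simp
      next
        assume "\<exists>s. (s \<subset> ?\<tau> \<and> s \<noteq> {y, z}) \<and> \<sigma> = insert v s"
        then obtain s where s: "s \<subset> ?\<tau>" "s \<noteq> {y, z}" "\<sigma> = insert v s" by (elim exE conjE)
        have "\<sigma> \<noteq> insert v {y, z}" using vins[of s "{y, z}"] s by simp
        then have "\<sigma> \<notin> T'" using T'_iff by simp
        moreover have "\<sigma> \<in> K'" unfolding K'_iff using s by (intro exI[of _ s]) simp
        ultimately show "\<sigma> \<in> K' - T'" by simp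
      qed
      also have "\<dots> \<longleftrightarrow> (\<exists>s. (s \<subseteq> {x, y} \<or> s \<subseteq> {x, z}) \<and> \<sigma> = insert v s)"
        unfolding s_iff ..
      also have "\<dots> \<longleftrightarrow> \<sigma> \<in> insert v ` insert {} ?R" by blast
      finally show ?thesis using nK by blast
    qed
  qed
  have ascKT: "simplicial_complex (K - T)" by (rule simplicial_complex_diff_spherical[OF sph])
  \<comment> \<open>The path contracts to \<open>x\<close>, after which \<open>v\<close> hangs on
    the single edge to \<open>x\<close> and can be folded away.\<close>
  have "collapses ?R {\<sigma>\<in>?R. \<forall>j\<in>{y, z}. \<not> {j} \<subseteq> \<sigma>}"
  proof (rule collapses_family_apex)
    show "\<exists>w. (\<forall>i\<in>{y, z}. w \<notin> {i}) \<and> (\<forall>\<sigma>\<in>?R. {j} \<subseteq> \<sigma> \<longrightarrow> insert w \<sigma> \<in> ?R)" for j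
      using ne by (intro exI[of _ x]) auto
  qed auto
  moreover have "{\<sigma>\<in>?R. \<forall>j\<in>{y, z}. \<not> {j} \<subseteq> \<sigma>} = {{x}}" using ne by auto
  ultimately have "collapses ?R {{x}}" by simp
  then have c1: "collapses (K' - T') ((K - T) \<union> insert v ` insert {} {{x}})"
    unfolding KT using v by (intro collapses_cone ascR RK) auto
  have c2: "collapses ((K - T) \<union> insert v ` insert {} {{x}}) (K - T)"
  proof (rule collapses_fold[of "{v}" x])
    fix \<sigma> assume "\<sigma> \<in> (K - T) \<union> insert v ` insert {} {{x}}" "{v} \<subseteq> \<sigma>"
    then have "\<sigma> = {v} \<or> \<sigma> = {v, x}" using vK by auto
    then show "insert x \<sigma> \<in> (K - T) \<union> insert v ` insert {} {{x}}" by auto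
  next
    show "K - T = {\<sigma> \<in> (K - T) \<union> insert v ` insert {} {{x}}. \<not> {v} \<subseteq> \<sigma>}"
      using vK by auto
  qed (use v\<tau> in auto)
  obtain q where "collapses (K - T) {{q}}" using K(6) by blast
  with c1 c2 have "collapses (K' - T') {{q}}" by (meson rtranclp_trans)
  moreover have "T' \<subseteq> K'"
  proof
    fix \<sigma> assume "\<sigma> \<in> T'"
    then have "\<sigma> \<in> T - {?\<tau>} \<or> (\<sigma> = insert v {y, z} \<and> {y, z} \<subset> ?\<tau>)" using ne unfolding T'_def by blast
    then show "\<sigma> \<in> K'" unfolding K' using K(3) by blast
  qed
  moreover have "card \<tau>' = 3 \<and> (\<forall>\<sigma>\<in>K'. \<tau>' \<subseteq> \<sigma> \<longrightarrow> \<sigma> = \<tau>')" if "\<tau>' \<in> T'" for \<tau>'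
  proof (cases "\<tau>' \<in> T - {?\<tau>}")
    case True
    then have \<tau>'K: "\<tau>' \<in> K" "\<tau>' \<in> T" "\<tau>' \<noteq> ?\<tau>" using K(3) by auto
    have "\<sigma> = \<tau>'" if \<sigma>: "\<sigma> \<in> K'" "\<tau>' \<subseteq> \<sigma>" for \<sigma>
      using \<sigma>(1) unfolding K'
    proof (elim disjE exE conjE)
      assume "\<sigma> \<in> K - {?\<tau>}"
      then show ?thesis using K(5)[OF \<tau>'K(2) _ \<sigma>(2)] by simp
    next
      fix s assume s: "s \<subset> ?\<tau>" "\<sigma> = insert v s"
      then have "\<tau>' \<subseteq> ?\<tau>" using \<sigma>(2) vK[OF \<tau>'K(1)] by blast
      then show ?thesis using K(5)[OF \<tau>'K(2) \<tau>K] \<tau>'K(3) by simp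
    qed
    then show ?thesis using K(4)[OF \<tau>'K(2)] by blast
  next
    case False
    then have \<tau>': "\<tau>' = insert v {y, z}" using that unfolding T'_def by blast
    have "\<sigma> = \<tau>'" if \<sigma>: "\<sigma> \<in> K'" "\<tau>' \<subseteq> \<sigma>" for \<sigma>
    proof -
      have "\<sigma> \<notin> K" using vK[of \<sigma>] \<sigma>(2) \<tau>' by blast
      then obtain s where s: "s \<subset> ?\<tau>" "\<sigma> = insert v s" using \<sigma>(1) unfolding K' by blast
      moreover have "{y, z} \<subseteq> s" using s(2) \<sigma>(2) \<tau>' v\<tau> by blast
      ultimately have "s = {y, z}" by blast
      then show ?thesis using s(2) \<tau>' by simp
    qed
    then show ?thesis using \<tau>' v\<tau> ne by simp
  qed
  moreover have "finite K'"
  proof -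
    have "finite (insert v ` Pow ?\<tau>)" by simp
    moreover have "K' \<subseteq> K \<union> insert v ` Pow ?\<tau>"
    proof
      fix \<sigma> assume "\<sigma> \<in> K'"
      then show "\<sigma> \<in> K \<union> insert v ` Pow ?\<tau>" unfolding K' by blast
    qed
    ultimately show ?thesis using K(2) finite_subset by (metis finite_UnI)
  qed
  ultimately have "spherical K' T'" unfolding spherical_def using ascK' by blast
  then show ?thesis using heq unfolding T'_def by blast
qed

lemma finite_Union_spherical: "spherical K T \<Longrightarrow> finite (\<Union>K)"
  using sphericalD(1,2) simplicial_complex_finite by (metis finite_Union)

text \<open>Three subdivisions of a triangle produce a triangle whose vertices are all new.\<close>
lemma spherical_separate_triangle:
  fixes K :: "'a set set"
  assumes inf: "infinite (UNIV :: 'a set)" and sph: "spherical K T" and \<tau>: "\<tau> \<in> T"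
  shows "\<exists>K' \<tau>'. spherical K' (insert \<tau>' (T - {\<tau>})) \<and> \<tau>' \<inter> \<Union>(T - {\<tau>}) = {} \<and> \<tau>' \<notin> T \<and>
    top_of_set (realization K') homotopy_equivalent_space top_of_set (realization K)"
proof -
  obtain x y z where xyz: "\<tau> = {x, y, z}"
    using sphericalD(4)[OF sph \<tau>] card_3_iff by metis
  let ?T = "T - {\<tau>}"
  have fresh: "\<exists>v. v \<notin> \<Union>L" if "spherical L S" for L S :: "'a set set"
    using ex_new_if_finite[OF inf finite_Union_spherical[OF that]] .
  have remove: "insert \<rho> S - {\<rho>} = S" if "v \<in> \<rho>" "v \<notin> \<Union>S" for v \<rho> and S :: "'a set set"
    using that by blast
  obtain v1 where v1: "v1 \<notin> \<Union>K" using fresh[OF sph] by blast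
  then have v1T: "v1 \<notin> \<Union>T" using sphericalD(3)[OF sph] by blast
  obtain K1 where K1: "spherical K1 (insert {v1, y, z} ?T)"
    "top_of_set (realization K1) homotopy_equivalent_space top_of_set (realization K)"
    using stellar_subdivision[OF sph _ v1, of x y z] \<tau> unfolding xyz by blast
  obtain v2 where v2: "v2 \<notin> \<Union>K1" using fresh[OF K1(1)] by blast
  then have v2T: "v2 \<notin> \<Union>?T" using sphericalD(3)[OF K1(1)] by blast
  have e1: "{v1, y, z} = {y, v1, z}" by auto
  have r1: "insert {y, v1, z} ?T - {{y, v1, z}} = ?T" using v1T by (intro remove[of v1]) auto
  obtain K2 where K2: "spherical K2 (insert {v2, v1, z} ?T)"
    "top_of_set (realization K2) homotopy_equivalent_space top_of_set (realization K1)"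
    using stellar_subdivision[OF K1(1)[unfolded e1] _ v2, of y v1 z, unfolded r1] by blast
  obtain v3 where v3: "v3 \<notin> \<Union>K2" using fresh[OF K2(1)] by blast
  then have v3T: "v3 \<notin> \<Union>?T" using sphericalD(3)[OF K2(1)] by blast
  have e2: "{v2, v1, z} = {z, v1, v2}" by auto
  have r2: "insert {z, v1, v2} ?T - {{z, v1, v2}} = ?T" using v1T by (intro remove[of v1]) auto
  obtain K3 where K3: "spherical K3 (insert {v3, v1, v2} ?T)"
    "top_of_set (realization K3) homotopy_equivalent_space top_of_set (realization K2)"
    using stellar_subdivision[OF K2(1)[unfolded e2] _ v3, of z v1 v2, unfolded r2] by blast
  have "{v3, v1, v2} \<inter> \<Union>?T = {}" using v1T v2T v3T by blast
  moreover have "{v3, v1, v2} \<notin> T" using v1T by blast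
  moreover have "top_of_set (realization K3) homotopy_equivalent_space top_of_set (realization K)"
    by (rule homotopy_eqv_trans[OF K3(2) homotopy_eqv_trans[OF K2(2) K1(2)]])
  ultimately show ?thesis using K3(1) by blast
qed

text \<open>\<open>E\<close> collects the marked triangles that may still meet others. A separated
  triangle avoids the vertices of all remaining ones, so later separations leave it separated and
  \<open>card E\<close> drops by one each time.\<close>

lemma spherical_separate:
  fixes K :: "'a set set"
  assumes inf: "infinite (UNIV :: 'a set)" and sph: "spherical K T" and "E \<subseteq> T"
    and disj: "\<And>\<tau> \<tau>'. \<tau> \<in> T - E \<Longrightarrow> \<tau>' \<in> T \<Longrightarrow> \<tau> \<noteq> \<tau>' \<Longrightarrow> \<tau> \<inter> \<tau>' = {}"
  shows "\<exists>(K' :: 'a set set) T'. spherical K' T' \<and> card T' = card T \<and>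
    (\<forall>\<tau>\<in>T'. \<forall>\<tau>'\<in>T'. \<tau> \<noteq> \<tau>' \<longrightarrow> \<tau> \<inter> \<tau>' = {}) \<and>
    top_of_set (realization K') homotopy_equivalent_space top_of_set (realization K)"
  using sph assms(3) disj
proof (induction "card E" arbitrary: K T E)
  case 0
  have "finite T" using sphericalD(2,3)[OF 0(2)] finite_subset by blast
  then have "E = {}" using 0(1,3) finite_subset by fastforce
  show ?case
  proof (rule exI[of _ K], rule exI[of _ T], intro conjI ballI impI)
    show "spherical K T" by (rule 0(2))
    show "top_of_set (realization K) homotopy_equivalent_space top_of_set (realization K)"
      by (rule homotopy_equivalent_space_refl)
    fix \<tau> \<tau>' assume "\<tau> \<in> T" "\<tau>' \<in> T" "\<tau> \<noteq> \<tau>'"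
    then show "\<tau> \<inter> \<tau>' = {}" using 0(4) \<open>E = {}\<close> by simp
  qed simp
next
  case (Suc n)
  have finT: "finite T" using sphericalD(2,3)[OF Suc.prems(1)] finite_subset by blast
  then have finE: "finite E" using Suc.prems(2) finite_subset by blast
  obtain \<tau> where \<tau>: "\<tau> \<in> E" using Suc.hyps(2) by fastforce
  then have \<tau>T: "\<tau> \<in> T" using Suc.prems(2) by blast
  obtain K' \<tau>' where K': "spherical K' (insert \<tau>' (T - {\<tau>}))" "\<tau>' \<inter> \<Union>(T - {\<tau>}) = {}" "\<tau>' \<notin> T"
    "top_of_set (realization K') homotopy_equivalent_space top_of_set (realization K)"
    using spherical_separate_triangle[OF inf Suc.prems(1) \<tau>T] by blast
  let ?T = "insert \<tau>' (T - {\<tau>})"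
  have n: "n = card (E - {\<tau>})" using Suc.hyps(2) \<tau> finE by simp
  have sub: "E - {\<tau>} \<subseteq> ?T" using Suc.prems(2) by blast
  \<comment> \<open>The new triangle meets nothing, and a pair of old triangles with one of them
    outside \<open>E\<close> was disjoint before.\<close>
  have dis: "\<rho> \<inter> \<rho>' = {}" if \<rho>: "\<rho> \<in> ?T - (E - {\<tau>})" "\<rho>' \<in> ?T" "\<rho> \<noteq> \<rho>'" for \<rho> \<rho>'
  proof -
    consider "\<rho> = \<tau>'" "\<rho>' \<in> T - {\<tau>}" | "\<rho>' = \<tau>'" "\<rho> \<in> T - {\<tau>}" | "\<rho> \<in> T - E" "\<rho>' \<in> T"
      using \<rho> by blast
    then show ?thesis
    proof cases
      case 3
      then show ?thesis using Suc.prems(3) \<rho>(3) by blast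
    qed (use K'(2) in blast)+
  qed
  obtain K'' :: "'a set set" and T'' where *: "spherical K'' T''" "card T'' = card ?T"
    "\<forall>\<tau>\<in>T''. \<forall>\<tau>'\<in>T''. \<tau> \<noteq> \<tau>' \<longrightarrow> \<tau> \<inter> \<tau>' = {}"
    "top_of_set (realization K'') homotopy_equivalent_space top_of_set (realization K')"
    using Suc.hyps(1)[OF n K'(1) sub] dis by blast
  have "card ?T = Suc (card (T - {\<tau>}))" using finT K'(3) by simp
  also have "\<dots> = card T" by (rule card_Suc_Diff1[OF finT \<tau>T])
  finally have "card T'' = card T" using *(2) by simp
  moreover have "top_of_set (realization K'') homotopy_equivalent_space top_of_set (realization K)"
    by (rule homotopy_eqv_trans[OF *(4) K'(4)])
  ultimately show ?case using *(1,3) by (intro exI[of _ K''] exI[of _ T''] conjI)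
qed

text \<open>Coning off the contractible complex \<open>K - T\<close> from a new apex leaves one tetrahedron boundary
  per triangle of \<open>T\<close>.\<close>
theorem spherical_homotopy_equivalent_wedge:
  fixes K :: "'a set set"
  assumes inf: "infinite (UNIV :: 'a set)" and sph0: "spherical K T0" and "T0 \<noteq> {}"
  shows "top_of_set (realization K) homotopy_equivalent_space wedge_of_2spheres (card T0)"
proof -
  obtain L T :: "'a set set" where sph: "spherical L T" and cardT: "card T = card T0"
    and disj: "\<forall>\<tau>\<in>T. \<forall>\<tau>'\<in>T. \<tau> \<noteq> \<tau>' \<longrightarrow> \<tau> \<inter> \<tau>' = {}"
    and heq: "top_of_set (realization L) homotopy_equivalent_space top_of_set (realization K)"
    using spherical_separate[OF inf sph0, of T0] by blast
  note L = sphericalD[OF sph]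
  have finT: "finite T" using L(2,3) finite_subset by blast
  have "finite T0" using sphericalD(2,3)[OF sph0] finite_subset by blast
  then have "T \<noteq> {}" using cardT \<open>T0 \<noteq> {}\<close> by auto
  obtain p where p: "p \<notin> \<Union>L"
    using ex_new_if_finite[OF inf finite_Union_spherical[OF sph]] by blast
  then have pL: "p \<notin> \<sigma>" if "\<sigma> \<in> L" for \<sigma> using that by blast
  obtain q where q: "collapses (L - T) {{q}}" using L(6) by blast
  have ascLT: "simplicial_complex (L - T)" by (rule simplicial_complex_diff_spherical[OF sph])
  \<comment> \<open>\<open>L\<close> together with the cone from \<open>p\<close> over everything
    except the marked triangles. Since \<open>L - T\<close> folds to \<open>q\<close>, the cone
    shrinks to an edge from \<open>p\<close> to \<open>q\<close> and vanishes, so \<open>Y\<close>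
    folds back to \<open>L\<close>.\<close>
  define Y where "Y = L \<union> insert p ` insert {} (L - T)"
  have Y_iff: "\<sigma> \<in> Y \<longleftrightarrow> \<sigma> \<in> L \<or> \<sigma> = {p} \<or> (\<exists>s. s \<in> L \<and> s \<notin> T \<and> \<sigma> = insert p s)" for \<sigma>
    unfolding Y_def by auto
  have "Y = cones L {p} (\<lambda>_. L - T)" unfolding Y_def cones_def by simp
  then have ascY: "simplicial_complex Y" using L(1) ascLT by (simp add: simplicial_complex_cones)
  have "{q} \<in> L" using collapses_subset[OF q] by simp
  then have pq: "p \<noteq> q" using pL by blast
  have "collapses Y (L \<union> insert p ` insert {} {{q}})"
    unfolding Y_def by (rule collapses_cone[OF q ascLT _ p]) simp
  moreover have "collapses (L \<union> insert p ` insert {} {{q}}) L"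
  proof (rule collapses_fold[of "{p}" q])
    fix \<sigma> assume "\<sigma> \<in> L \<union> insert p ` insert {} {{q}}" "{p} \<subseteq> \<sigma>"
    then have "\<sigma> = {p} \<or> \<sigma> = {p, q}" using pL by auto
    then show "insert q \<sigma> \<in> L \<union> insert p ` insert {} {{q}}" by auto
  next
    show "L = {\<sigma> \<in> L \<union> insert p ` insert {} {{q}}. \<not> {p} \<subseteq> \<sigma>}"
      using pL by auto
  qed (use pq in auto)
  ultimately have YL: "collapses Y L" by (rule rtranclp_trans)
  \<comment> \<open>All vertex sets contained in no marked triangle, whether or not they are
    simplices. A simplex of \<open>L\<close> above such a set is not in \<open>T\<close>, so
    \<open>p\<close> can be added to it; folding the whole family into \<open>p\<close> leaves only
    proper faces of the tetrahedra on \<open>p\<close> and a marked triangle.\<close>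
  define J where "J = {\<rho>. \<rho> \<subseteq> \<Union>L \<and> \<rho> \<noteq> {} \<and> (\<forall>\<tau>\<in>T. \<not> \<rho> \<subseteq> \<tau>)}"
  let ?W = "{\<sigma>. \<sigma> \<noteq> {} \<and> (\<exists>\<tau>\<in>T. \<sigma> \<subset> insert p \<tau>)}"
  have J: "\<rho> \<subseteq> \<Union>L" "\<rho> \<noteq> {}" "\<tau> \<in> T \<Longrightarrow> \<not> \<rho> \<subseteq> \<tau>" "p \<notin> \<rho>" if "\<rho> \<in> J" for \<rho> \<tau>
    using that p unfolding J_def by auto
  have finJ: "finite J" unfolding J_def using finite_Union_spherical[OF sph] by simp
  have "collapses Y {\<sigma>\<in>Y. \<forall>j\<in>J. \<not> id j \<subseteq> \<sigma>}"
  proof (rule collapses_family_apex[OF finJ])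
    fix \<rho> assume \<rho>: "\<rho> \<in> J"
    show "finite (id \<rho>) \<and> id \<rho> \<noteq> {}"
      using J(1,2)[OF \<rho>] finite_subset[OF _ finite_Union_spherical[OF sph]] by simp
    have ins: "insert p \<sigma> \<in> Y" if \<sigma>: "\<sigma> \<in> Y" "\<rho> \<subseteq> \<sigma>" for \<sigma>
    proof (cases "\<sigma> \<in> L")
      case True
      moreover have "\<sigma> \<notin> T" using J(3)[OF \<rho>] \<sigma>(2) by blast
      ultimately show ?thesis unfolding Y_iff by blast
    next
      case False
      then have "p \<in> \<sigma>" using \<sigma>(1) unfolding Y_iff by auto
      then show ?thesis using \<sigma>(1) by (simp add: insert_absorb)
    qed
    show "\<exists>w. (\<forall>i\<in>J. w \<notin> id i) \<and> (\<forall>\<sigma>\<in>Y. id \<rho> \<subseteq> \<sigma> \<longrightarrow> insert w \<sigma> \<in> Y)"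
      using ins J(4) by (intro exI[of _ p]) simp
  qed
  moreover have "{\<sigma>\<in>Y. \<forall>j\<in>J. \<not> id j \<subseteq> \<sigma>} = ?W"
  proof (intro equalityI subsetI)
    fix \<sigma> assume "\<sigma> \<in> {\<sigma>\<in>Y. \<forall>j\<in>J. \<not> id j \<subseteq> \<sigma>}"
    then have \<sigma>: "\<sigma> \<in> Y" "\<And>\<rho>. \<rho> \<in> J \<Longrightarrow> \<not> \<rho> \<subseteq> \<sigma>" by simp_all
    have in\<tau>: "\<exists>\<tau>\<in>T. s \<subseteq> \<tau>" if s: "s \<in> L" "s \<subseteq> \<sigma>" for s
    proof (rule ccontr)
      assume "\<not> ?thesis"
      then have "s \<in> J" using simplicial_complex_nonempty[OF L(1) s(1)] s(1) unfolding J_def by blast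
      then show False using \<sigma>(2) s(2) by blast
    qed
    show "\<sigma> \<in> ?W"
      using \<sigma>(1) unfolding Y_iff
    proof (elim disjE exE conjE)
      assume \<sigma>L: "\<sigma> \<in> L"
      obtain \<tau> where "\<tau> \<in> T" "\<sigma> \<subseteq> \<tau>" using in\<tau>[OF \<sigma>L] by blast
      moreover have "p \<notin> \<tau>" using L(3) calculation(1) pL by blast
      ultimately show ?thesis using simplicial_complex_nonempty[OF L(1) \<sigma>L] by blast
    next
      assume "\<sigma> = {p}"
      moreover obtain \<tau> where "\<tau> \<in> T" using \<open>T \<noteq> {}\<close> by blast
      moreover have "\<tau> \<in> L" using L(3) calculation(2) by blast
      moreover have "\<tau> \<noteq> {}" "p \<notin> \<tau>" using simplicial_complex_nonempty[OF L(1) calculation(3)] pL[OF calculation(3)] by simp_all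
      ultimately show ?thesis by blast
    next
      fix s assume s: "s \<in> L" "s \<notin> T" "\<sigma> = insert p s"
      have "s \<subseteq> \<sigma>" using s(3) by blast
      then obtain \<tau> where \<tau>: "\<tau> \<in> T" "s \<subseteq> \<tau>" using in\<tau>[OF s(1)] by blast
      have "p \<notin> \<tau>" using \<tau>(1) L(3) pL by blast
      have "s \<noteq> \<tau>" using s(2) \<tau>(1) by blast
      then obtain x where x: "x \<in> \<tau>" "x \<notin> s" using \<tau>(2) by blast
      then have "x \<notin> \<sigma>" using s(3) \<open>p \<notin> \<tau>\<close> by blast
      then have "\<sigma> \<subset> insert p \<tau>" using s(3) \<tau>(2) x(1) by blast
      then show ?thesis using \<tau>(1) s(3) by blast
    qed
  next
    fix \<sigma> assume "\<sigma> \<in> ?W"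
    then obtain \<tau> where \<tau>: "\<tau> \<in> T" "\<sigma> \<subset> insert p \<tau>" "\<sigma> \<noteq> {}" by blast
    then have \<tau>L: "\<tau> \<in> L" using L(3) by blast
    have "\<sigma> \<in> Y"
    proof (cases "p \<in> \<sigma>")
      case False
      then have "\<sigma> \<subseteq> \<tau>" using \<tau>(2) by blast
      then show ?thesis unfolding Y_iff using simplicial_complex_face[OF L(1) \<tau>L _ \<tau>(3)] by simp
    next
      case True
      define s where "s = \<sigma> - {p}"
      have s: "s \<subset> \<tau>" "\<sigma> = insert p s" using \<tau>(2) True unfolding s_def by blast+
      show ?thesis
      proof (cases "s = {}")
        case False
        then have "s \<in> L" using simplicial_complex_face[OF L(1) \<tau>L] s(1) by blast
        moreover have "s \<notin> T" using L(5)[OF _ \<tau>L, of s] s(1) by blast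
        ultimately show ?thesis unfolding Y_iff using s(2) by blast
      qed (use s(2) Y_iff in simp)
    qed
    moreover have "\<not> \<rho> \<subseteq> \<sigma>" if "\<rho> \<in> J" for \<rho>
    proof
      assume "\<rho> \<subseteq> \<sigma>"
      then have "\<rho> \<subseteq> \<tau>" using J(4)[OF that] \<tau>(2) by blast
      then show False using J(3)[OF that \<tau>(1)] by simp
    qed
    ultimately show "\<sigma> \<in> {\<sigma>\<in>Y. \<forall>j\<in>J. \<not> id j \<subseteq> \<sigma>}" by simp
  qed
  ultimately have "collapses Y ?W" by simp
  then have "top_of_set (realization L) homotopy_equivalent_space top_of_set (realization ?W)"
    by (rule collapses_common_homotopy_equivalent[OF YL _ ascY])
  moreover have "top_of_set (realization ?W) homeomorphic_space wedge_of_2spheres (card T)"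
  proof (rule realization_wedge_homeomorphic[OF finT])
    show "card \<tau> = 3 \<and> p \<notin> \<tau>" if "\<tau> \<in> T" for \<tau> using L(3,4) that pL by blast
  qed (use disj in blast)
  then have "top_of_set (realization ?W) homotopy_equivalent_space wedge_of_2spheres (card T0)"
    unfolding cardT by (rule homeomorphic_imp_homotopy_equivalent_space)
  ultimately have "top_of_set (realization L) homotopy_equivalent_space wedge_of_2spheres (card T0)"
    by (rule homotopy_eqv_trans)
  with heq[unfolded homotopy_equivalent_space_sym[of "top_of_set (realization L)"]] show ?thesis
    by (rule homotopy_eqv_trans)
qed

section \<open>Cones over induced subcomplexes\<close>

lemma simplicial_complex_image:
  assumes "simplicial_complex F"
  shows "simplicial_complex ((`) f ` F)"
proof (rule simplicial_complexI)
  fix \<sigma> s assume \<sigma>: "\<sigma> \<in> (`) f ` F" and s: "s \<subseteq> \<sigma>" "s \<noteq> {}"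
  then obtain \<sigma>' where \<sigma>': "\<sigma>' \<in> F" "\<sigma> = f ` \<sigma>'" by blast
  let ?s = "{x \<in> \<sigma>'. f x \<in> s}"
  have "s = f ` ?s" using s(1) \<sigma>'(2) by blast
  moreover from this have "?s \<noteq> {}" using s(2) by blast
  then have "?s \<in> F" using simplicial_complex_face[OF assms \<sigma>'(1), of ?s] by simp
  ultimately show "s \<in> (`) f ` F" by (rule image_eqI)
qed (use simplicial_complex_finite[OF assms] simplicial_complex_nonempty[OF assms] in auto)

text \<open>The base is always the full subcomplex on \<open>A c\<close>. It therefore shrinks
  together with \<open>K\<close>, so that a cone need not be carried along separately during folds
  of \<open>K\<close>.\<close>

definition induced_cones :: "'a set set \<Rightarrow> 'a set \<Rightarrow> ('a \<Rightarrow> 'a set) \<Rightarrow> 'a set set" where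
  "induced_cones K I A = cones K I (\<lambda>c. {\<sigma>\<in>K. \<sigma> \<subseteq> A c})"

lemma induced_cones_iff:
  "\<sigma> \<in> induced_cones K I A \<longleftrightarrow> \<sigma> \<in> K \<or> (\<exists>c\<in>I. \<exists>t. (t = {} \<or> t \<in> K) \<and> t \<subseteq> A c \<and> \<sigma> = insert c t)"
  unfolding induced_cones_def cones_def by auto

lemma simplicial_complex_induced: "simplicial_complex K \<Longrightarrow> simplicial_complex {\<sigma>\<in>K. \<sigma> \<subseteq> A}"
proof (rule simplicial_complexI)
  fix \<sigma> s assume "simplicial_complex K" "\<sigma> \<in> {\<sigma>\<in>K. \<sigma> \<subseteq> A}" "s \<subseteq> \<sigma>" "s \<noteq> {}"
  then show "s \<in> {\<sigma>\<in>K. \<sigma> \<subseteq> A}" using simplicial_complex_face[of K \<sigma> s] by auto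
qed (auto dest: simplicial_complex_finite simplicial_complex_nonempty)

lemma simplicial_complex_induced_cones: "simplicial_complex K \<Longrightarrow> simplicial_complex (induced_cones K I A)"
  unfolding induced_cones_def by (intro simplicial_complex_cones) (auto simp: simplicial_complex_induced)

text \<open>The one extra demand on a fold of \<open>K\<close> is that \<open>w j\<close> stays
  inside every \<open>A c\<close> containing \<open>\<rho> j\<close>: a simplex of such a cone then
  remains in it when \<open>w j\<close> is added. Apexes lie in no \<open>\<rho> j\<close>, so a
  cone simplex contains \<open>\<rho> j\<close> exactly when its base part does.\<close>

lemma collapses_induced_cones:
  fixes rk :: "'i \<Rightarrow> int"
  assumes "finite J" "\<And>j. j \<in> J \<Longrightarrow> finite (\<rho> j) \<and> \<rho> j \<noteq> {} \<and> I \<inter> \<rho> j = {}"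
    and w: "\<And>j. j \<in> J \<Longrightarrow> w j \<notin> \<rho> j \<and> (\<forall>c\<in>I. \<rho> j \<subseteq> A c \<longrightarrow> w j \<in> A c)"
    and I: "I \<inter> \<Union>K = {}" and wI: "\<And>j. j \<in> J \<Longrightarrow> w j \<notin> I"
    and ins: "\<And>j \<sigma>. j \<in> J \<Longrightarrow> \<sigma> \<in> K \<Longrightarrow> \<rho> j \<subseteq> \<sigma> \<Longrightarrow> (\<And>i. i \<in> J \<Longrightarrow> rk i < rk j \<Longrightarrow> \<not> \<rho> i \<subseteq> \<sigma>) \<Longrightarrow>
        insert (w j) \<sigma> \<in> K \<and> (\<forall>i\<in>J. rk i \<le> rk j \<longrightarrow> w j \<in> \<rho> i \<longrightarrow> \<not> \<rho> i \<subseteq> insert (w j) \<sigma>)"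
  shows "collapses (induced_cones K I A) (induced_cones {\<sigma>\<in>K. \<forall>j\<in>J. \<not> \<rho> j \<subseteq> \<sigma>} I A)"
proof -
  let ?C = "induced_cones K I A"
  have sub: "\<rho> j \<subseteq> insert c t \<longleftrightarrow> \<rho> j \<subseteq> t" if "j \<in> J" "c \<in> I" for j c t
    using assms(2)[OF that(1)] that(2) by blast
  have "collapses ?C {\<sigma>\<in>?C. \<forall>j\<in>J. \<not> \<rho> j \<subseteq> \<sigma>}"
  proof (rule collapses_family[where rk = rk])
    fix j assume j: "j \<in> J"
    have "insert (w j) \<sigma> \<in> ?C \<and> (\<forall>i\<in>J. rk i \<le> rk j \<longrightarrow> w j \<in> \<rho> i \<longrightarrow> \<not> \<rho> i \<subseteq> insert (w j) \<sigma>)"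
      if \<sigma>: "\<sigma> \<in> ?C" "\<rho> j \<subseteq> \<sigma>" "\<forall>i\<in>J. rk i < rk j \<longrightarrow> \<not> \<rho> i \<subseteq> \<sigma>" for \<sigma>
      using \<sigma>(1) unfolding induced_cones_iff[of \<sigma>]
    proof (elim disjE bexE exE conjE)
      assume \<sigma>K: "\<sigma> \<in> K"
      then show ?thesis
        using ins[OF j \<sigma>K \<sigma>(2)] \<sigma>(3) unfolding induced_cones_iff by simp
    next
      fix c t assume c: "c \<in> I" and t: "t \<in> K" "t \<subseteq> A c" "\<sigma> = insert c t"
      have \<rho>t: "\<rho> j \<subseteq> t" using \<sigma>(2) sub[OF j c] t(3) by simp
      have "\<not> \<rho> i \<subseteq> t" if "i \<in> J" "rk i < rk j" for i
        using \<sigma>(3) that t(3) by blast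
      note * = ins[OF j t(1) \<rho>t this]
      have "insert (w j) t \<subseteq> A c" using w[OF j] c \<rho>t t(2) by blast
      moreover have eq: "insert (w j) \<sigma> = insert c (insert (w j) t)" using t(3) by blast
      ultimately have "insert (w j) \<sigma> \<in> ?C"
        unfolding induced_cones_iff using * c by blast
      moreover have "\<not> \<rho> i \<subseteq> insert (w j) \<sigma>" if "i \<in> J" "rk i \<le> rk j" "w j \<in> \<rho> i" for i
        using * that sub[OF that(1) c, of "insert (w j) t"] eq by simp
      ultimately show ?thesis by blast
    next
      fix c t assume "c \<in> I" "t = {}" "\<sigma> = insert c t"
      then have False using \<sigma>(2) assms(2)[OF j] by blast
      then show ?thesis ..
    qed
    then show "\<exists>w. w \<notin> \<rho> j \<and> (\<forall>\<sigma>\<in>?C. \<rho> j \<subseteq> \<sigma> \<longrightarrow>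
        (\<forall>i\<in>J. rk i < rk j \<longrightarrow> \<not> \<rho> i \<subseteq> \<sigma>) \<longrightarrow> insert w \<sigma> \<in> ?C \<and>
        (\<forall>i\<in>J. rk i \<le> rk j \<longrightarrow> w \<in> \<rho> i \<longrightarrow> \<not> \<rho> i \<subseteq> insert w \<sigma>))"
      using w[OF j] by (intro exI[of _ "w j"]) simp
  qed (use assms(1,2) in simp_all)
  moreover have "{\<sigma>\<in>?C. \<forall>j\<in>J. \<not> \<rho> j \<subseteq> \<sigma>} = induced_cones {\<sigma>\<in>K. \<forall>j\<in>J. \<not> \<rho> j \<subseteq> \<sigma>} I A"
    (is "?L = ?R")
  proof -
    have good: "(\<forall>j\<in>J. \<not> \<rho> j \<subseteq> insert c t) \<longleftrightarrow> (\<forall>j\<in>J. \<not> \<rho> j \<subseteq> t)" if "c \<in> I" for c t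
      using sub[OF _ that] by simp
    have good0: "\<forall>j\<in>J. \<not> \<rho> j \<subseteq> {}" using assms(2) by simp
    show ?thesis
    proof (intro equalityI subsetI)
      fix \<sigma> assume "\<sigma> \<in> ?L"
      then have \<sigma>: "\<sigma> \<in> ?C" "\<forall>j\<in>J. \<not> \<rho> j \<subseteq> \<sigma>" by blast+
      show "\<sigma> \<in> ?R"
        using \<sigma>(1) unfolding induced_cones_iff[of \<sigma> K]
      proof (elim disjE bexE exE conjE)
        assume "\<sigma> \<in> K"
        then show ?thesis unfolding induced_cones_iff using \<sigma>(2) by blast
      next
        fix c t assume c: "c \<in> I" "t \<subseteq> A c" "\<sigma> = insert c t" and t: "t \<in> K"
        then have "t \<in> {\<sigma>\<in>K. \<forall>j\<in>J. \<not> \<rho> j \<subseteq> \<sigma>}" using \<sigma>(2) good[OF c(1)] by blast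
        then show ?thesis unfolding induced_cones_iff using c by blast
      next
        fix c t assume "c \<in> I" "t \<subseteq> A c" "\<sigma> = insert c t" "t = {}"
        then show ?thesis unfolding induced_cones_iff by blast
      qed
    next
      fix \<sigma> assume "\<sigma> \<in> ?R"
      then have "(\<sigma> \<in> K \<or> (\<exists>c\<in>I. \<exists>t. (t = {} \<or> t \<in> K) \<and> t \<subseteq> A c \<and> \<sigma> = insert c t)) \<and>
          (\<forall>j\<in>J. \<not> \<rho> j \<subseteq> \<sigma>)"
        unfolding induced_cones_iff[of \<sigma> "{\<sigma>\<in>K. \<forall>j\<in>J. \<not> \<rho> j \<subseteq> \<sigma>}"]
      proof (elim disjE bexE exE conjE)
        assume "\<sigma> \<in> {\<sigma>\<in>K. \<forall>j\<in>J. \<not> \<rho> j \<subseteq> \<sigma>}"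
        then show ?thesis by blast
      next
        fix c t assume c: "c \<in> I" "t \<subseteq> A c" "\<sigma> = insert c t"
          and t: "t \<in> {\<sigma>\<in>K. \<forall>j\<in>J. \<not> \<rho> j \<subseteq> \<sigma>}"
        have "\<forall>j\<in>J. \<not> \<rho> j \<subseteq> \<sigma>" unfolding c(3) good[OF c(1)] using t by simp
        then show ?thesis using c t by blast
      next
        fix c t assume c: "c \<in> I" "t \<subseteq> A c" "\<sigma> = insert c t" "t = {}"
        have "\<forall>j\<in>J. \<not> \<rho> j \<subseteq> \<sigma>" unfolding c(3) good[OF c(1)] c(4) by (rule good0)
        then show ?thesis using c by blast
      qed
      then show "\<sigma> \<in> ?L" by (simp add: induced_cones_iff)
    qed
  qed
  ultimately show ?thesis by simp
qed

text \<open>The intermediate complex contains each simplex \<open>\<tau> c\<close> and also the full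
  cone over it. Folding \<open>c\<close> into a vertex of \<open>\<tau> c\<close> removes the cone;
  folding \<open>\<tau> c\<close> into \<open>c\<close> leaves only the cone over its boundary. The
  last two hypotheses ensure that the only simplices above \<open>\<tau> c\<close> are itself and
  \<open>insert c (\<tau> c)\<close>.\<close>

lemma replace_simplices_by_cones:
  fixes K :: "'a set set"
  assumes K: "simplicial_complex K" and I: "finite I" "I \<inter> \<Union>K = {}"
    and \<tau>: "\<And>c. c \<in> I \<Longrightarrow> finite (\<tau> c) \<and> \<tau> c \<noteq> {} \<and> I \<inter> \<tau> c = {}"
    and faces: "\<And>c s. c \<in> I \<Longrightarrow> s \<subset> \<tau> c \<Longrightarrow> s \<noteq> {} \<Longrightarrow> s \<in> K"
    and max: "\<And>c \<sigma>. c \<in> I \<Longrightarrow> \<sigma> \<in> K \<Longrightarrow> \<not> \<tau> c \<subseteq> \<sigma>"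
    and inj: "\<And>c c'. c \<in> I \<Longrightarrow> c' \<in> I \<Longrightarrow> \<tau> c \<subseteq> \<tau> c' \<Longrightarrow> c = c'"
  shows "top_of_set (realization (K \<union> \<tau> ` I)) homotopy_equivalent_space
    top_of_set (realization (cones K I (\<lambda>c. {s. s \<noteq> {} \<and> s \<subset> \<tau> c})))"
proof -
  let ?X = "K \<union> \<tau> ` I"
  define Y where "Y = cones ?X I (\<lambda>c. {s. s \<noteq> {} \<and> s \<subseteq> \<tau> c})"
  have Y_iff: "\<sigma> \<in> Y \<longleftrightarrow> \<sigma> \<in> ?X \<or> (\<exists>c\<in>I. \<exists>s. s \<subseteq> \<tau> c \<and> \<sigma> = insert c s)" for \<sigma>
    unfolding Y_def cones_def by auto
  have faces': "s \<in> ?X" if "c \<in> I" "s \<subseteq> \<tau> c" "s \<noteq> {}" for c s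
    using faces[OF that(1) _ that(3)] that by (cases "s = \<tau> c") auto
  have X: "finite \<sigma> \<and> \<sigma> \<noteq> {}" if "\<sigma> \<in> ?X" for \<sigma>
    using that
  proof (elim UnE imageE)
    fix c assume "c \<in> I" "\<sigma> = \<tau> c"
    then show ?thesis using \<tau> by simp
  qed (simp add: simplicial_complex_finite[OF K] simplicial_complex_nonempty[OF K])
  have ascX: "simplicial_complex ?X"
  proof (rule simplicial_complexI)
    fix \<sigma> s assume "\<sigma> \<in> ?X" "s \<subseteq> \<sigma>" "s \<noteq> {}"
    then show "s \<in> ?X" using simplicial_complex_face[OF K, of \<sigma> s] faces' by blast
  qed (use X in blast)+
  have "simplicial_complex {s. s \<noteq> {} \<and> s \<subseteq> \<tau> c}" if "c \<in> I" for c
    using \<tau>[OF that] by (intro simplicial_complexI) (auto intro: finite_subset)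
  then have ascY: "simplicial_complex Y"
    unfolding Y_def using faces' by (intro simplicial_complex_cones ascX) blast
  have IX: "c \<notin> \<sigma>" if "\<sigma> \<in> ?X" "c \<in> I" for \<sigma> c
    using that I(2) \<tau> by blast
  have "collapses Y {\<sigma>\<in>Y. \<forall>c\<in>I. \<not> {c} \<subseteq> \<sigma>}"
  proof (rule collapses_family_apex[OF I(1)])
    fix c assume c: "c \<in> I"
    obtain x where x: "x \<in> \<tau> c" using \<tau>[OF c] by blast
    have "insert x \<sigma> \<in> Y" if \<sigma>: "\<sigma> \<in> Y" "{c} \<subseteq> \<sigma>" for \<sigma>
    proof -
      have "\<sigma> \<notin> ?X" using IX[of \<sigma> c] c \<sigma>(2) by blast
      then obtain c' s where s: "c' \<in> I" "s \<subseteq> \<tau> c'" "\<sigma> = insert c' s" using \<sigma>(1) unfolding Y_iff by blast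
      then have "c' = c" using \<sigma>(2) \<tau>[OF s(1)] c by blast
      then have "insert x s \<subseteq> \<tau> c" "insert x \<sigma> = insert c (insert x s)" using s x by blast+
      then show ?thesis unfolding Y_iff using c by blast
    qed
    moreover have "\<forall>i\<in>I. x \<notin> {i}" using \<tau>[OF c] x by blast
    ultimately show "\<exists>w. (\<forall>i\<in>I. w \<notin> {i}) \<and> (\<forall>\<sigma>\<in>Y. {c} \<subseteq> \<sigma> \<longrightarrow> insert w \<sigma> \<in> Y)"
      by (intro exI[of _ x]) simp
  qed simp
  moreover have "{\<sigma>\<in>Y. \<forall>c\<in>I. \<not> {c} \<subseteq> \<sigma>} = ?X"
  proof (intro equalityI subsetI)
    fix \<sigma> assume \<sigma>: "\<sigma> \<in> ?X"
    then have "\<sigma> \<in> Y" unfolding Y_iff ..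
    then show "\<sigma> \<in> {\<sigma>\<in>Y. \<forall>c\<in>I. \<not> {c} \<subseteq> \<sigma>}" using IX[OF \<sigma>] by simp
  next
    fix \<sigma> assume "\<sigma> \<in> {\<sigma>\<in>Y. \<forall>c\<in>I. \<not> {c} \<subseteq> \<sigma>}"
    then show "\<sigma> \<in> ?X" unfolding Y_iff mem_Collect_eq by blast
  qed
  ultimately have YX: "collapses Y ?X" by simp
  have "collapses Y {\<sigma>\<in>Y. \<forall>c\<in>I. \<not> \<tau> c \<subseteq> \<sigma>}"
  proof (rule collapses_family_apex[OF I(1)])
    fix c assume c: "c \<in> I"
    show "finite (\<tau> c) \<and> \<tau> c \<noteq> {}" using \<tau>[OF c] by simp
    have "insert c \<sigma> \<in> Y" if \<sigma>: "\<sigma> \<in> Y" "\<tau> c \<subseteq> \<sigma>" for \<sigma>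
    proof -
      consider "\<sigma> \<in> K" | c' where "c' \<in> I" "\<sigma> = \<tau> c'" | c' s where "c' \<in> I" "s \<subseteq> \<tau> c'" "\<sigma> = insert c' s"
        using \<sigma>(1) unfolding Y_iff by blast
      then show ?thesis
      proof cases
        case 1
        then show ?thesis using max[OF c] \<sigma>(2) by blast
      next
        case 2
        then have "c' = c" using inj[OF c 2(1)] \<sigma>(2) by simp
        then show ?thesis unfolding Y_iff using 2 by blast
      next
        case 3
        then have "\<tau> c \<subseteq> s" using \<sigma>(2) \<tau>[OF c] by blast
        then have "c' = c" using inj[OF c 3(1)] 3(2) by blast
        then show ?thesis using 3(3) \<sigma>(1) by simp
      qed
    qed
    moreover have "\<forall>i\<in>I. c \<notin> \<tau> i" using \<tau> c by blast
    ultimately show "\<exists>w. (\<forall>i\<in>I. w \<notin> \<tau> i) \<and> (\<forall>\<sigma>\<in>Y. \<tau> c \<subseteq> \<sigma> \<longrightarrow> insert w \<sigma> \<in> Y)"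
      by (intro exI[of _ c]) simp
  qed
  moreover have "{\<sigma>\<in>Y. \<forall>c\<in>I. \<not> \<tau> c \<subseteq> \<sigma>} = cones K I (\<lambda>c. {s. s \<noteq> {} \<and> s \<subset> \<tau> c})" (is "?L = ?R")
  proof -
    have R_iff: "\<sigma> \<in> ?R \<longleftrightarrow> \<sigma> \<in> K \<or> (\<exists>c\<in>I. \<exists>s. s \<subset> \<tau> c \<and> \<sigma> = insert c s)" for \<sigma>
    proof -
      have "insert {} {s. s \<noteq> {} \<and> s \<subset> \<tau> c} = {s. s \<subset> \<tau> c}" if "c \<in> I" for c
        using \<tau>[OF that] by blast
      then have "?R = K \<union> (\<Union>c\<in>I. insert c ` {s. s \<subset> \<tau> c})" unfolding cones_def by simp
      then show ?thesis by blast
    qed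
    show ?thesis
    proof (intro equalityI subsetI)
      fix \<sigma> assume "\<sigma> \<in> ?L"
      then have \<sigma>: "\<sigma> \<in> Y" "\<And>c. c \<in> I \<Longrightarrow> \<not> \<tau> c \<subseteq> \<sigma>" by simp_all
      show "\<sigma> \<in> ?R"
        using \<sigma>(1) unfolding Y_iff
      proof (elim disjE bexE exE conjE)
        assume "\<sigma> \<in> ?X"
        then show ?thesis unfolding R_iff using \<sigma>(2) by blast
      next
        fix c s assume s: "c \<in> I" "s \<subseteq> \<tau> c" "\<sigma> = insert c s"
        then have "s \<noteq> \<tau> c" using \<sigma>(2)[OF s(1)] by blast
        then show ?thesis unfolding R_iff using s by blast
      qed
    next
      fix \<sigma> assume "\<sigma> \<in> ?R"
      then have "\<sigma> \<in> Y \<and> (\<forall>c\<in>I. \<not> \<tau> c \<subseteq> \<sigma>)"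
        unfolding R_iff
      proof (elim disjE bexE exE conjE)
        assume "\<sigma> \<in> K"
        then show ?thesis unfolding Y_iff using max by blast
      next
        fix c s assume s: "c \<in> I" "s \<subset> \<tau> c" "\<sigma> = insert c s"
        have "\<not> \<tau> c' \<subseteq> \<sigma>" if c': "c' \<in> I" for c'
        proof
          assume "\<tau> c' \<subseteq> \<sigma>"
          then have "\<tau> c' \<subseteq> s" using \<tau>[OF c'] s(1,3) by blast
          moreover from this have "c' = c" using inj[OF c' s(1)] s(2) by blast
          ultimately show False using s(2) by blast
        qed
        moreover have "\<sigma> \<in> Y" unfolding Y_iff using s by blast
        ultimately show ?thesis by blast
      qed
      then show "\<sigma> \<in> ?L" by simp
    qed
  qed
  ultimately have "collapses Y ?R" by simp
  with YX show ?thesis by (intro collapses_common_homotopy_equivalent[OF _ _ ascY])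
qed

section \<open>Arcs on a circle\<close>

text \<open>With \<open>e\<close> periodic this is a complex on a circle whose simplices are
  required to lift to the line; a set that merely has small pairwise cyclic distances, such as a
  winding triangle, is excluded.\<close>

definition line_complex :: "(int \<Rightarrow> 'a) \<Rightarrow> int \<Rightarrow> 'a set set" where
  "line_complex e r = (`) e ` {s. finite s \<and> s \<noteq> {} \<and> (\<forall>x\<in>s. \<forall>y\<in>s. \<bar>y - x\<bar> \<le> r)}"

lemma line_complexI:
  "finite s \<Longrightarrow> s \<noteq> {} \<Longrightarrow> (\<And>x y. x \<in> s \<Longrightarrow> y \<in> s \<Longrightarrow> \<bar>y - x\<bar> \<le> r) \<Longrightarrow> e ` s \<in> line_complex e r"
  unfolding line_complex_def by blast

lemma line_complexD:
  "\<sigma> \<in> line_complex e r \<Longrightarrow>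
    \<exists>s. finite s \<and> s \<noteq> {} \<and> (\<forall>x\<in>s. \<forall>y\<in>s. \<bar>y - x\<bar> \<le> r) \<and> \<sigma> = e ` s"
  unfolding line_complex_def by blast

lemma simplicial_complex_line_complex: "simplicial_complex (line_complex e r)"
proof -
  have "simplicial_complex {s :: int set. finite s \<and> s \<noteq> {} \<and> (\<forall>x\<in>s. \<forall>y\<in>s. \<bar>y - x\<bar> \<le> r)}"
    by (rule simplicial_complexI) (auto intro: finite_subset)
  then show ?thesis unfolding line_complex_def by (rule simplicial_complex_image)
qed

lemma eq_of_dvd_diff:
  fixes x y N :: int
  assumes "N dvd x - y" "\<bar>x - y\<bar> < N"
  shows "x = y"
proof (rule ccontr)
  assume "x \<noteq> y"
  then have "\<bar>N\<bar> \<le> \<bar>x - y\<bar>" using assms(1) by (intro dvd_imp_le_int) auto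
  then show False using assms(2) by linarith
qed

text \<open>A lift may be translated by multiples of \<open>N\<close>, so it can be made to pass
  through any prescribed \<open>p\<close> over a vertex. Another vertex with a representative
  \<open>q\<close> close to \<open>p\<close> must be lifted to \<open>q\<close> itself, since the
  two candidates differ by a multiple of \<open>N\<close> of absolute value less than
  \<open>N\<close>.\<close>

lemma line_complex_lift:
  fixes e :: "int \<Rightarrow> 'a"
  assumes e: "\<And>x y. e x = e y \<longleftrightarrow> N dvd x - y" and \<sigma>: "\<sigma> \<in> line_complex e r"
    and p: "e p \<in> \<sigma>"
  shows "\<exists>s. finite s \<and> (\<forall>x\<in>s. \<forall>y\<in>s. \<bar>y - x\<bar> \<le> r) \<and> \<sigma> = e ` s \<and> p \<in> s \<and>
    (\<forall>q. e q \<in> \<sigma> \<longrightarrow> \<bar>q - p\<bar> + r < N \<longrightarrow> q \<in> s)"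
proof -
  obtain s where "finite s \<and> s \<noteq> {} \<and> (\<forall>x\<in>s. \<forall>y\<in>s. \<bar>y - x\<bar> \<le> r) \<and> \<sigma> = e ` s"
      using line_complexD[OF \<sigma>] by blast
    then have s: "finite s" "\<And>x y. x \<in> s \<Longrightarrow> y \<in> s \<Longrightarrow> \<bar>y - x\<bar> \<le> r" "\<sigma> = e ` s"
      by blast+
  obtain p0 where p0: "p0 \<in> s" "e p = e p0" using p s(3) by blast
  define t where "t = (\<lambda>x. x + (p - p0)) ` s"
  have N: "N dvd p - p0" using p0(2) unfolding e .
  have et: "e (x + (p - p0)) = e x" for x unfolding e using N by simp
  have t: "\<bar>y - x\<bar> \<le> r" if "x \<in> t" "y \<in> t" for x y
    using that s(2) unfolding t_def by auto
  show ?thesis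
  proof (intro exI[of _ t] conjI ballI allI impI)
    show "finite t" unfolding t_def using s(1) by simp
    show "\<bar>y - x\<bar> \<le> r" if "x \<in> t" "y \<in> t" for x y
      by (rule t[OF that])
    show \<sigma>t: "\<sigma> = e ` t" unfolding t_def image_image et s(3) ..
    show pt: "p \<in> t" unfolding t_def using p0(1) by force
    show "q \<in> t" if q: "e q \<in> \<sigma>" "\<bar>q - p\<bar> + r < N" for q
    proof -
      obtain q0 where q0: "q0 \<in> t" "e q = e q0" using q(1) \<sigma>t by blast
      have "\<bar>q0 - p\<bar> \<le> r" using t[OF pt q0(1)] .
      then have "\<bar>q - q0\<bar> < N" using q(2) by linarith
      moreover have "N dvd q - q0" using q0(2) unfolding e .
      ultimately have "q = q0" by (rule eq_of_dvd_diff[rotated])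
      then show ?thesis using q0(1) by simp
    qed
  qed
qed

text \<open>First the edges passing strictly over a multiple of \<open>k\<close> are folded into that multiple; the other
  vertices then lie in one arc each and are folded into its left end.\<close>
lemma collapses_circle_to_triangle_0:
  fixes e :: "int \<Rightarrow> 'a" and k :: int
  assumes k: "k > 0" and e: "\<And>x y. e x = e y \<longleftrightarrow> 3 * k dvd x - y"
  shows "collapses (line_complex e k) {\<sigma>. \<sigma> \<noteq> {} \<and> \<sigma> \<subset> e ` {0, k, 2 * k}}"
proof -
  let ?L = "line_complex e k"
  \<comment> \<open>The edge from \<open>p\<close> to \<open>q\<close> straddles a multiple of
    \<open>k\<close>.\<close>
  define st where "st = (\<lambda>p q. \<exists>m. k dvd m \<and> p < m \<and> m < q \<and> q \<le> p + k)"
  define J where "J = {(p, q). 0 \<le> p \<and> p < 3 * k \<and> st p q}"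
  note lift = line_complex_lift[OF e]
  have ne: "e x \<noteq> e y" if xy: "x < y" "y < x + 3 * k" for x y
  proof
    assume "e x = e y"
    then have "3 * k dvd x - y" unfolding e .
    then have "x = y" by (rule eq_of_dvd_diff) (use xy in linarith)
    then show False using xy(1) by simp
  qed
  \<comment> \<open>Both ends are at positive distance less than \<open>k\<close> from the multiple
    between them. Multiples of \<open>k\<close> are therefore never ends of straddling edges and can
    serve as apexes for all of them at once.\<close>
  have st_ndvd: "\<not> k dvd p \<and> \<not> k dvd q" if st: "st p q" for p q
  proof -
    obtain m where m: "k dvd m" "p < m" "m < q" "q \<le> p + k" using st unfolding st_def by blast
    have "\<not> k dvd m - p" using m by (intro zdvd_not_zless) auto
    moreover have "\<not> k dvd q - m" using m by (intro zdvd_not_zless) auto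
    ultimately show ?thesis using m(1) dvd_diff[of k m p] dvd_diff[of k q m] by blast
  qed
  have e_dvd: "k dvd x \<longleftrightarrow> k dvd y" if "e x = e y" for x y
  proof -
    have "3 * k dvd x - y" using that unfolding e .
    then have "k dvd x - y" using dvd_trans[of k "3 * k" "x - y"] by simp
    then show ?thesis using dvd_add_right_iff[of k "x - y" y] by simp
  qed
  have Jst: "\<exists>j\<in>J. {e (fst j), e (snd j)} = {e p, e q}" if "st p q" for p q
  proof -
    let ?d = "p mod (3 * k) - p"
    have d: "3 * k dvd ?d" by (simp add: mod_eq_dvd_iff[symmetric])
    then have "k dvd ?d" using dvd_trans[of k "3 * k"] by simp
    then have "st (p mod (3 * k)) (q + ?d)"
      using that unfolding st_def by (elim exE) (rule exI[of _ "_ + ?d"], auto)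
    then have "(p mod (3 * k), q + ?d) \<in> J" unfolding J_def using k by simp
    moreover have "e (p mod (3 * k)) = e p" "e (q + ?d) = e q" unfolding e using d by simp_all
    ultimately show ?thesis by force
  qed
  have "J \<subseteq> {0..3 * k} \<times> {0..4 * k}" unfolding J_def st_def by auto
  then have finJ: "finite J" by (rule finite_subset) simp
  define K1 where "K1 = {\<sigma>\<in>?L. \<forall>j\<in>J. \<not> {e (fst j), e (snd j)} \<subseteq> \<sigma>}"
  have "collapses ?L K1"
    unfolding K1_def
  proof (rule collapses_family_apex[OF finJ])
    fix j assume "j \<in> J"
    then obtain p q m where j: "j = (p, q)" and m: "k dvd m" "p < m" "m < q" "q \<le> p + k"
      unfolding J_def st_def by blast
    have "insert (e m) \<sigma> \<in> ?L" if \<sigma>: "\<sigma> \<in> ?L" "{e p, e q} \<subseteq> \<sigma>" for \<sigma>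
    proof -
      obtain s where s: "finite s" "\<forall>x\<in>s. \<forall>y\<in>s. \<bar>y - x\<bar> \<le> k" "\<sigma> = e ` s" "p \<in> s" "q \<in> s"
      proof -
        have pq: "e p \<in> \<sigma>" "e q \<in> \<sigma>" "\<bar>q - p\<bar> + k < 3 * k" using \<sigma>(2) m k by auto
        show thesis using lift[OF \<sigma>(1) pq(1)] pq(2,3) that by blast
      qed
      have "\<bar>m - x\<bar> \<le> k" if "x \<in> s" for x
        using s(2,4,5) that m by (smt (verit, best))
      then have "e ` insert m s \<in> ?L" using s k by (intro line_complexI) (auto simp: abs_minus_commute)
      then show ?thesis using s(3) by simp
    qed
    moreover have "e m \<notin> {e (fst i), e (snd i)}" if "i \<in> J" for i
    proof -
      have "st (fst i) (snd i)" using that unfolding J_def by auto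
      from st_ndvd[OF this] show ?thesis using e_dvd[of m "fst i"] e_dvd[of m "snd i"] m(1) by auto
    qed
    ultimately show "\<exists>w. (\<forall>i\<in>J. w \<notin> {e (fst i), e (snd i)}) \<and>
        (\<forall>\<sigma>\<in>?L. {e (fst j), e (snd j)} \<subseteq> \<sigma> \<longrightarrow> insert w \<sigma> \<in> ?L)"
      unfolding j by (intro exI[of _ "e m"]) simp
  qed simp
  define J2 where "J2 = {p. 0 \<le> p \<and> p < 3 * k \<and> \<not> k dvd p}"
  have finJ2: "finite J2" unfolding J2_def by (rule finite_subset[of _ "{0..3 * k}"]) auto
  have K1_no: "\<not> (p \<in> s \<and> q \<in> s \<and> st p q)" if "e ` s \<in> K1" for p q s
    using that Jst[of p q] unfolding K1_def by blast
  have "collapses K1 {\<sigma>\<in>K1. \<forall>p\<in>J2. \<not> {e p} \<subseteq> \<sigma>}"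
  proof (rule collapses_family_apex[OF finJ2])
    fix p assume "p \<in> J2"
    then have p: "\<not> k dvd p" unfolding J2_def by simp
    define m where "m = p - p mod k"
    have m: "k dvd m" "m < p" "p < m + k"
    proof -
      have "0 \<le> p mod k" "p mod k < k" using k by simp_all
      moreover have "p mod k \<noteq> 0" using p by (simp add: dvd_eq_mod_eq_0)
      ultimately show "k dvd m" "m < p" "p < m + k" unfolding m_def by (simp_all add: dvd_minus_mod)
    qed
    have "insert (e m) \<sigma> \<in> K1" if \<sigma>: "\<sigma> \<in> K1" "{e p} \<subseteq> \<sigma>" for \<sigma>
    proof -
      have \<sigma>L: "\<sigma> \<in> ?L" using \<sigma>(1) unfolding K1_def by simp
      obtain s where s: "finite s" "\<forall>x\<in>s. \<forall>y\<in>s. \<bar>y - x\<bar> \<le> k" "\<sigma> = e ` s" "p \<in> s"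
        using lift[OF \<sigma>L, of p] \<sigma>(2) by blast
      \<comment> \<open>In the absence of straddling edges, a simplex through an interior point of
        the arc from \<open>m\<close> to \<open>m + k\<close> cannot leave that arc.\<close>
      have range: "m \<le> x \<and> x \<le> m + k" if x: "x \<in> s" for x
      proof -
        have xp: "\<bar>x - p\<bar> \<le> k" using s(2,4) x by blast
        have "st x p" if "x < m" unfolding st_def using m that xp by (intro exI[of _ m]) simp
        moreover have "st p x" if "m + k < x" unfolding st_def using m that xp by (intro exI[of _ "m + k"]) simp
        moreover have "e ` s \<in> K1" using \<sigma>(1) s(3) by simp
        ultimately show ?thesis using K1_no[of s x p] K1_no[of s p x] s(4) x by linarith
      qed
      have L: "e ` insert m s \<in> ?L"
      proof (rule line_complexI)
        fix x y assume "x \<in> insert m s" "y \<in> insert m s"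
        then have "m \<le> x \<and> x \<le> m + k" "m \<le> y \<and> y \<le> m + k" using range k by auto
        then show "\<bar>y - x\<bar> \<le> k" by linarith
      qed (use s(1) in auto)
      \<comment> \<open>Adding the left end \<open>m\<close> creates no straddling edge: such an
        edge would have both ends strictly inside one arc, with a multiple of \<open>k\<close>
        between them.\<close>
      have "\<not> {e (fst j), e (snd j)} \<subseteq> e ` insert m s" if j: "j \<in> J" for j
      proof
        assume *: "{e (fst j), e (snd j)} \<subseteq> e ` insert m s"
        have st: "st (fst j) (snd j)" using j unfolding J_def by auto
        obtain a b where ab: "a \<in> insert m s" "b \<in> insert m s" "e (fst j) = e a" "e (snd j) = e b"
          using * by blast
        have r: "m \<le> a" "a \<le> m + k" "m \<le> b" "b \<le> m + k" using ab(1,2) range k by auto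
        obtain m' where m': "k dvd m'" "fst j < m'" "m' < snd j" "snd j \<le> fst j + k"
          using st unfolding st_def by blast
        have na: "\<not> k dvd a" "\<not> k dvd b" using st_ndvd[OF st] e_dvd ab(3,4) by blast+
        then have r': "m < a" "a < m + k" "m < b" "b < m + k"
          using r m(1) by (metis dvd_add_triv_right_iff order_le_less)+
        have "3 * k dvd (snd j - fst j) - (b - a)"
        proof -
          have "3 * k dvd snd j - b" "3 * k dvd fst j - a" using ab(3,4) unfolding e by simp_all
          then have "3 * k dvd (snd j - b) - (fst j - a)" by (rule dvd_diff)
          moreover have "(snd j - b) - (fst j - a) = (snd j - fst j) - (b - a)" by simp
          ultimately show ?thesis by (simp only:)
        qed
        moreover have "\<bar>(snd j - fst j) - (b - a)\<bar> < 3 * k" using m' r' by linarith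
        ultimately have eq: "snd j - fst j = b - a" by (rule eq_of_dvd_diff)
        have "k dvd m' - fst j + a - m"
        proof -
          have "3 * k dvd fst j - a" using ab(3) unfolding e .
          then have "k dvd fst j - a" using dvd_trans[of k "3 * k"] by simp
          from dvd_diff[OF dvd_diff[OF m'(1) this] m(1)] have "k dvd m' - (fst j - a) - m" .
          moreover have "m' - (fst j - a) - m = m' - fst j + a - m" by simp
          ultimately show ?thesis by (simp only:)
        qed
        moreover have "0 < m' - fst j + a - m" "m' - fst j + a - m < k" using m' r' eq by linarith+
        ultimately show False by (simp add: zdvd_not_zless)
      qed
      with L have "e ` insert m s \<in> K1" unfolding K1_def by blast
      then show ?thesis using s(3) by simp
    qed
    moreover have "e m \<notin> {e q}" if "q \<in> J2" for q
      using that e_dvd[of m q] m(1) unfolding J2_def by auto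
    ultimately show "\<exists>w. (\<forall>q\<in>J2. w \<notin> {e q}) \<and> (\<forall>\<sigma>\<in>K1. {e p} \<subseteq> \<sigma> \<longrightarrow> insert w \<sigma> \<in> K1)"
      by (intro exI[of _ "e m"]) simp
  qed simp
  moreover have "{\<sigma>\<in>K1. \<forall>p\<in>J2. \<not> {e p} \<subseteq> \<sigma>} = {\<sigma>. \<sigma> \<noteq> {} \<and> \<sigma> \<subset> e ` {0, k, 2 * k}}"
  proof (intro equalityI subsetI)
    fix \<sigma> assume "\<sigma> \<in> {\<sigma>\<in>K1. \<forall>p\<in>J2. \<not> {e p} \<subseteq> \<sigma>}"
    then have \<sigma>: "\<sigma> \<in> ?L" "\<And>p. p \<in> J2 \<Longrightarrow> e p \<notin> \<sigma>" unfolding K1_def by simp_all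
    obtain s where "finite s \<and> s \<noteq> {} \<and> (\<forall>x\<in>s. \<forall>y\<in>s. \<bar>y - x\<bar> \<le> k) \<and> \<sigma> = e ` s"
      using line_complexD[OF \<sigma>(1)] by blast
    then have s: "finite s" "s \<noteq> {}" "\<And>x y. x \<in> s \<Longrightarrow> y \<in> s \<Longrightarrow> \<bar>y - x\<bar> \<le> k" "\<sigma> = e ` s"
      by blast+
    have dvd: "k dvd x" if "x \<in> s" for x
    proof (rule ccontr)
      assume n: "\<not> k dvd x"
      have ex: "e (x mod (3 * k)) = e x" unfolding e by (rule mod_eq_dvd_iff[THEN iffD1]) simp
      have "x mod (3 * k) \<in> J2" using e_dvd[OF ex] n k unfolding J2_def by simp
      from \<sigma>(2)[OF this] show False unfolding ex s(4) using that by simp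
    qed
    define a where "a = Min s"
    have a: "a \<in> s" "\<And>x. x \<in> s \<Longrightarrow> a \<le> x" unfolding a_def using s(1,2) by auto
    have sa: "x = a \<or> x = a + k" if "x \<in> s" for x
    proof -
      have "0 \<le> x - a" "x - a \<le> k" using a(2)[OF that] s(3)[OF a(1) that] by auto
      moreover have "k dvd x - a" using dvd[OF that] dvd[OF a(1)] by (rule dvd_diff)
      ultimately show ?thesis using zdvd_not_zless[of "x - a" k] by linarith
    qed
    define i where "i = a div k"
    have i: "a = i * k" unfolding i_def using dvd[OF a(1)] by simp
    \<comment> \<open>Modulo \<open>3 * k\<close> there are only three multiples of
      \<open>k\<close>, so two consecutive ones always give an edge of the triangle on 0,
      \<open>k\<close> and \<open>2 * k\<close>.\<close>
    have cls: "e (i * k) = (if i mod 3 = 0 then e 0 else if i mod 3 = 1 then e k else e (2 * k))" for i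
    proof -
      have "3 dvd i - i mod 3" by (rule dvd_minus_mod)
      then have "3 * k dvd (i - i mod 3) * k" by (rule mult_dvd_mono) simp
      then have "e (i * k) = e (i mod 3 * k)" unfolding e left_diff_distrib .
      moreover have "i mod 3 = 0 \<or> i mod 3 = 1 \<or> i mod 3 = 2" by presburger
      ultimately show ?thesis by auto
    qed
    have "(i + 1) * k = a + k" using i by (simp add: distrib_right)
    then have sub: "\<sigma> \<subseteq> {e (i * k), e ((i + 1) * k)}" using sa unfolding s(4) i[symmetric] by auto
    have e_ne: "e 0 \<noteq> e k" "e 0 \<noteq> e (2 * k)" "e k \<noteq> e (2 * k)"
      by (rule ne; use k in simp)+
    have "i mod 3 = 0 \<and> (i + 1) mod 3 = 1 \<or> i mod 3 = 1 \<and> (i + 1) mod 3 = 2 \<or> i mod 3 = 2 \<and> (i + 1) mod 3 = 0"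
      by presburger
    then have "\<sigma> \<subseteq> {e 0, e k} \<or> \<sigma> \<subseteq> {e k, e (2 * k)} \<or> \<sigma> \<subseteq> {e (2 * k), e 0}"
      using sub unfolding cls[of i] cls[of "i + 1"] by (elim disjE) simp_all
    then have "\<sigma> \<subseteq> e ` {0, k, 2 * k} \<and> (\<exists>x\<in>e ` {0, k, 2 * k}. x \<notin> \<sigma>)"
    proof (elim disjE)
      assume *: "\<sigma> \<subseteq> {e 0, e k}"
      then have "e (2 * k) \<notin> \<sigma>" using e_ne by auto
      then show ?thesis using * by auto
    next
      assume *: "\<sigma> \<subseteq> {e k, e (2 * k)}"
      then have "e 0 \<notin> \<sigma>" using e_ne by auto
      then show ?thesis using * by auto
    next
      assume *: "\<sigma> \<subseteq> {e (2 * k), e 0}"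
      then have "e k \<notin> \<sigma>" using e_ne by auto
      then show ?thesis using * by auto
    qed
    then have "\<sigma> \<subset> e ` {0, k, 2 * k}" by blast
    then show "\<sigma> \<in> {\<sigma>. \<sigma> \<noteq> {} \<and> \<sigma> \<subset> e ` {0, k, 2 * k}}" using s(2,4) by simp
  next
    fix \<sigma> assume "\<sigma> \<in> {\<sigma>. \<sigma> \<noteq> {} \<and> \<sigma> \<subset> e ` {0, k, 2 * k}}"
    then have \<sigma>: "\<sigma> \<noteq> {}" "\<sigma> \<subseteq> {e 0, e k, e (2 * k)}" "\<sigma> \<noteq> {e 0, e k, e (2 * k)}" by auto
    have e3: "e 0 = e (3 * k)" unfolding e by simp
    have "\<sigma> \<subseteq> {e 0, e k} \<or> \<sigma> \<subseteq> {e k, e (2 * k)} \<or> \<sigma> \<subseteq> {e (2 * k), e 0}"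
      using \<sigma>(2,3) by (cases "e 0 \<in> \<sigma>"; cases "e k \<in> \<sigma>"; cases "e (2 * k) \<in> \<sigma>") auto
    then have "\<exists>m. k dvd m \<and> \<sigma> \<subseteq> e ` {m, m + k}"
    proof (elim disjE)
      assume "\<sigma> \<subseteq> {e 0, e k}" then show ?thesis by (intro exI[of _ 0]) auto
    next
      assume "\<sigma> \<subseteq> {e k, e (2 * k)}" then show ?thesis by (intro exI[of _ k]) auto
    next
      assume "\<sigma> \<subseteq> {e (2 * k), e 0}" then show ?thesis using e3 by (intro exI[of _ "2 * k"]) auto
    qed
    then obtain m where m: "k dvd m" "\<sigma> \<subseteq> e ` {m, m + k}" by blast
    have "e ` {m, m + k} \<in> ?L" using k by (intro line_complexI) auto
    then have \<sigma>L: "\<sigma> \<in> ?L" using simplicial_complex_face[OF simplicial_complex_line_complex _ m(2) \<sigma>(1)] by simp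
    have nd: "e x \<notin> \<sigma>" if "\<not> k dvd x" for x
      using m that e_dvd[of x m] e_dvd[of x "m + k"] by auto
    have "\<not> {e (fst j), e (snd j)} \<subseteq> \<sigma>" if "j \<in> J" for j
      using that st_ndvd[of "fst j" "snd j"] nd unfolding J_def by auto
    moreover have "e p \<notin> \<sigma>" if "p \<in> J2" for p using that nd unfolding J2_def by simp
    ultimately show "\<sigma> \<in> {\<sigma>\<in>K1. \<forall>p\<in>J2. \<not> {e p} \<subseteq> \<sigma>}" unfolding K1_def using \<sigma>L by simp
  qed
  ultimately show ?thesis using \<open>collapses ?L K1\<close> by (metis rtranclp_trans)
qed

text \<open>Shifting the parametrisation by \<open>t\<close> changes the target triangle but not the
  complex. The \<open>k\<close> apexes over one circle can thus each be given a different winding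
  triangle.\<close>

lemma collapses_circle_to_triangle:
  fixes e :: "int \<Rightarrow> 'a" and k t :: int
  assumes k: "k > 0" and e: "\<And>x y. e x = e y \<longleftrightarrow> 3 * k dvd x - y"
  shows "collapses (line_complex e k) {\<sigma>. \<sigma> \<noteq> {} \<and> \<sigma> \<subset> e ` {t, t + k, t + 2 * k}}"
proof -
  define e' where "e' = (\<lambda>x. e (t + x))"
  have "e' x = e' y \<longleftrightarrow> 3 * k dvd x - y" for x y unfolding e'_def e by simp
  from collapses_circle_to_triangle_0[OF k this]
  have "collapses (line_complex e' k) {\<sigma>. \<sigma> \<noteq> {} \<and> \<sigma> \<subset> e' ` {0, k, 2 * k}}" .
  moreover have "line_complex e' k = line_complex e k"
  proof (intro equalityI subsetI)
    fix \<sigma> assume "\<sigma> \<in> line_complex e' k"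
    then obtain s where "finite s \<and> s \<noteq> {} \<and> (\<forall>x\<in>s. \<forall>y\<in>s. \<bar>y - x\<bar> \<le> k) \<and> \<sigma> = e' ` s"
      using line_complexD by meson
    then have s: "finite s" "s \<noteq> {}" "\<And>x y. x \<in> s \<Longrightarrow> y \<in> s \<Longrightarrow> \<bar>y - x\<bar> \<le> k" "\<sigma> = e' ` s"
      by blast+
    have "e ` ((+) t ` s) \<in> line_complex e k" using s by (intro line_complexI) auto
    then show "\<sigma> \<in> line_complex e k" using s(4) unfolding e'_def by (simp add: image_image)
  next
    fix \<sigma> assume "\<sigma> \<in> line_complex e k"
    then obtain s where "finite s \<and> s \<noteq> {} \<and> (\<forall>x\<in>s. \<forall>y\<in>s. \<bar>y - x\<bar> \<le> k) \<and> \<sigma> = e ` s"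
      using line_complexD by meson
    then have s: "finite s" "s \<noteq> {}" "\<And>x y. x \<in> s \<Longrightarrow> y \<in> s \<Longrightarrow> \<bar>y - x\<bar> \<le> k" "\<sigma> = e ` s"
      by blast+
    have "e' ` ((\<lambda>x. x - t) ` s) \<in> line_complex e' k" using s by (intro line_complexI) auto
    then show "\<sigma> \<in> line_complex e' k" using s(4) unfolding e'_def by (simp add: image_image)
  qed
  moreover have "e' ` {0, k, 2 * k} = e ` {t, t + k, t + 2 * k}" unfolding e'_def by auto
  ultimately show ?thesis by simp
qed

text \<open>Without its closing edge the cycle is a path from 0 to \<open>N - 1\<close>, which is
  folded from its left end, each vertex into its right neighbour.\<close>

lemma collapses_path_to_point:
  fixes e :: "int \<Rightarrow> 'a" and N :: int
  assumes N: "N > 3" and e: "\<And>x y. e x = e y \<longleftrightarrow> N dvd x - y"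
  shows "collapses (line_complex e 1 - {{e (N - 1), e 0}}) {{e (N - 1)}}"
proof -
  define K where "K = line_complex e 1 - {{e (N - 1), e 0}}"
  have ne: "e x \<noteq> e y" if xy: "x < y" "y < x + N" for x y
  proof
    assume "e x = e y"
    then have "N dvd x - y" unfolding e .
    then have "x = y" by (rule eq_of_dvd_diff) (use xy in linarith)
    then show False using xy(1) by simp
  qed
  have "collapses K {\<sigma>\<in>K. \<forall>i\<in>{0..N - 2}. \<not> {e i} \<subseteq> \<sigma>}"
  proof (rule collapses_family[where rk = id])
    fix i assume i: "i \<in> {0..N - 2}"
    have "insert (e (i + 1)) \<sigma> \<in> K"
      if \<sigma>: "\<sigma> \<in> K" "{e i} \<subseteq> \<sigma>" "\<forall>j\<in>{0..N - 2}. id j < id i \<longrightarrow> \<not> {e j} \<subseteq> \<sigma>" for \<sigma>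
    proof -
      have \<sigma>L: "\<sigma> \<in> line_complex e 1" "e i \<in> \<sigma>" using \<sigma> unfolding K_def by auto
      obtain s where "finite s \<and> (\<forall>x\<in>s. \<forall>y\<in>s. \<bar>y - x\<bar> \<le> 1) \<and> \<sigma> = e ` s \<and> i \<in> s"
      using line_complex_lift[OF e \<sigma>L] by blast
    then have s: "finite s" "\<And>x y. x \<in> s \<Longrightarrow> y \<in> s \<Longrightarrow> \<bar>y - x\<bar> \<le> 1" "\<sigma> = e ` s" "i \<in> s"
      by blast+
      \<comment> \<open>For \<open>i = 0\<close> the left neighbour would give the deleted closing
        edge; for larger \<open>i\<close> that vertex has already been folded away.\<close>
      have "i - 1 \<notin> s"
      proof
        assume l: "i - 1 \<in> s"
        show False
        proof (cases "i = 0")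
          case True
          have "y = i - 1 \<or> y = i" if "y \<in> s" for y
            using s(2)[OF l that] s(2)[OF s(4) that] by linarith
          then have "s = {-1, 0}" using l s(4) True by auto
          moreover have "e (-1) = e (N - 1)" unfolding e by simp
          ultimately show False using \<sigma>(1) s(3) unfolding K_def by simp
        next
          case False
          then have "e (i - 1) \<notin> \<sigma>" using \<sigma>(3) i by auto
          then show False using l s(3) by simp
        qed
      qed
      have "y = i \<or> y = i + 1" if "y \<in> s" for y
      proof -
        have "\<bar>y - i\<bar> \<le> 1" "y \<noteq> i - 1" using s(2)[OF s(4) that] that \<open>i - 1 \<notin> s\<close> by auto
        then show ?thesis by linarith
      qed
      then have "insert (i + 1) s = {i, i + 1}" using s(4) by blast
      then have eq: "insert (e (i + 1)) \<sigma> = e ` {i, i + 1}" using s(3) by (metis image_insert)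
      have "e ` {i, i + 1} \<in> line_complex e 1" by (intro line_complexI) auto
      moreover have "e ` {i, i + 1} \<noteq> {e (N - 1), e 0}"
      proof
        assume a: "e ` {i, i + 1} = {e (N - 1), e 0}"
        have "e i \<noteq> e (N - 1)" using ne[of i "N - 1"] i by auto
        then have "e i = e 0" "e (i + 1) = e (N - 1)" using a by (auto simp: doubleton_eq_iff)
        then have "i = 0" using ne[of 0 i] i by force
        then show False using ne[of 1 "N - 1"] \<open>e (i + 1) = e (N - 1)\<close> N by simp
      qed
      ultimately show ?thesis unfolding K_def eq by simp
    qed
    moreover have "e (i + 1) \<notin> {e j}" if "j \<in> {0..N - 2}" "id j \<le> id i" for j
      using ne[of j "i + 1"] that i by auto
    ultimately show "\<exists>w. w \<notin> {e i} \<and> (\<forall>\<sigma>\<in>K. {e i} \<subseteq> \<sigma> \<longrightarrow>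
           (\<forall>j\<in>{0..N - 2}. id j < id i \<longrightarrow> \<not> {e j} \<subseteq> \<sigma>) \<longrightarrow> insert w \<sigma> \<in> K \<and>
           (\<forall>j\<in>{0..N - 2}. id j \<le> id i \<longrightarrow> w \<in> {e j} \<longrightarrow> \<not> {e j} \<subseteq> insert w \<sigma>))"
      using i by (intro exI[of _ "e (i + 1)"]) blast
  qed auto
  moreover have "{\<sigma>\<in>K. \<forall>i\<in>{0..N - 2}. \<not> {e i} \<subseteq> \<sigma>} = {{e (N - 1)}}"
  proof (intro equalityI subsetI)
    fix \<sigma> assume "\<sigma> \<in> {\<sigma>\<in>K. \<forall>i\<in>{0..N - 2}. \<not> {e i} \<subseteq> \<sigma>}"
    then have \<sigma>: "\<sigma> \<in> line_complex e 1" "\<And>i. 0 \<le> i \<Longrightarrow> i \<le> N - 2 \<Longrightarrow> e i \<notin> \<sigma>" unfolding K_def by auto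
    obtain s where "finite s \<and> s \<noteq> {} \<and> (\<forall>x\<in>s. \<forall>y\<in>s. \<bar>y - x\<bar> \<le> 1) \<and> \<sigma> = e ` s"
      using line_complexD[OF \<sigma>(1)] by blast
    then have s: "finite s" "s \<noteq> {}" "\<And>x y. x \<in> s \<Longrightarrow> y \<in> s \<Longrightarrow> \<bar>y - x\<bar> \<le> 1" "\<sigma> = e ` s"
      by blast+
    have "e x = e (N - 1)" if "x \<in> s" for x
    proof -
      have ex: "e x = e (x mod N)" unfolding e by (rule dvd_minus_mod)
      have "0 \<le> x mod N" "x mod N < N" using N by simp_all
      moreover have "e (x mod N) \<in> \<sigma>" unfolding ex[symmetric] s(4) using that by (rule imageI)
      then have "\<not> x mod N \<le> N - 2" using \<sigma>(2)[of "x mod N"] \<open>0 \<le> x mod N\<close> by blast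
      ultimately have "x mod N = N - 1" by linarith
      then show ?thesis using ex by simp
    qed
    then have "\<sigma> = {e (N - 1)}" using s(2,4) by auto
    then show "\<sigma> \<in> {{e (N - 1)}}" by simp
  next
    fix \<sigma> assume "\<sigma> \<in> {{e (N - 1)}}"
    then have \<sigma>: "\<sigma> = e ` {N - 1}" by simp
    have "\<sigma> \<in> line_complex e 1" unfolding \<sigma> by (intro line_complexI) auto
    moreover have n0: "e (N - 1) \<noteq> e 0" using ne[of 0 "N - 1"] N by simp
    then have "\<sigma> \<noteq> {e (N - 1), e 0}" unfolding \<sigma> by auto
    moreover have "e i \<noteq> e (N - 1)" if "i \<in> {0..N - 2}" for i using ne[of i "N - 1"] that by auto
    ultimately show "\<sigma> \<in> {\<sigma>\<in>K. \<forall>i\<in>{0..N - 2}. \<not> {e i} \<subseteq> \<sigma>}" unfolding K_def \<sigma> by auto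
  qed
  ultimately show ?thesis unfolding K_def by simp
qed

section \<open>Complexes on the torus\<close>

text \<open>For symmetric \<open>P\<close> containing 0 this is the clique complex of the Cayley
  graph of the integer plane with step set \<open>P\<close>; the encoding turns every fold into a
  question about displacements.\<close>

definition flag_family :: "(int \<times> int \<Rightarrow> bool) \<Rightarrow> (int \<times> int) set set" where
  "flag_family P = {s. finite s \<and> s \<noteq> {} \<and> (\<forall>x\<in>s. \<forall>y\<in>s. P (y - x))}"

definition wrap :: "int \<Rightarrow> int \<times> int \<Rightarrow> nat \<times> nat" where
  "wrap N p = (nat (fst p mod N), nat (snd p mod N))"

text \<open>The image of a planar complex, not a clique complex on the torus: simplices without a
  planar lift are left out by construction.\<close>

definition torus_complex :: "int \<Rightarrow> (int \<times> int \<Rightarrow> bool) \<Rightarrow> (nat \<times> nat) set set" where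
  "torus_complex N P = (`) (wrap N) ` flag_family P"

text \<open>The coordinatewise bound \<open>k\<close> on a torus of side \<open>3 * k\<close> makes
  lifts unique: two candidates near a common point differ by at most \<open>2 * k\<close> in each
  coordinate.\<close>

definition short :: "int \<Rightarrow> (int \<times> int \<Rightarrow> bool) \<Rightarrow> bool" where
  "short k P \<longleftrightarrow> P 0 \<and> (\<forall>d. P d \<longrightarrow> P (- d) \<and> \<bar>fst d\<bar> \<le> k \<and> \<bar>snd d\<bar> \<le> k)"

lemma shortD:
  assumes "short k P"
  shows "P 0" "P d \<Longrightarrow> P (- d)" "P d \<Longrightarrow> \<bar>fst d\<bar> \<le> k" "P d \<Longrightarrow> \<bar>snd d\<bar> \<le> k"
  using assms unfolding short_def by blast+

lemma wrap_eq:
  assumes "N > 0"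
  shows "wrap N p = wrap N q \<longleftrightarrow> N dvd fst p - fst q \<and> N dvd snd p - snd q"
proof -
  have "nat (a mod N) = nat (b mod N) \<longleftrightarrow> N dvd a - b" for a b
    unfolding mod_eq_dvd_iff[symmetric] using assms by (simp add: eq_nat_nat_iff)
  then show ?thesis by (simp add: wrap_def)
qed

lemma flag_familyD:
  assumes "s \<in> flag_family P"
  shows "finite s" "s \<noteq> {}" "x \<in> s \<Longrightarrow> y \<in> s \<Longrightarrow> P (y - x)"
  using assms unfolding flag_family_def by blast+

lemma simplicial_complex_flag_family: "simplicial_complex (flag_family P)"
  unfolding flag_family_def by (rule simplicial_complexI) (auto intro: finite_subset)

lemma simplicial_complex_torus_complex: "simplicial_complex (torus_complex N P)"
  unfolding torus_complex_def by (rule simplicial_complex_image[OF simplicial_complex_flag_family])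

lemma torus_complexI: "s \<in> flag_family P \<Longrightarrow> wrap N ` s \<in> torus_complex N P"
  unfolding torus_complex_def by (rule imageI)

text \<open>As on the circle, the lift is normalised to pass through \<open>p\<close>, and a vertex
  with a representative \<open>q\<close> near \<open>p\<close> has to be lifted to \<open>q\<close>,
  because two representatives less than \<open>N\<close> apart coincide.\<close>

lemma torus_lift:
  assumes N: "N = 3 * k" "k > 0" and P: "short k P" and \<sigma>: "\<sigma> \<in> torus_complex N P" and p: "wrap N p \<in> \<sigma>"
  shows "\<exists>s. s \<in> flag_family P \<and> \<sigma> = wrap N ` s \<and> p \<in> s \<and>
    (\<forall>q. wrap N q \<in> \<sigma> \<longrightarrow> \<bar>fst q - fst p\<bar> \<le> k \<longrightarrow> \<bar>snd q - snd p\<bar> \<le> k \<longrightarrow> q \<in> s)"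
proof -
  have N0: "N > 0" using N by simp
  obtain s where s: "s \<in> flag_family P" "\<sigma> = wrap N ` s" using \<sigma> unfolding torus_complex_def by blast
  obtain p0 where p0: "p0 \<in> s" "wrap N p = wrap N p0" using p s(2) by blast
  have d: "N dvd fst p - fst p0" "N dvd snd p - snd p0" using p0(2) unfolding wrap_eq[OF N0] by blast+
  define t where "t = (\<lambda>x. x + (p - p0)) ` s"
  have wt: "wrap N (x + (p - p0)) = wrap N x" for x unfolding wrap_eq[OF N0] using d by simp
  have t: "t \<in> flag_family P"
    using s(1) unfolding t_def flag_family_def by auto
  have \<sigma>t: "\<sigma> = wrap N ` t" unfolding t_def image_image wt s(2) ..
  have pt: "p \<in> t" unfolding t_def using p0(1) by (rule rev_image_eqI) simp
  have tq: "q \<in> t" if q: "wrap N q \<in> \<sigma>" "\<bar>fst q - fst p\<bar> \<le> k" "\<bar>snd q - snd p\<bar> \<le> k" for q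
  proof -
    obtain q0 where q0: "q0 \<in> t" "wrap N q = wrap N q0" using q(1) \<sigma>t by blast
    have "P (q0 - p)" by (rule flag_familyD(3)[OF t pt q0(1)])
    then have b: "\<bar>fst q0 - fst p\<bar> \<le> k" "\<bar>snd q0 - snd p\<bar> \<le> k" using shortD(3,4)[OF P, of "q0 - p"] by auto
    have "N dvd fst q - fst q0" "N dvd snd q - snd q0" using q0(2) unfolding wrap_eq[OF N0] by blast+
    moreover have "\<bar>fst q - fst q0\<bar> < N" "\<bar>snd q - snd q0\<bar> < N" using b q(2,3) N by linarith+
    ultimately have "fst q = fst q0" "snd q = snd q0" by (auto intro: eq_of_dvd_diff)
    then have "q = q0" by (simp add: prod_eq_iff)
    then show ?thesis using q0(1) by simp
  qed
  show ?thesis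
  proof (intro exI[of _ t] conjI allI impI)
    show "q \<in> t" if "wrap N q \<in> \<sigma>" "\<bar>fst q - fst p\<bar> \<le> k" "\<bar>snd q - snd p\<bar> \<le> k" for q
      by (rule tq[OF that])
  qed (fact t \<sigma>t pt)+
qed

lemma torus_lift_edge:
  assumes N: "N = 3 * k" "k > 0" and P: "short k P" and \<sigma>: "\<sigma> \<in> torus_complex N P"
    and pq: "{wrap N p, wrap N q} \<subseteq> \<sigma>" "\<bar>fst q - fst p\<bar> \<le> k" "\<bar>snd q - snd p\<bar> \<le> k"
  shows "\<exists>s. s \<in> flag_family P \<and> \<sigma> = wrap N ` s \<and> p \<in> s \<and> q \<in> s"
proof -
  have "wrap N p \<in> \<sigma>" "wrap N q \<in> \<sigma>" using pq(1) by auto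
  from torus_lift[OF N P \<sigma> this(1)]
  obtain s where "s \<in> flag_family P \<and> \<sigma> = wrap N ` s \<and> p \<in> s \<and>
      (\<forall>q. wrap N q \<in> \<sigma> \<longrightarrow> \<bar>fst q - fst p\<bar> \<le> k \<longrightarrow> \<bar>snd q - snd p\<bar> \<le> k \<longrightarrow> q \<in> s)"
    by (rule exE) (rule that)
  note s = this[THEN conjunct1] this[THEN conjunct2, THEN conjunct1]
    this[THEN conjunct2, THEN conjunct2, THEN conjunct1] this[THEN conjunct2, THEN conjunct2, THEN conjunct2]
  have "q \<in> s" by (rule s(4)[rule_format, OF \<open>wrap N q \<in> \<sigma>\<close> pq(2,3)])
  then show ?thesis by (intro exI[of _ s] conjI s(1-3))
qed

text \<open>An edge with displacement \<open>d\<close> is folded into the vertex at displacement \<open>\<omega> d\<close> from its first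
  endpoint, edges of small rank first.\<close>
lemma torus_fold:
  fixes P bad :: "int \<times> int \<Rightarrow> bool" and rk :: "int \<times> int \<Rightarrow> int"
  assumes N: "N = 3 * k" "k > 0" and P: "short k P"
    and bad0: "\<not> bad 0" and bad_sym: "\<And>d. bad (- d) = bad d" and rk_sym: "\<And>d. rk (- d) = rk d"
    and \<omega>: "\<And>d. P d \<Longrightarrow> bad d \<Longrightarrow> \<omega> d \<noteq> 0 \<and> \<omega> d \<noteq> d"
    and H: "\<And>d x. P d \<Longrightarrow> bad d \<Longrightarrow> P x \<Longrightarrow> P (x - d) \<Longrightarrow> (bad x \<Longrightarrow> rk d \<le> rk x) \<Longrightarrow>
        (bad (x - d) \<Longrightarrow> rk d \<le> rk (x - d)) \<Longrightarrow>
        P (x - \<omega> d) \<and> (bad (x - \<omega> d) \<longrightarrow> rk d < rk (x - \<omega> d))"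
    and A: "\<And>c p d. c \<in> I \<Longrightarrow> P d \<Longrightarrow> bad d \<Longrightarrow> wrap N p \<in> A c \<Longrightarrow> wrap N (p + d) \<in> A c \<Longrightarrow>
        wrap N (p + \<omega> d) \<in> A c"
    and I: "I \<inter> range (wrap N) = {}"
  shows "collapses (induced_cones (torus_complex N P) I A)
    (induced_cones (torus_complex N (\<lambda>d. P d \<and> \<not> bad d)) I A)"
proof -
  have N0: "N > 0" using N by simp
  \<comment> \<open>First endpoints are confined to one fundamental square, which makes the family
    finite while still covering every edge of the torus.\<close>
  define J where "J = {j. 0 \<le> fst (fst j) \<and> fst (fst j) < N \<and> 0 \<le> snd (fst j) \<and> snd (fst j) < N \<and>
    P (snd j) \<and> bad (snd j)}"
  define \<rho> where "\<rho> = (\<lambda>j. {wrap N (fst j), wrap N (fst j + snd j)})"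
  define w where "w = (\<lambda>j. wrap N (fst j + \<omega> (snd j)))"
  have "J \<subseteq> ({0..N} \<times> {0..N}) \<times> ({-k..k} \<times> {-k..k})"
  proof
    fix j assume "j \<in> J"
    moreover from this have "\<bar>fst (snd j)\<bar> \<le> k" "\<bar>snd (snd j)\<bar> \<le> k"
      using shortD(3,4)[OF P] unfolding J_def by blast+
    ultimately show "j \<in> ({0..N} \<times> {0..N}) \<times> ({-k..k} \<times> {-k..k})"
      unfolding J_def by (auto simp: mem_Times_iff)
  qed
  then have finJ: "finite J" by (rule finite_subset) simp
  have PJ: "P (snd j)" "bad (snd j)" if "j \<in> J" for j using that unfolding J_def by blast+
  have J_ex: "\<exists>j\<in>J. \<rho> j = {wrap N p, wrap N (p + d)} \<and> snd j = d" if d: "P d" "bad d" for p d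
  proof (rule bexI[of _ "((fst p mod N, snd p mod N), d)"])
    have m: "N dvd x mod N - x" for x :: int by (rule mod_eq_dvd_iff[THEN iffD1]) simp
    have "wrap N (fst p mod N, snd p mod N) = wrap N p" unfolding wrap_eq[OF N0] using m by simp
    moreover have "wrap N ((fst p mod N, snd p mod N) + d) = wrap N (p + d)"
      unfolding wrap_eq[OF N0] using m by simp
    ultimately show "\<rho> ((fst p mod N, snd p mod N), d) = {wrap N p, wrap N (p + d)} \<and>
        snd ((fst p mod N, snd p mod N), d) = d"
      unfolding \<rho>_def by simp
    show "((fst p mod N, snd p mod N), d) \<in> J" unfolding J_def using d N0 by simp
  qed
  have lift: "\<exists>s. s \<in> flag_family Q \<and> \<sigma> = wrap N ` s \<and> p \<in> s \<and> p + d \<in> s"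
    if Q: "short k Q" and \<sigma>: "\<sigma> \<in> torus_complex N Q" "{wrap N p, wrap N (p + d)} \<subseteq> \<sigma>" and d: "P d" for Q \<sigma> p d
    by (rule torus_lift_edge[OF N Q \<sigma>]) (use shortD(3,4)[OF P d] in auto)
  \<comment> \<open>Displacements are not changed by projection: two of them, each bounded by
    \<open>k\<close> and congruent modulo \<open>3 * k\<close>, are equal. A family edge on the
    torus therefore comes from a pair in \<open>s\<close> with the same displacement.\<close>
  have bad_diff: "\<exists>a\<in>s. \<exists>b\<in>s. b - a = snd j \<and> \<rho> j = {wrap N a, wrap N b}"
    if s: "\<forall>x\<in>s. \<forall>y\<in>s. P (y - x)" and j: "j \<in> J" "\<rho> j \<subseteq> wrap N ` s" for s j
  proof -
    obtain a b where ab: "a \<in> s" "b \<in> s" "wrap N (fst j) = wrap N a" "wrap N (fst j + snd j) = wrap N b"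
      using j(2) unfolding \<rho>_def by blast
    have "N dvd fst (fst j) - fst a" "N dvd fst (fst j + snd j) - fst b"
      "N dvd snd (fst j) - snd a" "N dvd snd (fst j + snd j) - snd b"
      using ab(3,4) unfolding wrap_eq[OF N0] by blast+
    then have "N dvd (fst (fst j + snd j) - fst b) - (fst (fst j) - fst a)"
      "N dvd (snd (fst j + snd j) - snd b) - (snd (fst j) - snd a)" by (blast intro: dvd_diff)+
    moreover have "(fst (fst j + snd j) - fst b) - (fst (fst j) - fst a) = fst (snd j) - (fst b - fst a)"
      "(snd (fst j + snd j) - snd b) - (snd (fst j) - snd a) = snd (snd j) - (snd b - snd a)" by simp_all
    ultimately have dv: "N dvd fst (snd j) - (fst b - fst a)" "N dvd snd (snd j) - (snd b - snd a)"
      by (simp_all only:)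
    have "\<bar>fst b - fst a\<bar> \<le> k" "\<bar>snd b - snd a\<bar> \<le> k"
      using shortD(3,4)[OF P s[rule_format, OF ab(1,2)]] by simp_all
    moreover have "\<bar>fst (snd j)\<bar> \<le> k" "\<bar>snd (snd j)\<bar> \<le> k"
      using shortD(3,4)[OF P PJ(1)[OF j(1)]] by simp_all
    ultimately have "\<bar>fst (snd j) - (fst b - fst a)\<bar> < N" "\<bar>snd (snd j) - (snd b - snd a)\<bar> < N"
      using N by linarith+
    with dv have "fst (snd j) = fst b - fst a" "snd (snd j) = snd b - snd a"
      by (blast intro: eq_of_dvd_diff)+
    then have "b - a = snd j" by (simp add: prod_eq_iff)
    then show ?thesis using ab unfolding \<rho>_def
      by (intro rev_bexI[OF ab(1)] rev_bexI[OF ab(2)]) simp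
  qed
  have "collapses (induced_cones (torus_complex N P) I A)
    (induced_cones {\<sigma>\<in>torus_complex N P. \<forall>j\<in>J. \<not> \<rho> j \<subseteq> \<sigma>} I A)"
  proof (rule collapses_induced_cones[where rk = "\<lambda>j. rk (snd j)" and w = w])
    show "finite J" by (rule finJ)
    show "I \<inter> \<Union>(torus_complex N P) = {}" using I unfolding torus_complex_def by blast
    fix j assume j: "j \<in> J"
    note d = PJ[OF j]
    let ?p = "fst j" and ?d = "snd j" and ?w = "fst j + \<omega> (snd j)"
    show "finite (\<rho> j) \<and> \<rho> j \<noteq> {} \<and> I \<inter> \<rho> j = {}" unfolding \<rho>_def using I by blast
    show "w j \<notin> I" unfolding w_def using I by blast
    \<comment> \<open>Applying \<open>H\<close> to the two endpoints themselves, at displacements 0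
      and \<open>d\<close>, shows that the apex is a neighbour of both.\<close>
    have w0: "P (0 - \<omega> ?d)" 
      by (rule H[OF d, THEN conjunct1]) (use d shortD(1,2)[OF P] bad0 rk_sym in simp_all)
    have w1: "P (?d - \<omega> ?d)"
      by (rule H[OF d, THEN conjunct1]) (use d shortD(1,2)[OF P] bad0 rk_sym in simp_all)
    have bw: "\<bar>fst (\<omega> ?d)\<bar> \<le> k" "\<bar>snd (\<omega> ?d)\<bar> \<le> k" "\<bar>fst ?d - fst (\<omega> ?d)\<bar> \<le> k" "\<bar>snd ?d - snd (\<omega> ?d)\<bar> \<le> k"
      using shortD(3,4)[OF P w0] shortD(3,4)[OF P w1] by simp_all
    have "wrap N ?w \<noteq> wrap N ?p"
    proof
      assume "wrap N ?w = wrap N ?p"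
      then have "N dvd fst (\<omega> ?d) - 0" "N dvd snd (\<omega> ?d) - 0" unfolding wrap_eq[OF N0] by simp_all
      then have "fst (\<omega> ?d) = 0" "snd (\<omega> ?d) = 0" using bw N by (auto intro: eq_of_dvd_diff)
      then show False using \<omega>[OF d] by (simp add: prod_eq_iff)
    qed
    moreover have "wrap N ?w \<noteq> wrap N (?p + ?d)"
    proof
      assume "wrap N ?w = wrap N (?p + ?d)"
      then have "N dvd fst (\<omega> ?d) - fst ?d" "N dvd snd (\<omega> ?d) - snd ?d" unfolding wrap_eq[OF N0] by simp_all
      moreover have "\<bar>fst (\<omega> ?d) - fst ?d\<bar> < N" "\<bar>snd (\<omega> ?d) - snd ?d\<bar> < N" using bw N by linarith+
      ultimately have "fst (\<omega> ?d) = fst ?d" "snd (\<omega> ?d) = snd ?d" by (blast intro: eq_of_dvd_diff)+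
      then show False using \<omega>[OF d] by (simp add: prod_eq_iff)
    qed
    ultimately show "w j \<notin> \<rho> j \<and> (\<forall>c\<in>I. \<rho> j \<subseteq> A c \<longrightarrow> w j \<in> A c)"
      unfolding w_def \<rho>_def using A[OF _ d] by simp
    fix \<sigma> assume \<sigma>: "\<sigma> \<in> torus_complex N P" "\<rho> j \<subseteq> \<sigma>"
      and low: "\<And>i. i \<in> J \<Longrightarrow> rk (snd i) < rk (snd j) \<Longrightarrow> \<not> \<rho> i \<subseteq> \<sigma>"
    obtain s where s: "s \<in> flag_family P" "\<sigma> = wrap N ` s" "?p \<in> s" "?p + ?d \<in> s"
      using lift[OF P \<sigma>(1) _ d(1), of ?p] \<sigma>(2) unfolding \<rho>_def by blast
    note Ps = flag_familyD[OF s(1)]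
    \<comment> \<open>Edges of smaller rank are already gone, so the displacement being folded has
      the least rank among the bad ones in \<open>s\<close>.\<close>
    have rk_le: "rk ?d \<le> rk (y - x)" if xy: "x \<in> s" "y \<in> s" "bad (y - x)" for x y
    proof (rule ccontr)
      assume lt: "\<not> ?thesis"
      obtain i where i: "i \<in> J" "\<rho> i = {wrap N x, wrap N (x + (y - x))}" "snd i = y - x"
        using J_ex[OF Ps(3)[OF xy(1,2)] xy(3)] by blast
      have "\<rho> i \<subseteq> \<sigma>" unfolding i(2) s(2) using xy(1,2) by simp
      then show False using low[OF i(1)] lt i(3) by simp
    qed
    have key: "P (x - ?w) \<and> (bad (x - ?w) \<longrightarrow> rk ?d < rk (x - ?w))" if x: "x \<in> s" for x
    proof -
      have e1: "x - ?p - ?d = x - (?p + ?d)" and e2: "x - ?p - \<omega> ?d = x - ?w" by (simp_all add: algebra_simps)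
      have "P (x - ?p - \<omega> ?d) \<and> (bad (x - ?p - \<omega> ?d) \<longrightarrow> rk ?d < rk (x - ?p - \<omega> ?d))"
      proof (rule H[OF d])
        show "P (x - ?p)" by (rule Ps(3)[OF s(3) x])
        show "P (x - ?p - ?d)" unfolding e1 by (rule Ps(3)[OF s(4) x])
        show "rk ?d \<le> rk (x - ?p)" if "bad (x - ?p)" by (rule rk_le[OF s(3) x that])
        show "rk ?d \<le> rk (x - ?p - ?d)" if "bad (x - ?p - ?d)"
          using rk_le[OF s(4) x] that unfolding e1 by simp
      qed
      then show ?thesis unfolding e2 .
    qed
    have Pins: "P (y - x)" if xy: "x \<in> insert ?w s" "y \<in> insert ?w s" for x y
    proof -
      consider "x = ?w" "y = ?w" | "x = ?w" "y \<in> s" | "x \<in> s" "y = ?w" | "x \<in> s" "y \<in> s" using xy by blast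
      then show ?thesis
      proof cases
        case 3
        then show ?thesis using shortD(2)[OF P, of "x - ?w"] key by simp
      qed (use shortD(1)[OF P] key Ps(3) in simp_all)
    qed
    have eq: "insert (w j) \<sigma> = wrap N ` insert ?w s" unfolding w_def s(2) by simp
    have "insert ?w s \<in> flag_family P" unfolding flag_family_def using Pins Ps(1) by simp
    then have "insert (w j) \<sigma> \<in> torus_complex N P" unfolding eq by (rule torus_complexI)
    moreover have "\<not> \<rho> i \<subseteq> insert (w j) \<sigma>" if i: "i \<in> J" "rk (snd i) \<le> rk (snd j)" "w j \<in> \<rho> i" for i
    proof
      assume "\<rho> i \<subseteq> insert (w j) \<sigma>"
      then obtain a b where ab: "a \<in> insert ?w s" "b \<in> insert ?w s" "b - a = snd i" "\<rho> i = {wrap N a, wrap N b}"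
        using bad_diff[of "insert ?w s" i] Pins i(1) unfolding eq by blast
      have ne: "a \<noteq> b" using PJ(2)[OF i(1)] bad0 ab(3) by auto
      have inj: "x = y" if "x \<in> insert ?w s" "y \<in> insert ?w s" "wrap N x = wrap N y" for x y
      proof -
        have "\<bar>fst y - fst x\<bar> < N" "\<bar>snd y - snd x\<bar> < N"
          using shortD(3,4)[OF P Pins[OF that(1,2)]] N by simp_all
        moreover have "N dvd fst y - fst x" "N dvd snd y - snd x"
          using that(3)[symmetric] unfolding wrap_eq[OF N0] by simp_all
        ultimately have "fst y = fst x" "snd y = snd x" by (blast intro: eq_of_dvd_diff)+
        then show ?thesis by (simp add: prod_eq_iff)
      qed
      \<comment> \<open>A family edge through the apex joins it to a point of \<open>s\<close>; by
        \<open>key\<close> its rank is strictly larger than the present one, so it has not been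
        folded yet.\<close>
      have "wrap N ?w = wrap N a \<or> wrap N ?w = wrap N b" using i(3) ab(4) unfolding w_def by simp
      then have "a = ?w \<or> b = ?w" using inj[OF _ ab(1), of ?w] inj[OF _ ab(2), of ?w] by auto
      then show False
      proof
        assume a: "a = ?w"
        then have "b \<in> s" using ab(2) ne by simp
        then show False using key[of b] PJ(2)[OF i(1)] ab(3) a i(2) by simp
      next
        assume b: "b = ?w"
        then have as: "a \<in> s" using ab(1) ne by simp
        have "a - ?w = - snd i" using ab(3) b by (metis minus_diff_eq)
        then show False using key[OF as] PJ(2)[OF i(1)] bad_sym[of "snd i"] rk_sym[of "snd i"] i(2) by simp
      qed
    qed
    ultimately show "insert (w j) \<sigma> \<in> torus_complex N P \<and>
        (\<forall>i\<in>J. rk (snd i) \<le> rk (snd j) \<longrightarrow> w j \<in> \<rho> i \<longrightarrow> \<not> \<rho> i \<subseteq> insert (w j) \<sigma>)" by blast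
  qed
  moreover have "{\<sigma>\<in>torus_complex N P. \<forall>j\<in>J. \<not> \<rho> j \<subseteq> \<sigma>} = torus_complex N (\<lambda>d. P d \<and> \<not> bad d)"
  proof (intro equalityI subsetI)
    fix \<sigma> assume "\<sigma> \<in> {\<sigma>\<in>torus_complex N P. \<forall>j\<in>J. \<not> \<rho> j \<subseteq> \<sigma>}"
    then have \<sigma>: "\<sigma> \<in> torus_complex N P" "\<And>j. j \<in> J \<Longrightarrow> \<not> \<rho> j \<subseteq> \<sigma>" by simp_all
    obtain s where s: "s \<in> flag_family P" "\<sigma> = wrap N ` s" using \<sigma>(1) unfolding torus_complex_def by blast
    note Ps = flag_familyD[OF s(1)]
    have "\<not> bad (y - x)" if xy: "x \<in> s" "y \<in> s" for x y
    proof
      assume "bad (y - x)"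
      then obtain i where i: "i \<in> J" "\<rho> i = {wrap N x, wrap N (x + (y - x))}"
        using J_ex[OF Ps(3)[OF xy]] by blast
      have "\<rho> i \<subseteq> \<sigma>" unfolding i(2) s(2) using xy by simp
      then show False using \<sigma>(2)[OF i(1)] by simp
    qed
    then have "s \<in> flag_family (\<lambda>d. P d \<and> \<not> bad d)" unfolding flag_family_def using Ps by simp
    then show "\<sigma> \<in> torus_complex N (\<lambda>d. P d \<and> \<not> bad d)" unfolding s(2) by (rule torus_complexI)
  next
    fix \<sigma> assume "\<sigma> \<in> torus_complex N (\<lambda>d. P d \<and> \<not> bad d)"
    then obtain s where s: "s \<in> flag_family (\<lambda>d. P d \<and> \<not> bad d)" "\<sigma> = wrap N ` s"
      unfolding torus_complex_def by blast
    note Ps = flag_familyD[OF s(1)]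
    have "s \<in> flag_family P" unfolding flag_family_def using Ps by simp
    then have "\<sigma> \<in> torus_complex N P" unfolding s(2) by (rule torus_complexI)
    moreover have "\<not> \<rho> j \<subseteq> \<sigma>" if j: "j \<in> J" for j
    proof
      assume "\<rho> j \<subseteq> \<sigma>"
      then obtain a b where "a \<in> s" "b \<in> s" "b - a = snd j"
        using bad_diff[of s j] Ps(3) j unfolding s(2) by blast
      then show False using Ps(3)[of a b] PJ(2)[OF j] by simp
    qed
    ultimately show "\<sigma> \<in> {\<sigma>\<in>torus_complex N P. \<forall>j\<in>J. \<not> \<rho> j \<subseteq> \<sigma>}" by simp
  qed
  ultimately show ?thesis by simp
qed

section \<open>Displacement shapes, and the rows and columns of the torus\<close>

definition L1_ball :: "nat \<Rightarrow> int \<times> int \<Rightarrow> bool" where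
  "L1_ball k d \<longleftrightarrow> \<bar>fst d\<bar> + \<bar>snd d\<bar> \<le> int k"

text \<open>Besides 0 these are the six edge directions of the grid triangulated by diagonals (1,
  1); only the antidiagonal steps are missing from the 3 by 3 box.\<close>

definition triangular :: "int \<times> int \<Rightarrow> bool" where
  "triangular d \<longleftrightarrow> \<bar>fst d\<bar> \<le> 1 \<and> \<bar>snd d\<bar> \<le> 1 \<and> \<bar>fst d - snd d\<bar> \<le> 1"

text \<open>The apex \<open>(3k + t, j)\<close> or \<open>(i, 3k + t)\<close> with \<open>t < k\<close>, a point outside the vertex set, belongs to the winding
  triangle based at \<open>t\<close> in row \<open>j\<close> or in column \<open>i\<close>.\<close>
definition apexes :: "nat \<Rightarrow> (nat \<times> nat) set" where
  "apexes k = {c. 3 * k \<le> fst c \<and> fst c < 4 * k \<and> snd c < 3 * k \<or> fst c < 3 * k \<and> 3 * k \<le> snd c \<and> snd c < 4 * k}"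

definition circle :: "nat \<Rightarrow> nat \<times> nat \<Rightarrow> int \<Rightarrow> nat \<times> nat" where
  "circle k c i = wrap (3 * int k) (if 3 * k \<le> fst c then (i, int (snd c)) else (int (fst c), i))"

definition base :: "nat \<Rightarrow> nat \<times> nat \<Rightarrow> int" where
  "base k c = int ((if 3 * k \<le> fst c then fst c else snd c) - 3 * k)"

definition winding :: "nat \<Rightarrow> nat \<times> nat \<Rightarrow> (nat \<times> nat) set" where
  "winding k c = circle k c ` {base k c, base k c + int k, base k c + 2 * int k}"

lemma circle_eq:
  assumes "k > 0"
  shows "circle k c x = circle k c y \<longleftrightarrow> 3 * int k dvd x - y"
  using assms by (simp add: circle_def wrap_eq)

lemma in_range_circle:
  assumes "k > 0"
  shows "wrap (3 * int k) p \<in> range (circle k c) \<longleftrightarrow>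
    (if 3 * k \<le> fst c then 3 * int k dvd snd p - int (snd c) else 3 * int k dvd fst p - int (fst c))"
proof -
  have N: "3 * int k > 0" using assms by simp
  show ?thesis
  proof (cases "3 * k \<le> fst c")
    case True
    have "wrap (3 * int k) p \<in> range (circle k c) \<longleftrightarrow> (\<exists>i. wrap (3 * int k) p = wrap (3 * int k) (i, int (snd c)))"
      unfolding circle_def using True by auto
    also have "\<dots> \<longleftrightarrow> 3 * int k dvd snd p - int (snd c)"
      unfolding wrap_eq[OF N] by (auto intro: exI[of _ "fst p"])
    finally show ?thesis using True by simp
  next
    case False
    have "wrap (3 * int k) p \<in> range (circle k c) \<longleftrightarrow> (\<exists>i. wrap (3 * int k) p = wrap (3 * int k) (int (fst c), i))"
      unfolding circle_def using False by auto
    also have "\<dots> \<longleftrightarrow> 3 * int k dvd fst p - int (fst c)"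
      unfolding wrap_eq[OF N] by (auto intro: exI[of _ "snd p"])
    finally show ?thesis using False by simp
  qed
qed

lemma wrap_less:
  assumes "k > 0"
  shows "fst (wrap (3 * int k) p) < 3 * k" "snd (wrap (3 * int k) p) < 3 * k"
  using assms by (simp_all add: wrap_def nat_less_iff)

lemma apexes_disjoint:
  assumes "k > 0"
  shows "apexes k \<inter> range (wrap (3 * int k)) = {}"
proof -
  have "wrap (3 * int k) p \<notin> apexes k" for p
    using wrap_less[OF assms, of p] unfolding apexes_def by auto
  then show ?thesis by blast
qed

lemma finite_apexes: "finite (apexes k)"
  by (rule finite_subset[of _ "{..<4 * k} \<times> {..<4 * k}"]) (auto simp: apexes_def)

text \<open>Two lifted vertices over the same row have second coordinates differing by a multiple of
  \<open>3 * k\<close> and by at most \<open>k\<close>, hence not at all. The full subcomplex on a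
  row thus sees only horizontal displacements.\<close>

lemma induced_circle_row:
  assumes k: "k > 0" and P: "short (int k) P" and r: "\<And>i. P (i, 0) \<longleftrightarrow> \<bar>i\<bar> \<le> r" and c: "3 * k \<le> fst c"
  shows "{\<sigma>\<in>torus_complex (3 * int k) P. \<sigma> \<subseteq> range (circle k c)} = line_complex (circle k c) r"
proof (intro equalityI subsetI)
  have N: "3 * int k > 0" using k by simp
  fix \<sigma> assume "\<sigma> \<in> {\<sigma>\<in>torus_complex (3 * int k) P. \<sigma> \<subseteq> range (circle k c)}"
  then obtain s where s: "s \<in> flag_family P" "\<sigma> = wrap (3 * int k) ` s" and sub: "\<sigma> \<subseteq> range (circle k c)"
    unfolding torus_complex_def by blast
  note Ps = flag_familyD[OF s(1)]
  have dv: "3 * int k dvd snd x - int (snd c)" if "x \<in> s" for x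
  proof -
    have "wrap (3 * int k) x \<in> range (circle k c)" using that sub s(2) by blast
    then show ?thesis unfolding in_range_circle[OF k] using c by simp
  qed
  have "wrap (3 * int k) x = circle k c (fst x)" if "x \<in> s" for x
    unfolding circle_def wrap_eq[OF N] using c dv[OF that] by simp
  then have "\<sigma> = circle k c ` (fst ` s)" unfolding s(2) image_image by (intro image_cong) simp_all
  moreover have "circle k c ` (fst ` s) \<in> line_complex (circle k c) r"
  proof (rule line_complexI)
    fix a b assume "a \<in> fst ` s" "b \<in> fst ` s"
    then obtain x y where xy: "x \<in> s" "y \<in> s" "a = fst x" "b = fst y" by blast
    have Pd: "P (y - x)" by (rule Ps(3)[OF xy(1,2)])
    then have "\<bar>snd y - snd x\<bar> \<le> int k" using shortD(3,4)[OF P, of "y - x"] by simp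
    then have lt: "\<bar>snd y - snd x\<bar> < 3 * int k" using k by linarith
    have "3 * int k dvd (snd y - int (snd c)) - (snd x - int (snd c))"
      by (rule dvd_diff[OF dv[OF xy(2)] dv[OF xy(1)]])
    then have "3 * int k dvd snd y - snd x" by simp
    then have "snd y = snd x" using lt by (rule eq_of_dvd_diff)
    then have "y - x = (b - a, 0)" using xy(3,4) by (simp add: prod_eq_iff)
    then show "\<bar>b - a\<bar> \<le> r" using Pd r by simp
  qed (use Ps in auto)
  ultimately show "\<sigma> \<in> line_complex (circle k c) r" by simp
next
  fix \<sigma> assume "\<sigma> \<in> line_complex (circle k c) r"
  from line_complexD[OF this] obtain s where
    s: "finite s" "s \<noteq> {}" "\<forall>x\<in>s. \<forall>y\<in>s. \<bar>y - x\<bar> \<le> r" "\<sigma> = circle k c ` s" by blast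
  let ?f = "\<lambda>i. (i, int (snd c))"
  have "P (?f j - ?f i)" if "i \<in> s" "j \<in> s" for i j
  proof -
    have "?f j - ?f i = (j - i, 0)" by simp
    then show ?thesis using r[of "j - i"] s(3) that by simp
  qed
  then have "?f ` s \<in> flag_family P" unfolding flag_family_def using s(1,2) by blast
  then have "wrap (3 * int k) ` ?f ` s \<in> torus_complex (3 * int k) P" by (rule torus_complexI)
  moreover have "wrap (3 * int k) ` ?f ` s = \<sigma>" unfolding s(4) circle_def image_image using c by simp
  moreover have "\<sigma> \<subseteq> range (circle k c)" unfolding s(4) by blast
  ultimately show "\<sigma> \<in> {\<sigma>\<in>torus_complex (3 * int k) P. \<sigma> \<subseteq> range (circle k c)}" by simp
qed

lemma induced_circle_column:
  assumes k: "k > 0" and P: "short (int k) P" and r: "\<And>i. P (0, i) \<longleftrightarrow> \<bar>i\<bar> \<le> r" and c: "\<not> 3 * k \<le> fst c"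
  shows "{\<sigma>\<in>torus_complex (3 * int k) P. \<sigma> \<subseteq> range (circle k c)} = line_complex (circle k c) r"
proof (intro equalityI subsetI)
  have N: "3 * int k > 0" using k by simp
  fix \<sigma> assume "\<sigma> \<in> {\<sigma>\<in>torus_complex (3 * int k) P. \<sigma> \<subseteq> range (circle k c)}"
  then obtain s where s: "s \<in> flag_family P" "\<sigma> = wrap (3 * int k) ` s" and sub: "\<sigma> \<subseteq> range (circle k c)"
    unfolding torus_complex_def by blast
  note Ps = flag_familyD[OF s(1)]
  have dv: "3 * int k dvd fst x - int (fst c)" if "x \<in> s" for x
  proof -
    have "wrap (3 * int k) x \<in> range (circle k c)" using that sub s(2) by blast
    then show ?thesis unfolding in_range_circle[OF k] using c by simp
  qed
  have "wrap (3 * int k) x = circle k c (snd x)" if "x \<in> s" for x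
    unfolding circle_def wrap_eq[OF N] using c dv[OF that] by simp
  then have "\<sigma> = circle k c ` (snd ` s)" unfolding s(2) image_image by (intro image_cong) simp_all
  moreover have "circle k c ` (snd ` s) \<in> line_complex (circle k c) r"
  proof (rule line_complexI)
    fix a b assume "a \<in> snd ` s" "b \<in> snd ` s"
    then obtain x y where xy: "x \<in> s" "y \<in> s" "a = snd x" "b = snd y" by blast
    have Pd: "P (y - x)" by (rule Ps(3)[OF xy(1,2)])
    then have "\<bar>fst y - fst x\<bar> \<le> int k" using shortD(3,4)[OF P, of "y - x"] by simp
    then have lt: "\<bar>fst y - fst x\<bar> < 3 * int k" using k by linarith
    have "3 * int k dvd (fst y - int (fst c)) - (fst x - int (fst c))"
      by (rule dvd_diff[OF dv[OF xy(2)] dv[OF xy(1)]])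
    then have "3 * int k dvd fst y - fst x" by simp
    then have "fst y = fst x" using lt by (rule eq_of_dvd_diff)
    then have "y - x = (0, b - a)" using xy(3,4) by (simp add: prod_eq_iff)
    then show "\<bar>b - a\<bar> \<le> r" using Pd r by simp
  qed (use Ps in auto)
  ultimately show "\<sigma> \<in> line_complex (circle k c) r" by simp
next
  fix \<sigma> assume "\<sigma> \<in> line_complex (circle k c) r"
  from line_complexD[OF this] obtain s where
    s: "finite s" "s \<noteq> {}" "\<forall>x\<in>s. \<forall>y\<in>s. \<bar>y - x\<bar> \<le> r" "\<sigma> = circle k c ` s" by blast
  let ?f = "\<lambda>i. (int (fst c), i)"
  have "P (?f j - ?f i)" if "i \<in> s" "j \<in> s" for i j
  proof -
    have "?f j - ?f i = (0, j - i)" by simp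
    then show ?thesis using r[of "j - i"] s(3) that by simp
  qed
  then have "?f ` s \<in> flag_family P" unfolding flag_family_def using s(1,2) by blast
  then have "wrap (3 * int k) ` ?f ` s \<in> torus_complex (3 * int k) P" by (rule torus_complexI)
  moreover have "wrap (3 * int k) ` ?f ` s = \<sigma>" unfolding s(4) circle_def image_image using c by simp
  moreover have "\<sigma> \<subseteq> range (circle k c)" unfolding s(4) by blast
  ultimately show "\<sigma> \<in> {\<sigma>\<in>torus_complex (3 * int k) P. \<sigma> \<subseteq> range (circle k c)}" by simp
qed

lemma induced_circle:
  assumes "k > 0" "short (int k) P" "\<And>i. P (i, 0) \<longleftrightarrow> \<bar>i\<bar> \<le> r" "\<And>i. P (0, i) \<longleftrightarrow> \<bar>i\<bar> \<le> r"
  shows "{\<sigma>\<in>torus_complex (3 * int k) P. \<sigma> \<subseteq> range (circle k c)} = line_complex (circle k c) r"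
  using assms induced_circle_row[of k P r c] induced_circle_column[of k P r c] by blast

section \<open>Shortening planar edges down to the triangulated torus\<close>

lemma short_L1_ball: "short (int k) (L1_ball k)"
  unfolding short_def L1_ball_def by auto

text \<open>The compatibility of a fold with the cones reduces to one requirement:
  \<open>\<omega>\<close> maps horizontal displacements to horizontal ones and vertical to vertical.
  An edge with both ends in a row is horizontal, so its apex lies in the same row.\<close>

lemma torus_fold_step:
  fixes bad :: "int \<times> int \<Rightarrow> bool" and rk :: "int \<times> int \<Rightarrow> int"
  assumes k: "k > 0" and P: "short (int k) P"
    and bad: "\<not> bad 0" "\<And>d. bad (- d) = bad d" "\<And>d. rk (- d) = rk d"
    and \<omega>: "\<And>d. P d \<Longrightarrow> bad d \<Longrightarrow> \<omega> d \<noteq> 0 \<and> \<omega> d \<noteq> d \<and> (fst d = 0 \<longrightarrow> fst (\<omega> d) = 0) \<and> (snd d = 0 \<longrightarrow> snd (\<omega> d) = 0)"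
    and H: "\<And>d x. P d \<Longrightarrow> bad d \<Longrightarrow> P x \<Longrightarrow> P (x - d) \<Longrightarrow> (bad x \<Longrightarrow> rk d \<le> rk x) \<Longrightarrow>
        (bad (x - d) \<Longrightarrow> rk d \<le> rk (x - d)) \<Longrightarrow>
        P (x - \<omega> d) \<and> (bad (x - \<omega> d) \<longrightarrow> rk d < rk (x - \<omega> d))"
  shows "collapses (induced_cones (torus_complex (3 * int k) P) (apexes k) (\<lambda>c. range (circle k c)))
    (induced_cones (torus_complex (3 * int k) (\<lambda>d. P d \<and> \<not> bad d)) (apexes k) (\<lambda>c. range (circle k c)))"
proof (rule torus_fold[where \<omega> = \<omega> and rk = rk])
  show "short (int k) P" by (rule P)
  fix d assume d: "P d" "bad d"
  show "\<omega> d \<noteq> 0 \<and> \<omega> d \<noteq> d" using \<omega>[OF d] by blast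
  have small: "\<bar>fst d\<bar> < 3 * int k" "\<bar>snd d\<bar> < 3 * int k" using shortD(3,4)[OF P d(1)] k by linarith+
  have zero: "x = 0" if "3 * int k dvd (p + x) - q" "3 * int k dvd p - q" "\<bar>x\<bar> < 3 * int k" for p q x :: int
  proof -
    have "3 * int k dvd ((p + x) - q) - (p - q)" by (rule dvd_diff[OF that(1,2)])
    then show ?thesis using that(3) eq_of_dvd_diff[of "3 * int k" x 0] by simp
  qed
  fix c p assume p: "wrap (3 * int k) p \<in> range (circle k c)" "wrap (3 * int k) (p + d) \<in> range (circle k c)"
  show "wrap (3 * int k) (p + \<omega> d) \<in> range (circle k c)"
  proof (cases "3 * k \<le> fst c")
    case True
    then have "snd d = 0"
      using p zero[of "snd p" "snd d"] small unfolding in_range_circle[OF k] by simp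
    then show ?thesis using p(1) \<omega>[OF d] True unfolding in_range_circle[OF k] by simp
  next
    case False
    then have "fst d = 0"
      using p zero[of "fst p" "fst d"] small unfolding in_range_circle[OF k] by simp
    then show ?thesis using p(1) \<omega>[OF d] False unfolding in_range_circle[OF k] by simp
  qed
qed (use k bad H apexes_disjoint in simp_all)

text \<open>For nonzero coordinate sum, a unit step in each coordinate whose sign agrees with that
  of the sum. Diagonal steps cannot be avoided: for d = (a, a) with 2a = k, the points (0, k) and
  (k, 0) are neighbours of both ends, yet at distance k + 1 from (1, 0) and from (0, 1)
  respectively.\<close>

definition sum_apex :: "int \<times> int \<Rightarrow> int \<times> int" where
  "sum_apex d = (if fst d + snd d > 0
     then (if fst d \<le> 0 then (0, 1) else if snd d \<le> 0 then (1, 0) else (1, 1))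
     else (if fst d \<ge> 0 then (0, -1) else if snd d \<ge> 0 then (-1, 0) else (-1, -1)))"

definition difference_apex :: "int \<times> int \<Rightarrow> int \<times> int" where
  "difference_apex d = (fst (sum_apex (fst d, - snd d)), - snd (sum_apex (fst d, - snd d)))"

text \<open>Suppose a + b > 0. As the longest edges go first, the two rank hypotheses confine (x, y)
  to the strip 0 \<le> x + y \<le> a + b. The step (u, v) has sum 1 or 2, so the new sum lies
  between -2 and a + b - 1. This is why edges count as long only from 3 on.\<close>

lemma sum_apex_arith:
  fixes a b x y k :: int
  assumes "\<bar>a\<bar> + \<bar>b\<bar> \<le> k" "3 \<le> \<bar>a + b\<bar>" "\<bar>x\<bar> + \<bar>y\<bar> \<le> k" "\<bar>x - a\<bar> + \<bar>y - b\<bar> \<le> k"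
    "3 \<le> \<bar>x + y\<bar> \<longrightarrow> \<bar>x + y\<bar> \<le> \<bar>a + b\<bar>" "3 \<le> \<bar>x - a + (y - b)\<bar> \<longrightarrow> \<bar>x - a + (y - b)\<bar> \<le> \<bar>a + b\<bar>"
    "(u, v) = sum_apex (a, b)"
  shows "\<bar>x - u\<bar> + \<bar>y - v\<bar> \<le> k \<and> (3 \<le> \<bar>x - u + (y - v)\<bar> \<longrightarrow> \<bar>x - u + (y - v)\<bar> < \<bar>a + b\<bar>)"
  using assms unfolding sum_apex_def fst_conv snd_conv by (smt (z3) prod.inject)

text \<open>The previous argument reflected in the second coordinate, with the bound on sums to be
  preserved. The hypotheses force a and b to be nonzero of opposite signs, so the step is (1, -1) or
  (-1, 1) and x + y does not change at all.\<close>

lemma difference_apex_arith: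
  fixes a b x y k :: int
  assumes "\<bar>a\<bar> + \<bar>b\<bar> \<le> k" "\<bar>a + b\<bar> \<le> 2" "3 \<le> \<bar>a - b\<bar>" "\<bar>x\<bar> + \<bar>y\<bar> \<le> k" "\<bar>x + y\<bar> \<le> 2"
    "\<bar>x - a\<bar> + \<bar>y - b\<bar> \<le> k" "\<bar>x - a + (y - b)\<bar> \<le> 2"
    "3 \<le> \<bar>x - y\<bar> \<longrightarrow> \<bar>x - y\<bar> \<le> \<bar>a - b\<bar>" "3 \<le> \<bar>x - a - (y - b)\<bar> \<longrightarrow> \<bar>x - a - (y - b)\<bar> \<le> \<bar>a - b\<bar>"
    "(u, v) = difference_apex (a, b)"
  shows "\<bar>x - u\<bar> + \<bar>y - v\<bar> \<le> k \<and> \<bar>x - u + (y - v)\<bar> \<le> 2 \<and>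
    (3 \<le> \<bar>x - u - (y - v)\<bar> \<longrightarrow> \<bar>x - u - (y - v)\<bar> < \<bar>a - b\<bar>)"
  using assms unfolding difference_apex_def sum_apex_def fst_conv snd_conv by (smt (z3) prod.inject fst_conv snd_conv)

text \<open>The bounds describe the L1 ball of radius 2. The only common neighbours of the ends of a
  straight double step are the ends, their midpoint and the two points beside the midpoint; all are
  within distance 1 of the midpoint.\<close>

lemma double_step_arith:
  fixes a b x y :: int
  assumes "\<bar>x + y\<bar> \<le> 2" "\<bar>x - y\<bar> \<le> 2" "\<bar>x - a + (y - b)\<bar> \<le> 2" "\<bar>x - a - (y - b)\<bar> \<le> 2"
    "a = 2 * u \<and> b = 2 * v" "\<bar>u\<bar> + \<bar>v\<bar> = 1"
  shows "\<bar>x - u + (y - v)\<bar> \<le> 2 \<and> \<bar>x - u - (y - v)\<bar> \<le> 2 \<and>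
    \<not> (\<bar>x - u\<bar> + \<bar>y - v\<bar> = 2 \<and> (x - u = 0 \<or> y - v = 0))"
  using assms by (smt (z3))

text \<open>The common neighbours of the ends of an antidiagonal are the four corners of one unit
  square, and the apex is a corner on the other diagonal.\<close>

lemma antidiagonal_step_arith:
  fixes a b x y :: int
  assumes "\<bar>x\<bar> \<le> 1" "\<bar>y\<bar> \<le> 1" "\<bar>x - a\<bar> \<le> 1" "\<bar>y - b\<bar> \<le> 1" "a + b = 0" "\<bar>a\<bar> = 1"
  shows "\<bar>x - a\<bar> \<le> 1 \<and> \<bar>y\<bar> \<le> 1 \<and> \<not> (x - a + y = 0 \<and> \<bar>x - a\<bar> = 1)"
  using assms by (smt (z3))

definition "wide_sum d \<longleftrightarrow> 3 \<le> \<bar>fst d + snd d\<bar>" for d :: "int \<times> int"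
definition "wide_difference d \<longleftrightarrow> 3 \<le> \<bar>fst d - snd d\<bar>" for d :: "int \<times> int"
definition "double_step d \<longleftrightarrow> \<bar>fst d\<bar> + \<bar>snd d\<bar> = 2 \<and> (fst d = 0 \<or> snd d = 0)" for d :: "int \<times> int"
definition "antidiagonal_step d \<longleftrightarrow> fst d + snd d = 0 \<and> \<bar>fst d\<bar> = 1" for d :: "int \<times> int"

abbreviation torus_with_cones :: "nat \<Rightarrow> (int \<times> int \<Rightarrow> bool) \<Rightarrow> (nat \<times> nat) set set" where
  "torus_with_cones k P \<equiv> induced_cones (torus_complex (3 * int k) P) (apexes k) (\<lambda>c. range (circle k c))"

lemma short_conj:
  assumes "short k P" "\<not> bad 0" "\<And>d. bad (- d) = bad d"
  shows "short k (\<lambda>d. P d \<and> \<not> bad d)"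
  unfolding short_def using assms(2,3) by (intro conjI allI impI; simp add: shortD[OF assms(1)])

text \<open>Since the larger of |a + b| and |a - b| is |a| + |b|, bounding both by 2 leaves the L1
  ball of radius 2; here \<open>k \<ge> 2\<close> makes the original bound redundant. Removing
  double steps leaves the 3 by 3 box, and removing antidiagonals leaves the triangulation. Ranks are
  negated lengths because small ranks are folded first.\<close>

lemma collapses_L1_ball_triangular:
  assumes k: "k \<ge> 2"
  shows "collapses (torus_with_cones k (L1_ball k)) (torus_with_cones k triangular)"
proof -
  have k0: "k > 0" using k by simp
  define P1 where "P1 = (\<lambda>d. L1_ball k d \<and> \<not> wide_sum d)"
  define P2 where "P2 = (\<lambda>d. P1 d \<and> \<not> wide_difference d)"
  define P3 where "P3 = (\<lambda>d. P2 d \<and> \<not> double_step d)"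
  have s1: "short (int k) P1" unfolding P1_def
    by (rule short_conj[OF short_L1_ball]) (auto simp: wide_sum_def)
  have s2: "short (int k) P2" unfolding P2_def
    by (rule short_conj[OF s1]) (auto simp: wide_difference_def)
  have s3: "short (int k) P3" unfolding P3_def
    by (rule short_conj[OF s2]) (auto simp: double_step_def)
  have c1: "collapses (torus_with_cones k (L1_ball k)) (torus_with_cones k P1)"
    unfolding P1_def
  proof (rule torus_fold_step[OF k0 short_L1_ball, where \<omega> = sum_apex and rk = "\<lambda>d. - \<bar>fst d + snd d\<bar>"])
    fix d assume "L1_ball k d" "wide_sum d"
    then show "sum_apex d \<noteq> 0 \<and> sum_apex d \<noteq> d \<and> (fst d = 0 \<longrightarrow> fst (sum_apex d) = 0) \<and> (snd d = 0 \<longrightarrow> snd (sum_apex d) = 0)"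
      unfolding wide_sum_def sum_apex_def by (auto simp: prod_eq_iff)
    fix x assume "L1_ball k x" "L1_ball k (x - d)" 
      "wide_sum x \<Longrightarrow> - \<bar>fst d + snd d\<bar> \<le> - \<bar>fst x + snd x\<bar>"
      "wide_sum (x - d) \<Longrightarrow> - \<bar>fst d + snd d\<bar> \<le> - \<bar>fst (x - d) + snd (x - d)\<bar>"
    then show "L1_ball k (x - sum_apex d) \<and> (wide_sum (x - sum_apex d) \<longrightarrow>
        - \<bar>fst d + snd d\<bar> < - \<bar>fst (x - sum_apex d) + snd (x - sum_apex d)\<bar>)"
      using sum_apex_arith[of "fst d" "snd d" "int k" "fst x" "snd x" "fst (sum_apex d)" "snd (sum_apex d)"]
        \<open>L1_ball k d\<close> \<open>wide_sum d\<close>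
      unfolding wide_sum_def L1_ball_def by simp
  qed (auto simp: wide_sum_def)
  have c2: "collapses (torus_with_cones k P1) (torus_with_cones k P2)"
    unfolding P2_def
  proof (rule torus_fold_step[OF k0 s1, where \<omega> = difference_apex and rk = "\<lambda>d. - \<bar>fst d - snd d\<bar>"])
    fix d assume "P1 d" "wide_difference d"
    then show "difference_apex d \<noteq> 0 \<and> difference_apex d \<noteq> d \<and> (fst d = 0 \<longrightarrow> fst (difference_apex d) = 0) \<and> (snd d = 0 \<longrightarrow> snd (difference_apex d) = 0)"
      unfolding wide_difference_def difference_apex_def sum_apex_def by (auto simp: prod_eq_iff)
    fix x assume "P1 x" "P1 (x - d)" 
      "wide_difference x \<Longrightarrow> - \<bar>fst d - snd d\<bar> \<le> - \<bar>fst x - snd x\<bar>"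
      "wide_difference (x - d) \<Longrightarrow> - \<bar>fst d - snd d\<bar> \<le> - \<bar>fst (x - d) - snd (x - d)\<bar>"
    then show "P1 (x - difference_apex d) \<and> (wide_difference (x - difference_apex d) \<longrightarrow>
        - \<bar>fst d - snd d\<bar> < - \<bar>fst (x - difference_apex d) - snd (x - difference_apex d)\<bar>)"
      using difference_apex_arith[of "fst d" "snd d" "int k" "fst x" "snd x" "fst (difference_apex d)" "snd (difference_apex d)"]
        \<open>P1 d\<close> \<open>wide_difference d\<close>
      unfolding wide_difference_def P1_def wide_sum_def L1_ball_def by simp
  qed (auto simp: wide_difference_def)
  have P2: "P2 d \<longleftrightarrow> \<bar>fst d + snd d\<bar> \<le> 2 \<and> \<bar>fst d - snd d\<bar> \<le> 2" for d
  proof -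
    have "\<bar>fst d\<bar> + \<bar>snd d\<bar> \<le> int k" if "\<bar>fst d + snd d\<bar> \<le> 2" "\<bar>fst d - snd d\<bar> \<le> 2" using that k by linarith
    then show ?thesis unfolding P2_def P1_def L1_ball_def wide_sum_def wide_difference_def by auto
  qed
  have c3: "collapses (torus_with_cones k P2) (torus_with_cones k P3)"
    unfolding P3_def
  \<comment> \<open>A constant rank is enough: edges from the apex are never double steps again, so
    the order of these folds is immaterial.\<close>
  proof (rule torus_fold_step[OF k0 s2, where \<omega> = "\<lambda>d. (sgn (fst d), sgn (snd d))" and rk = "\<lambda>d. 0"])
    fix d assume d: "P2 d" "double_step d"
    then have d': "fst d = 2 * sgn (fst d)" "snd d = 2 * sgn (snd d)" "\<bar>sgn (fst d)\<bar> + \<bar>sgn (snd d)\<bar> = 1"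
      unfolding double_step_def by (auto simp: sgn_if)
    then show "(sgn (fst d), sgn (snd d)) \<noteq> 0 \<and> (sgn (fst d), sgn (snd d)) \<noteq> d \<and>
        (fst d = 0 \<longrightarrow> fst (sgn (fst d), sgn (snd d)) = 0) \<and> (snd d = 0 \<longrightarrow> snd (sgn (fst d), sgn (snd d)) = 0)"
      by (auto simp: prod_eq_iff)
    fix x assume x: "P2 x" "P2 (x - d)"
    show "P2 (x - (sgn (fst d), sgn (snd d))) \<and> (double_step (x - (sgn (fst d), sgn (snd d))) \<longrightarrow> 0 < (0::int))"
      using x double_step_arith[of "fst x" "snd x" "fst d" "snd d" "sgn (fst d)" "sgn (snd d)", OF _ _ _ _ conjI[OF d'(1,2)] d'(3)]
      unfolding P2 double_step_def fst_diff snd_diff fst_conv snd_conv by blast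
  qed (auto simp: double_step_def)
  have P3: "P3 d \<longleftrightarrow> \<bar>fst d\<bar> \<le> 1 \<and> \<bar>snd d\<bar> \<le> 1" for d
  proof -
    have "\<bar>a + b\<bar> \<le> 2 \<and> \<bar>a - b\<bar> \<le> 2 \<and> \<not> (\<bar>a\<bar> + \<bar>b\<bar> = 2 \<and> (a = 0 \<or> b = 0)) \<longleftrightarrow> \<bar>a\<bar> \<le> 1 \<and> \<bar>b\<bar> \<le> 1"
      for a b :: int by (smt (z3))
    then show ?thesis unfolding P3_def P2 double_step_def by blast
  qed
  have c4: "collapses (torus_with_cones k P3) (torus_with_cones k (\<lambda>d. P3 d \<and> \<not> antidiagonal_step d))"
  proof (rule torus_fold_step[OF k0 s3, where \<omega> = "\<lambda>d. (fst d, 0)" and rk = "\<lambda>d. 0"])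
    fix d assume d: "P3 d" "antidiagonal_step d"
    then have d': "fst d + snd d = 0" "\<bar>fst d\<bar> = 1" unfolding antidiagonal_step_def by simp_all
    then show "(fst d, 0) \<noteq> 0 \<and> (fst d, 0) \<noteq> d \<and> (fst d = 0 \<longrightarrow> fst (fst d, 0::int) = 0) \<and>
        (snd d = 0 \<longrightarrow> snd (fst d, 0::int) = 0)"
      by (auto simp: prod_eq_iff)
    fix x assume x: "P3 x" "P3 (x - d)"
    show "P3 (x - (fst d, 0)) \<and> (antidiagonal_step (x - (fst d, 0)) \<longrightarrow> 0 < (0::int))"
      using x antidiagonal_step_arith[of "fst x" "snd x" "fst d" "snd d", OF _ _ _ _ d']
      unfolding P3 antidiagonal_step_def fst_diff snd_diff fst_conv snd_conv diff_0_right by blast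
  qed (auto simp: antidiagonal_step_def)
  have "\<bar>a\<bar> \<le> 1 \<and> \<bar>b\<bar> \<le> 1 \<and> \<not> (a + b = 0 \<and> \<bar>a\<bar> = 1) \<longleftrightarrow> \<bar>a\<bar> \<le> 1 \<and> \<bar>b\<bar> \<le> 1 \<and> \<bar>a - b\<bar> \<le> 1"
    for a b :: int by (smt (z3))
  then have "(\<lambda>d. P3 d \<and> \<not> antidiagonal_step d) = triangular"
    unfolding fun_eq_iff P3 antidiagonal_step_def triangular_def by blast
  then have c4': "collapses (torus_with_cones k P3) (torus_with_cones k triangular)" using c4 by simp
  show ?thesis by (rule rtranclp_trans[OF c1 rtranclp_trans[OF c2 rtranclp_trans[OF c3 c4']]])
qed

section \<open>Winding triangles\<close>

text \<open>With the lemma that follows: the cyclic distance is the least absolute value in the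
  residue class of v - u modulo n.\<close>

lemma cyc_dist_attained:
  assumes "u < n" "v < n"
  shows "\<exists>d::int. \<bar>d\<bar> = int (cyc_dist n u v) \<and> int n dvd int v - int u - d"
proof -
  define D where "D = int v - int u"
  have D: "\<bar>D\<bar> < int n" using assms unfolding D_def by linarith
  have c: "int (cyc_dist n u v) = min \<bar>D\<bar> (int n - \<bar>D\<bar>)"
    using assms unfolding cyc_dist_def D_def by (auto simp: min_def of_nat_diff)
  show ?thesis
  proof (cases "\<bar>D\<bar> \<le> int n - \<bar>D\<bar>")
    case True
    then show ?thesis unfolding c D_def[symmetric] by (intro exI[of _ D]) simp
  next
    case False
    show ?thesis
    proof (cases "D \<ge> 0")
      case True
      then show ?thesis using False D unfolding c D_def[symmetric] by (intro exI[of _ "D - int n"]) simp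
    next
      case neg: False
      then show ?thesis using False D unfolding c D_def[symmetric] by (intro exI[of _ "D + int n"]) simp
    qed
  qed
qed

lemma cyc_dist_le:
  assumes "u < n" "v < n" "int n dvd int v - int u - d"
  shows "int (cyc_dist n u v) \<le> \<bar>d\<bar>"
proof -
  define D where "D = int v - int u"
  have D: "\<bar>D\<bar> < int n" using assms unfolding D_def by linarith
  have c: "int (cyc_dist n u v) = min \<bar>D\<bar> (int n - \<bar>D\<bar>)"
    using assms unfolding cyc_dist_def D_def by (auto simp: min_def of_nat_diff)
  show ?thesis
  proof (cases "d = D")
    case False
    then have "\<bar>int n\<bar> \<le> \<bar>D - d\<bar>" using assms(3) unfolding D_def by (intro dvd_imp_le_int) auto
    then show ?thesis unfolding c by linarith
  qed (simp add: c)
qed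

section \<open>Torus distances as planar displacements\<close>

lemma torus_dist_wrap_le:
  assumes "k > 0"
  shows "int (torus_dist (3 * k) (wrap (3 * int k) x) (wrap (3 * int k) y)) \<le> \<bar>fst y - fst x\<bar> + \<bar>snd y - snd x\<bar>"
proof -
  have m: "int (nat (a mod (3 * int k))) = a mod (3 * int k)" for a using assms by simp
  have nn: "0 \<le> a mod (3 * int k)" for a using assms by simp
  have dv: "int (3 * k) dvd b mod (3 * int k) - a mod (3 * int k) - (b - a)" for a b :: int
    by (simp add: mod_eq_dvd_iff[symmetric] mod_diff_eq)
  have "int (cyc_dist (3 * k) (fst (wrap (3 * int k) x)) (fst (wrap (3 * int k) y))) \<le> \<bar>fst y - fst x\<bar>"
    using dv wrap_less[OF assms] by (intro cyc_dist_le) (simp_all add: wrap_def m nn)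
  moreover have "int (cyc_dist (3 * k) (snd (wrap (3 * int k) x)) (snd (wrap (3 * int k) y))) \<le> \<bar>snd y - snd x\<bar>"
    using dv wrap_less[OF assms] by (intro cyc_dist_le) (simp_all add: wrap_def m nn)
  ultimately show ?thesis unfolding torus_dist_def by simp
qed

text \<open>The lift of a vertex to the fundamental square, used as the origin from which
  displacements to the other vertices are measured.\<close>

definition centre :: "nat \<times> nat \<Rightarrow> int \<times> int" where
  "centre p = (int (fst p), int (snd p))"

lemma wrap_centre: "p \<in> torus_vertices (3 * k) \<Longrightarrow> wrap (3 * int k) (centre p) = p"
  by (auto simp: torus_vertices_def wrap_def centre_def)

lemma torus_displacement:
  assumes k: "k > 0" and xy: "x \<in> torus_vertices (3 * k)" "y \<in> torus_vertices (3 * k)" "torus_dist (3 * k) x y \<le> k"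
  shows "\<exists>d. L1_ball k d \<and> wrap (3 * int k) (centre x + d) = y"
proof -
  have N: "3 * int k > 0" using k by simp
  have lt: "fst x < 3 * k" "snd x < 3 * k" "fst y < 3 * k" "snd y < 3 * k"
    using xy(1,2) by (auto simp: torus_vertices_def)
  obtain a where a: "\<bar>a\<bar> = int (cyc_dist (3 * k) (fst x) (fst y))" "int (3 * k) dvd int (fst y) - int (fst x) - a"
    using cyc_dist_attained[OF lt(1,3)] by blast
  obtain b where b: "\<bar>b\<bar> = int (cyc_dist (3 * k) (snd x) (snd y))" "int (3 * k) dvd int (snd y) - int (snd x) - b"
    using cyc_dist_attained[OF lt(2,4)] by blast
  have "L1_ball k (a, b)" using xy(3) a(1) b(1) unfolding L1_ball_def torus_dist_def by simp
  moreover have "wrap (3 * int k) (centre y) = wrap (3 * int k) (centre x + (a, b))"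
    unfolding wrap_eq[OF N] centre_def using a(2) b(2) by (simp add: diff_diff_eq)
  then have "wrap (3 * int k) (centre x + (a, b)) = y" using wrap_centre[OF xy(2)] by simp
  ultimately show ?thesis by blast
qed

text \<open>Two vertices at displacements (A, A') and (B, B') from a third are joined by (E, E'),
  and the loop closes modulo 3K. Its total L1 length is at most 3K. If it fails to close in the
  plane, some coordinate sum is 3K or -3K, which uses up the whole length: all three legs have
  length K along one axis.\<close>

lemma inconsistent_lift_arith:
  fixes A A' B B' E E' K :: int
  assumes "K > 0" "\<bar>A\<bar> + \<bar>A'\<bar> \<le> K" "\<bar>B\<bar> + \<bar>B'\<bar> \<le> K" "\<bar>E\<bar> + \<bar>E'\<bar> \<le> K"
    "A + E - B = 0 \<or> A + E - B = 3 * K \<or> A + E - B = - 3 * K"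
    "A' + E' - B' = 0 \<or> A' + E' - B' = 3 * K \<or> A' + E' - B' = - 3 * K"
    "\<not> \<bar>B - A\<bar> + \<bar>B' - A'\<bar> \<le> K"
  shows "\<bar>A\<bar> = K \<and> B = - A \<and> A' = 0 \<and> B' = 0 \<or> \<bar>A'\<bar> = K \<and> B' = - A' \<and> A = 0 \<and> B = 0"
  using assms by (smt (z3))

text \<open>(Z, Z') is a further vertex near the base vertex and both ends A and -A of a winding
  triangle. If both loops close in the plane, being within K of two points at distance 2K forces (Z,
  Z') = 0; a loop that does not close identifies it with one of the ends.\<close>

lemma winding_neighbour_arith:
  fixes A Z Z' E E' F F' K :: int
  assumes "K > 0" "\<bar>A\<bar> = K" "\<bar>Z\<bar> + \<bar>Z'\<bar> \<le> K" "\<bar>E\<bar> + \<bar>E'\<bar> \<le> K" "\<bar>F\<bar> + \<bar>F'\<bar> \<le> K"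
    "A + E - Z = 0 \<or> A + E - Z = 3 * K \<or> A + E - Z = - 3 * K"
    "E' - Z' = 0 \<or> E' - Z' = 3 * K \<or> E' - Z' = - 3 * K"
    "- A + F - Z = 0 \<or> - A + F - Z = 3 * K \<or> - A + F - Z = - 3 * K"
    "F' - Z' = 0 \<or> F' - Z' = 3 * K \<or> F' - Z' = - 3 * K"
  shows "Z' = 0 \<and> (Z = 0 \<or> Z = K \<or> Z = - K)"
  using assms by (smt (z3))

lemma dvd_three_cases:
  fixes x K :: int
  assumes "3 * K dvd x" "\<bar>x\<bar> \<le> 3 * K"
  shows "x = 0 \<or> x = 3 * K \<or> x = - 3 * K"
proof -
  have "x = 3 * K" if "x > 0"
  proof -
    have "3 * K \<le> x" by (rule zdvd_imp_le[OF assms(1) that])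
    then show ?thesis using assms(2) by linarith
  qed
  moreover have "x = - 3 * K" if "x < 0"
  proof -
    have "3 * K \<le> - x" using assms(1) that by (intro zdvd_imp_le) auto
    then show ?thesis using assms(2) by linarith
  qed
  ultimately show ?thesis by linarith
qed

lemma image_three_classes:
  fixes f :: "int \<Rightarrow> 'a" and K :: int
  assumes per: "\<And>x. f (x + 3 * K) = f x" and m: "m \<in> {0, 1, 2}"
  shows "f ` {t + m * K, t + m * K + K, t + m * K - K} = f ` {t, t + K, t + 2 * K}"
proof -
  have e: "f (t - K) = f (t + 2 * K)" using per[of "t - K"] by (simp add: algebra_simps)
  have e3: "f (t + 3 * K) = f t" by (rule per)
  have sums: "t + K + K = t + 2 * K" "t + 2 * K + K = t + 3 * K" "t + 2 * K - K = t + K" by simp_all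
  consider "m = 0" | "m = 1" | "m = 2" using m by blast
  then show ?thesis
  proof cases
    case 1
    then have "f ` {t + m * K, t + m * K + K, t + m * K - K} = {f t, f (t + K), f (t - K)}" by simp
    then show ?thesis by (simp add: e)
  next
    case 2
    then have "f ` {t + m * K, t + m * K + K, t + m * K - K} = {f (t + K), f (t + K + K), f t}" by simp
    then show ?thesis unfolding sums by (simp add: insert_commute)
  next
    case 3
    then have "f ` {t + m * K, t + m * K + K, t + m * K - K} = {f (t + 2 * K), f (t + 2 * K + K), f (t + 2 * K - K)}"
      by simp
    then show ?thesis unfolding sums e3 by (simp add: insert_commute)
  qed
qed

lemma circle_period: "k > 0 \<Longrightarrow> circle k c (x + 3 * int k) = circle k c x"
  by (simp add: circle_eq)

text \<open>The winding triangle may be read from any of its vertices. The remainder of the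
  coordinate modulo \<open>k\<close> gives the base and the quotient tells which of the three
  vertices \<open>p\<close> is.\<close>

lemma winding_through_row:
  assumes k: "k > 0" and p: "p \<in> torus_vertices (3 * k)"
  shows "\<exists>c\<in>apexes k. winding k c =
    (\<lambda>j. wrap (3 * int k) (centre p + (j, 0))) ` {0, int k, - int k}"
proof -
  let ?c = "(3 * k + fst p mod k, snd p)"
  define m where "m = int (fst p div k)"
  have lt: "fst p < 3 * k" "snd p < 3 * k" using p by (auto simp: torus_vertices_def)
  then have "fst p div k < 3" using k by (simp add: div_less_iff_less_mult)
  then have m: "m \<in> {0, 1, 2}" unfolding m_def by auto
  have c: "?c \<in> apexes k" "3 * k \<le> fst ?c" using lt k unfolding apexes_def by simp_all
  have b: "base k ?c = int (fst p mod k)" using c(2) unfolding base_def by simp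
  have "int (fst p mod k + fst p div k * k) = int (fst p)" by (simp only: mod_div_mult_eq)
  then have pm: "int (fst p) = base k ?c + m * int k"
    unfolding b m_def by (simp only: of_nat_add of_nat_mult)
  have "winding k ?c = circle k ?c ` {base k ?c + m * int k, base k ?c + m * int k + int k, base k ?c + m * int k - int k}"
    unfolding winding_def using image_three_classes[of "circle k ?c" "int k" m "base k ?c", OF circle_period[OF k] m] by (rule sym)
  also have "\<dots> = (\<lambda>j. circle k ?c (int (fst p) + j)) ` {0, int k, - int k}"
    unfolding pm[symmetric] by simp
  also have "(\<lambda>j. circle k ?c (int (fst p) + j)) = (\<lambda>j. wrap (3 * int k) (centre p + (j, 0)))"
    using c(2) unfolding circle_def centre_def by simp
  finally show ?thesis using c(1) by blast
qed

lemma winding_through_column: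
  assumes k: "k > 0" and p: "p \<in> torus_vertices (3 * k)"
  shows "\<exists>c\<in>apexes k. winding k c =
    (\<lambda>j. wrap (3 * int k) (centre p + (0, j))) ` {0, int k, - int k}"
proof -
  let ?c = "(fst p, 3 * k + snd p mod k)"
  define m where "m = int (snd p div k)"
  have lt: "snd p < 3 * k" "fst p < 3 * k" using p by (auto simp: torus_vertices_def)
  then have "snd p div k < 3" using k by (simp add: div_less_iff_less_mult)
  then have m: "m \<in> {0, 1, 2}" unfolding m_def by auto
  have c: "?c \<in> apexes k" "\<not> 3 * k \<le> fst ?c" using lt k unfolding apexes_def by simp_all
  have b: "base k ?c = int (snd p mod k)" using c(2) unfolding base_def by simp
  have "int (snd p mod k + snd p div k * k) = int (snd p)" by (simp only: mod_div_mult_eq)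
  then have pm: "int (snd p) = base k ?c + m * int k"
    unfolding b m_def by (simp only: of_nat_add of_nat_mult)
  have "winding k ?c = circle k ?c ` {base k ?c + m * int k, base k ?c + m * int k + int k, base k ?c + m * int k - int k}"
    unfolding winding_def using image_three_classes[of "circle k ?c" "int k" m "base k ?c", OF circle_period[OF k] m] by (rule sym)
  also have "\<dots> = (\<lambda>j. circle k ?c (int (snd p) + j)) ` {0, int k, - int k}"
    unfolding pm[symmetric] by simp
  also have "(\<lambda>j. circle k ?c (int (snd p) + j)) = (\<lambda>j. wrap (3 * int k) (centre p + (0, j)))"
    using c(2) unfolding circle_def centre_def by simp
  finally show ?thesis using c(1) by blast
qed

lemma winding_dist:
  assumes k: "k > 0" and ab: "a \<in> winding k c" "b \<in> winding k c"
  shows "torus_dist (3 * k) a b \<le> k"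
proof -
  obtain i j where ij: "a = circle k c i" "b = circle k c j"
    "i \<in> {base k c, base k c + int k, base k c + 2 * int k}" "j \<in> {base k c, base k c + int k, base k c + 2 * int k}"
    using ab unfolding winding_def by blast
  define j' where "j' = (if j - i > int k then j - 3 * int k else if i - j > int k then j + 3 * int k else j)"
  have "circle k c j' = circle k c j" unfolding j'_def circle_eq[OF k] by simp
  moreover have "\<bar>j' - i\<bar> \<le> int k" using ij(3,4) k unfolding j'_def by auto
  moreover have "int (torus_dist (3 * k) (circle k c i) (circle k c j')) \<le> \<bar>j' - i\<bar>"
    using torus_dist_wrap_le[OF k, of "(i, int (snd c))" "(j', int (snd c))"]
      torus_dist_wrap_le[OF k, of "(int (fst c), i)" "(int (fst c), j')"] unfolding circle_def by simp
  ultimately show ?thesis using ij(1,2) by simp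
qed

text \<open>All vertices are lifted relative to one vertex \<open>p\<close> of the simplex. If the
  lifts are pairwise close, they form a planar simplex. One inconsistent pair already determines a
  winding triangle with \<open>p\<close>, and every further vertex must belong to it.\<close>

lemma vietoris_rips_torus:
  assumes k: "k > 0"
  shows "vietoris_rips (torus_vertices (3 * k)) (torus_dist (3 * k)) k =
    torus_complex (3 * int k) (L1_ball k) \<union> winding k ` apexes k"
proof (intro equalityI subsetI)
  have N: "3 * int k > 0" using k by simp
  have wv: "wrap (3 * int k) x \<in> torus_vertices (3 * k)" for x
    using wrap_less[OF k, of x] by (simp add: torus_vertices_def mem_Times_iff)
  {
    fix \<sigma> assume "\<sigma> \<in> torus_complex (3 * int k) (L1_ball k) \<union> winding k ` apexes k"
    then show "\<sigma> \<in> vietoris_rips (torus_vertices (3 * k)) (torus_dist (3 * k)) k"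
    proof
      assume "\<sigma> \<in> torus_complex (3 * int k) (L1_ball k)"
      then obtain s where s: "s \<in> flag_family (L1_ball k)" "\<sigma> = wrap (3 * int k) ` s"
        unfolding torus_complex_def by blast
      note Ps = flag_familyD[OF s(1)]
      have "torus_dist (3 * k) (wrap (3 * int k) x) (wrap (3 * int k) y) \<le> k" if "x \<in> s" "y \<in> s" for x y
        using torus_dist_wrap_le[OF k, of x y] Ps(3)[OF that] unfolding L1_ball_def by simp
      then show ?thesis unfolding vietoris_rips_def s(2) using Ps(1,2) wv by blast
    next
      assume "\<sigma> \<in> winding k ` apexes k"
      then obtain c where c: "\<sigma> = winding k c" by blast
      have "finite (winding k c)" "winding k c \<noteq> {}" "winding k c \<subseteq> torus_vertices (3 * k)"
        unfolding winding_def circle_def using wv by auto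
      then show ?thesis unfolding vietoris_rips_def c using winding_dist[OF k] by blast
    qed
  }
  fix \<sigma> assume "\<sigma> \<in> vietoris_rips (torus_vertices (3 * k)) (torus_dist (3 * k)) k"
  then have \<sigma>: "\<sigma> \<subseteq> torus_vertices (3 * k)" "finite \<sigma>" "\<sigma> \<noteq> {}"
    "\<And>x y. x \<in> \<sigma> \<Longrightarrow> y \<in> \<sigma> \<Longrightarrow> torus_dist (3 * k) x y \<le> k" unfolding vietoris_rips_def by blast+
  have disp: "\<exists>d. L1_ball k d \<and> wrap (3 * int k) (centre x + d) = y" if "x \<in> \<sigma>" "y \<in> \<sigma>" for x y
    using torus_displacement[OF k, of x y] \<sigma>(1) \<sigma>(4)[OF that] that by blast
  obtain p where p: "p \<in> \<sigma>" using \<sigma>(3) by blast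
  have pv: "p \<in> torus_vertices (3 * k)" using p \<sigma>(1) by blast
  \<comment> \<open>A displacement of L1 norm at most \<open>k\<close> from \<open>p\<close> to each
    vertex; nothing is claimed yet about the displacements between two of these lifts.\<close>
  obtain \<delta> where \<delta>: "\<forall>x\<in>\<sigma>. L1_ball k (\<delta> x) \<and> wrap (3 * int k) (centre p + \<delta> x) = x"
    using bchoice[of \<sigma> "\<lambda>x d. L1_ball k d \<and> wrap (3 * int k) (centre p + d) = x"] disp[OF p] by blast
  \<comment> \<open>The loop from \<open>p\<close> to \<open>x\<close> to \<open>y\<close> and back
    has length at most \<open>3 * k\<close>, so in each coordinate it closes up to 0 or one full
    turn in either direction.\<close>
  have tri: "\<exists>e. \<bar>fst e\<bar> + \<bar>snd e\<bar> \<le> int k \<and>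
      (fst (\<delta> x) + fst e - fst (\<delta> y) = 0 \<or> fst (\<delta> x) + fst e - fst (\<delta> y) = 3 * int k \<or> fst (\<delta> x) + fst e - fst (\<delta> y) = - 3 * int k) \<and>
      (snd (\<delta> x) + snd e - snd (\<delta> y) = 0 \<or> snd (\<delta> x) + snd e - snd (\<delta> y) = 3 * int k \<or> snd (\<delta> x) + snd e - snd (\<delta> y) = - 3 * int k)"
    if xy: "x \<in> \<sigma>" "y \<in> \<sigma>" for x y
  proof -
    obtain e where e: "L1_ball k e" "wrap (3 * int k) (centre x + e) = y" using disp[OF xy] by blast
    have "wrap (3 * int k) (centre p + \<delta> x) = wrap (3 * int k) (centre x)"
      using \<delta> xy(1) wrap_centre[of x k] \<sigma>(1) by auto
    then have 1: "3 * int k dvd fst (centre p + \<delta> x) - fst (centre x)" "3 * int k dvd snd (centre p + \<delta> x) - snd (centre x)"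
      unfolding wrap_eq[OF N] by blast+
    have "wrap (3 * int k) (centre x + e) = wrap (3 * int k) (centre p + \<delta> y)"
      using \<delta> xy(2) e(2) by simp
    then have 2: "3 * int k dvd fst (centre x + e) - fst (centre p + \<delta> y)" "3 * int k dvd snd (centre x + e) - snd (centre p + \<delta> y)"
      unfolding wrap_eq[OF N] by blast+
    have 3: "3 * int k dvd fst (\<delta> x) + fst e - fst (\<delta> y)" using dvd_add[OF 1(1) 2(1)] by (simp add: algebra_simps)
    have 4: "3 * int k dvd snd (\<delta> x) + snd e - snd (\<delta> y)" using dvd_add[OF 1(2) 2(2)] by (simp add: algebra_simps)
    have b: "L1_ball k (\<delta> x)" "L1_ball k (\<delta> y)" using \<delta> xy by blast+
    have "\<bar>fst (\<delta> x) + fst e - fst (\<delta> y)\<bar> \<le> 3 * int k" "\<bar>snd (\<delta> x) + snd e - snd (\<delta> y)\<bar> \<le> 3 * int k"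
      using b e(1) unfolding L1_ball_def by linarith+
    then show ?thesis using dvd_three_cases[OF 3] dvd_three_cases[OF 4] e(1) unfolding L1_ball_def by blast
  qed
  show "\<sigma> \<in> torus_complex (3 * int k) (L1_ball k) \<union> winding k ` apexes k"
  proof (cases "\<forall>x\<in>\<sigma>. \<forall>y\<in>\<sigma>. L1_ball k (\<delta> y - \<delta> x)")
    case True
    let ?l = "\<lambda>x. centre p + \<delta> x"
    have "?l ` \<sigma> \<in> flag_family (L1_ball k)"
      unfolding flag_family_def using True \<sigma>(2,3) by simp
    moreover have "wrap (3 * int k) ` ?l ` \<sigma> = \<sigma>" unfolding image_image using \<delta> by simp
    ultimately show ?thesis using torus_complexI[of "?l ` \<sigma>" "L1_ball k" "3 * int k"] by simp
  next
    case False
    then obtain x y where xy: "x \<in> \<sigma>" "y \<in> \<sigma>" "\<not> L1_ball k (\<delta> y - \<delta> x)" by blast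
    have K: "int k > 0" using k by simp
    have L: "\<bar>fst (\<delta> z)\<bar> + \<bar>snd (\<delta> z)\<bar> \<le> int k" if "z \<in> \<sigma>" for z using \<delta> that unfolding L1_ball_def by blast
    have \<delta>eq: "wrap (3 * int k) (centre p + \<delta> z) = z" if "z \<in> \<sigma>" for z using \<delta> that by blast
    obtain e where e: "\<bar>fst e\<bar> + \<bar>snd e\<bar> \<le> int k"
      "fst (\<delta> x) + fst e - fst (\<delta> y) = 0 \<or> fst (\<delta> x) + fst e - fst (\<delta> y) = 3 * int k \<or> fst (\<delta> x) + fst e - fst (\<delta> y) = - 3 * int k"
      "snd (\<delta> x) + snd e - snd (\<delta> y) = 0 \<or> snd (\<delta> x) + snd e - snd (\<delta> y) = 3 * int k \<or> snd (\<delta> x) + snd e - snd (\<delta> y) = - 3 * int k"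
      using tri[OF xy(1,2)] by blast
    have "\<not> \<bar>fst (\<delta> y) - fst (\<delta> x)\<bar> + \<bar>snd (\<delta> y) - snd (\<delta> x)\<bar> \<le> int k"
      using xy(3) unfolding L1_ball_def by simp
    \<comment> \<open>The pair x, y winds around together with \<open>p\<close>, either horizontally
      or vertically.\<close>
    from inconsistent_lift_arith[OF K L[OF xy(1)] L[OF xy(2)] e this] show ?thesis
    proof
      assume *: "\<bar>fst (\<delta> x)\<bar> = int k \<and> fst (\<delta> y) = - fst (\<delta> x) \<and> snd (\<delta> x) = 0 \<and> snd (\<delta> y) = 0"
      have z: "\<delta> z \<in> (\<lambda>j. (j, 0)) ` {0, int k, - int k}" if z: "z \<in> \<sigma>" for z
      proof -
        obtain E where E: "\<bar>fst E\<bar> + \<bar>snd E\<bar> \<le> int k"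
          "fst (\<delta> x) + fst E - fst (\<delta> z) = 0 \<or> fst (\<delta> x) + fst E - fst (\<delta> z) = 3 * int k \<or> fst (\<delta> x) + fst E - fst (\<delta> z) = - 3 * int k"
          "snd (\<delta> x) + snd E - snd (\<delta> z) = 0 \<or> snd (\<delta> x) + snd E - snd (\<delta> z) = 3 * int k \<or> snd (\<delta> x) + snd E - snd (\<delta> z) = - 3 * int k"
          using tri[OF xy(1) z] by blast
        obtain F where F: "\<bar>fst F\<bar> + \<bar>snd F\<bar> \<le> int k"
          "fst (\<delta> y) + fst F - fst (\<delta> z) = 0 \<or> fst (\<delta> y) + fst F - fst (\<delta> z) = 3 * int k \<or> fst (\<delta> y) + fst F - fst (\<delta> z) = - 3 * int k"
          "snd (\<delta> y) + snd F - snd (\<delta> z) = 0 \<or> snd (\<delta> y) + snd F - snd (\<delta> z) = 3 * int k \<or> snd (\<delta> y) + snd F - snd (\<delta> z) = - 3 * int k"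
          using tri[OF xy(2) z] by blast
        have "snd (\<delta> z) = 0 \<and> (fst (\<delta> z) = 0 \<or> fst (\<delta> z) = int k \<or> fst (\<delta> z) = - int k)"
          by (rule winding_neighbour_arith[of "int k" "fst (\<delta> x)" _ _ "fst E" "snd E" "fst F" "snd F"])
            (use K * L[OF z] E F in \<open>simp_all add: add.commute\<close>)
        then show ?thesis by (auto simp: prod_eq_iff image_iff)
      qed
      let ?g = "\<lambda>j. wrap (3 * int k) (centre p + (j, 0))"
      have "\<sigma> \<subseteq> ?g ` {0, int k, - int k}"
      proof
        fix v assume v: "v \<in> \<sigma>"
        obtain j where j: "j \<in> {0, int k, - int k}" "\<delta> v = (j, 0)" using z[OF v] by blast
        have "v = ?g j" using \<delta>eq[OF v] j(2) by simp
        then show "v \<in> ?g ` {0, int k, - int k}" using j(1) by (rule image_eqI)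
      qed
      \<comment> \<open>All three points of the winding triangle occur, namely \<open>p\<close>,
        \<open>x\<close> and \<open>y\<close>, so the simplex equals the triangle and is not just a
        face of it.\<close>
      moreover have "?g j \<in> \<sigma>" if j: "j \<in> {0, int k, - int k}" for j
      proof -
        have "?g 0 = p" using wrap_centre[OF pv] by (simp flip: zero_prod_def)
        moreover have "(fst (\<delta> x), 0) = \<delta> x" "(- fst (\<delta> x), 0) = \<delta> y" using * by (simp_all add: prod_eq_iff)
        then have "?g (fst (\<delta> x)) = x" "?g (- fst (\<delta> x)) = y" using \<delta>eq xy(1,2) by simp_all
        moreover have "j = 0 \<or> j = fst (\<delta> x) \<or> j = - fst (\<delta> x)" using j * by auto
        ultimately show ?thesis using p xy(1,2) by (elim disjE) simp_all
      qed
      ultimately have "\<sigma> = ?g ` {0, int k, - int k}" by blast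
      then show ?thesis using winding_through_row[OF k pv] by auto
    next
      assume *: "\<bar>snd (\<delta> x)\<bar> = int k \<and> snd (\<delta> y) = - snd (\<delta> x) \<and> fst (\<delta> x) = 0 \<and> fst (\<delta> y) = 0"
      have z: "\<delta> z \<in> (\<lambda>j. (0, j)) ` {0, int k, - int k}" if z: "z \<in> \<sigma>" for z
      proof -
        obtain E where E: "\<bar>fst E\<bar> + \<bar>snd E\<bar> \<le> int k"
          "fst (\<delta> x) + fst E - fst (\<delta> z) = 0 \<or> fst (\<delta> x) + fst E - fst (\<delta> z) = 3 * int k \<or> fst (\<delta> x) + fst E - fst (\<delta> z) = - 3 * int k"
          "snd (\<delta> x) + snd E - snd (\<delta> z) = 0 \<or> snd (\<delta> x) + snd E - snd (\<delta> z) = 3 * int k \<or> snd (\<delta> x) + snd E - snd (\<delta> z) = - 3 * int k"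
          using tri[OF xy(1) z] by blast
        obtain F where F: "\<bar>fst F\<bar> + \<bar>snd F\<bar> \<le> int k"
          "fst (\<delta> y) + fst F - fst (\<delta> z) = 0 \<or> fst (\<delta> y) + fst F - fst (\<delta> z) = 3 * int k \<or> fst (\<delta> y) + fst F - fst (\<delta> z) = - 3 * int k"
          "snd (\<delta> y) + snd F - snd (\<delta> z) = 0 \<or> snd (\<delta> y) + snd F - snd (\<delta> z) = 3 * int k \<or> snd (\<delta> y) + snd F - snd (\<delta> z) = - 3 * int k"
          using tri[OF xy(2) z] by blast
        have "fst (\<delta> z) = 0 \<and> (snd (\<delta> z) = 0 \<or> snd (\<delta> z) = int k \<or> snd (\<delta> z) = - int k)"
          by (rule winding_neighbour_arith[of "int k" "snd (\<delta> x)" _ _ "snd E" "fst E" "snd F" "fst F"])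
            (use K * L[OF z] E F in \<open>simp_all add: add.commute\<close>)
        then show ?thesis by (auto simp: prod_eq_iff image_iff)
      qed
      let ?g = "\<lambda>j. wrap (3 * int k) (centre p + (0, j))"
      have "\<sigma> \<subseteq> ?g ` {0, int k, - int k}"
      proof
        fix v assume v: "v \<in> \<sigma>"
        obtain j where j: "j \<in> {0, int k, - int k}" "\<delta> v = (0, j)" using z[OF v] by blast
        have "v = ?g j" using \<delta>eq[OF v] j(2) by simp
        then show "v \<in> ?g ` {0, int k, - int k}" using j(1) by (rule image_eqI)
      qed
      moreover have "?g j \<in> \<sigma>" if j: "j \<in> {0, int k, - int k}" for j
      proof -
        have "?g 0 = p" using wrap_centre[OF pv] by (simp flip: zero_prod_def)
        moreover have "(0, snd (\<delta> x)) = \<delta> x" "(0, - snd (\<delta> x)) = \<delta> y" using * by (simp_all add: prod_eq_iff)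
        then have "?g (snd (\<delta> x)) = x" "?g (- snd (\<delta> x)) = y" using \<delta>eq xy(1,2) by simp_all
        moreover have "j = 0 \<or> j = snd (\<delta> x) \<or> j = - snd (\<delta> x)" using j * by auto
        ultimately show ?thesis using p xy(1,2) by (elim disjE) simp_all
      qed
      ultimately have "\<sigma> = ?g ` {0, int k, - int k}" by blast
      then show ?thesis using winding_through_column[OF k pv] by auto
    qed
  qed
qed

section \<open>Winding triangles as explicit vertex sets\<close>

lemma winding_row:
  assumes k: "k > 0" and c: "c \<in> apexes k" "3 * k \<le> fst c"
  shows "winding k c = {(fst c - 3 * k, snd c), (fst c - 3 * k + k, snd c), (fst c - 3 * k + 2 * k, snd c)}"
proof -
  have lt: "fst c - 3 * k < k" "snd c < 3 * k" using c unfolding apexes_def by auto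
  have w: "circle k c (int i) = (i, snd c)" if "i < 3 * k" for i
    using that lt(2) c(2) unfolding circle_def wrap_def by (simp flip: of_nat_mult add: zmod_int[symmetric])
  have "winding k c = circle k c ` {int (fst c - 3 * k), int (fst c - 3 * k + k), int (fst c - 3 * k + 2 * k)}"
    using c(2) unfolding winding_def base_def by simp
  then show ?thesis using lt(1) by (simp add: w del: of_nat_add of_nat_diff)
qed

lemma winding_column:
  assumes k: "k > 0" and c: "c \<in> apexes k" "\<not> 3 * k \<le> fst c"
  shows "winding k c = {(fst c, snd c - 3 * k), (fst c, snd c - 3 * k + k), (fst c, snd c - 3 * k + 2 * k)}"
proof -
  have lt: "snd c - 3 * k < k" "fst c < 3 * k" using c unfolding apexes_def by auto
  have w: "circle k c (int i) = (fst c, i)" if "i < 3 * k" for i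
    using that lt(2) c(2) unfolding circle_def wrap_def by (simp flip: of_nat_mult add: zmod_int[symmetric])
  have "winding k c = circle k c ` {int (snd c - 3 * k), int (snd c - 3 * k + k), int (snd c - 3 * k + 2 * k)}"
    using c(2) unfolding winding_def base_def by simp
  then show ?thesis using lt(1) by (simp add: w del: of_nat_add of_nat_diff)
qed

text \<open>The base is below \<open>k\<close>, hence is recovered as the only coordinate below
  \<open>k\<close> along the circle. A row triangle is never contained in a column triangle or
  conversely, since its vertices differ in the coordinate that is constant on the other.\<close>

lemma winding_inj:
  assumes k: "k > 0" and c: "c \<in> apexes k" "c' \<in> apexes k" "winding k c \<subseteq> winding k c'"
  shows "c = c'"
proof (cases "3 * k \<le> fst c"; cases "3 * k \<le> fst c'")
  assume r: "3 * k \<le> fst c" "3 * k \<le> fst c'"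
  have "snd c = snd c'" using c(3) unfolding winding_row[OF k c(1) r(1)] winding_row[OF k c(2) r(2)] by auto
  moreover have "fst c < 4 * k" "fst c' < 4 * k" using c(1,2) r unfolding apexes_def by auto
  moreover have "fst c - 3 * k = fst c' - 3 * k \<or> fst c - 3 * k = fst c' - 3 * k + k \<or> fst c - 3 * k = fst c' - 3 * k + 2 * k"
    using c(3) unfolding winding_row[OF k c(1) r(1)] winding_row[OF k c(2) r(2)] by auto
  ultimately show ?thesis using r by (intro prod_eqI) linarith+
next
  assume r: "\<not> 3 * k \<le> fst c" "\<not> 3 * k \<le> fst c'"
  have "fst c = fst c'" using c(3) unfolding winding_column[OF k c(1) r(1)] winding_column[OF k c(2) r(2)] by auto
  moreover have "3 * k \<le> snd c" "3 * k \<le> snd c'" "snd c < 4 * k" "snd c' < 4 * k"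
    using c(1,2) r unfolding apexes_def by auto
  moreover have "snd c - 3 * k = snd c' - 3 * k \<or> snd c - 3 * k = snd c' - 3 * k + k \<or> snd c - 3 * k = snd c' - 3 * k + 2 * k"
    using c(3) unfolding winding_column[OF k c(1) r(1)] winding_column[OF k c(2) r(2)] by auto
  ultimately show ?thesis by (intro prod_eqI) linarith+
next
  assume r: "3 * k \<le> fst c" "\<not> 3 * k \<le> fst c'"
  have "fst c - 3 * k = fst c'" "fst c - 3 * k + k = fst c'"
    using c(3) unfolding winding_row[OF k c(1) r(1)] winding_column[OF k c(2) r(2)] by auto
  then show ?thesis using k by simp
next
  assume r: "\<not> 3 * k \<le> fst c" "3 * k \<le> fst c'"
  have "snd c - 3 * k = snd c'" "snd c - 3 * k + k = snd c'"
    using c(3) unfolding winding_column[OF k c(1) r(1)] winding_row[OF k c(2) r(2)] by auto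
  then show ?thesis using k by simp
qed

text \<open>In a lift centred at the base vertex the other two vertices sit at distance
  \<open>k\<close> on opposite sides, hence \<open>2 * k\<close> apart.\<close>

lemma winding_not_local:
  assumes k: "k > 0" and \<sigma>: "\<sigma> \<in> torus_complex (3 * int k) (L1_ball k)"
  shows "\<not> winding k c \<subseteq> \<sigma>"
proof
  assume *: "winding k c \<subseteq> \<sigma>"
  have k': "int k > 0" using k by simp
  define pt where "pt = (\<lambda>i. if 3 * k \<le> fst c then (i, int (snd c)) else (int (fst c), i))"
  have pt: "circle k c i = wrap (3 * int k) (pt i)" for i unfolding circle_def pt_def by simp
  let ?b = "base k c"
  have 0: "wrap (3 * int k) (pt ?b) \<in> \<sigma>" and 1: "wrap (3 * int k) (pt (?b + int k)) \<in> \<sigma>"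
    and "circle k c (?b + 2 * int k) \<in> \<sigma>"
    using * unfolding winding_def pt[symmetric] by auto
  moreover have "circle k c (?b + 2 * int k) = circle k c (?b - int k)" unfolding circle_eq[OF k] by simp
  ultimately have 2: "wrap (3 * int k) (pt (?b - int k)) \<in> \<sigma>" unfolding pt by simp
  obtain s where s: "s \<in> flag_family (L1_ball k)" 
    "\<forall>q. wrap (3 * int k) q \<in> \<sigma> \<longrightarrow> \<bar>fst q - fst (pt ?b)\<bar> \<le> int k \<longrightarrow> \<bar>snd q - snd (pt ?b)\<bar> \<le> int k \<longrightarrow> q \<in> s"
    using torus_lift[OF refl k' short_L1_ball \<sigma> 0] by blast
  have "pt (?b + int k) \<in> s" using s(2) 1 unfolding pt_def by auto
  moreover have "pt (?b - int k) \<in> s" using s(2) 2 unfolding pt_def by auto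
  ultimately have "L1_ball k (pt (?b + int k) - pt (?b - int k))" by (intro flag_familyD(3)[OF s(1)])
  then show False using k unfolding L1_ball_def pt_def by (auto split: if_splits)
qed

text \<open>The complex of long planar edges with cones over whole circles folds in two ways.
  Folding only the bases of the cones turns each circle into the boundary of its winding triangle,
  and such cones can be traded for the triangles themselves. Folding the planar edges gives the
  triangulated torus with cones.\<close>

lemma vietoris_rips_homotopy_equivalent_torus_with_cones:
  assumes k: "k \<ge> 2"
  shows "top_of_set (realization (vietoris_rips (torus_vertices (3 * k)) (torus_dist (3 * k)) k))
    homotopy_equivalent_space top_of_set (realization (torus_with_cones k triangular))"
proof -
  have k0: "k > 0" using k by simp
  let ?K = "torus_complex (3 * int k) (L1_ball k)"
  let ?R = "\<lambda>c. {s. s \<noteq> {} \<and> s \<subset> winding k c}"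
  have ind: "{\<sigma>\<in>?K. \<sigma> \<subseteq> range (circle k c)} = line_complex (circle k c) (int k)" for c
    by (rule induced_circle[OF k0 short_L1_ball]) (simp_all add: L1_ball_def)
  have col: "collapses {\<sigma>\<in>?K. \<sigma> \<subseteq> range (circle k c)} (?R c)" for c
    unfolding ind winding_def
    by (rule collapses_circle_to_triangle) (use k0 circle_eq[OF k0] in simp_all)
  have disj: "apexes k \<inter> \<Union>?K = {}"
    using apexes_disjoint[OF k0] unfolding torus_complex_def by blast
  have "collapses (torus_with_cones k (L1_ball k)) (cones ?K (apexes k) ?R)"
    unfolding induced_cones_def
    by (rule collapses_cones[OF finite_apexes simplicial_complex_torus_complex _ disj])
      (use col simplicial_complex_induced[OF simplicial_complex_torus_complex] in auto)
  then have heq: "top_of_set (realization (cones ?K (apexes k) ?R)) homotopy_equivalent_space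
      top_of_set (realization (torus_with_cones k triangular))"
    by (rule collapses_common_homotopy_equivalent[OF _ collapses_L1_ball_triangular[OF k]
          simplicial_complex_induced_cones[OF simplicial_complex_torus_complex]])
  have "top_of_set (realization (?K \<union> winding k ` apexes k)) homotopy_equivalent_space
      top_of_set (realization (cones ?K (apexes k) ?R))"
  proof (rule replace_simplices_by_cones[OF simplicial_complex_torus_complex finite_apexes disj])
    fix c assume c: "c \<in> apexes k"
    have "winding k c \<subseteq> range (wrap (3 * int k))" unfolding winding_def circle_def by blast
    then have "apexes k \<inter> winding k c = {}" using apexes_disjoint[OF k0] by blast
    then show "finite (winding k c) \<and> winding k c \<noteq> {} \<and> apexes k \<inter> winding k c = {}"
      unfolding winding_def by simp
    show "s \<in> ?K" if "s \<subset> winding k c" "s \<noteq> {}" for s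
      using collapses_subset[OF col[of c]] that by blast
  qed (use winding_not_local[OF k0] winding_inj[OF k0] in blast)+
  then show ?thesis unfolding vietoris_rips_torus[OF k0]
    using heq by (rule homotopy_eqv_trans)
qed

section \<open>The triangulated torus with cones\<close>

lemma short_triangular: "k > 0 \<Longrightarrow> short (int k) triangular"
  unfolding short_def triangular_def by auto

lemma fst_wrap: "k > 0 \<Longrightarrow> int (fst (wrap (3 * int k) p)) = fst p mod (3 * int k)"
  and snd_wrap: "k > 0 \<Longrightarrow> int (snd (wrap (3 * int k) p)) = snd p mod (3 * int k)"
  by (simp_all add: wrap_def)

lemma triangular_edge_lift:
  assumes k: "k > 0" and \<sigma>: "\<sigma> \<in> torus_complex (3 * int k) triangular"
    and pq: "{wrap (3 * int k) p, wrap (3 * int k) q} \<subseteq> \<sigma>" "\<bar>fst q - fst p\<bar> \<le> 1" "\<bar>snd q - snd p\<bar> \<le> 1"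
  shows "\<exists>s. s \<in> flag_family triangular \<and> \<sigma> = wrap (3 * int k) ` s \<and> p \<in> s \<and> q \<in> s"
proof -
  have "int k > 0" "\<bar>fst q - fst p\<bar> \<le> int k" "\<bar>snd q - snd p\<bar> \<le> int k" using k pq(2,3) by linarith+
  then show ?thesis by (intro torus_lift_edge[OF refl _ short_triangular[OF k] \<sigma> pq(1)])
qed

text \<open>Displacements in the unit box survive projection: two of them differ by at most 2 in
  each coordinate, which is less than \<open>3 * k\<close>, so congruent ones are equal.\<close>

lemma edge_in_image:
  assumes k: "k > 0" and s: "\<forall>x\<in>s. \<forall>y\<in>s. triangular (y - x)"
    and d: "\<bar>fst d\<bar> \<le> 1" "\<bar>snd d\<bar> \<le> 1"
    and sub: "{wrap (3 * int k) a, wrap (3 * int k) (a + d)} \<subseteq> wrap (3 * int k) ` s"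
  shows "\<exists>x\<in>s. x + d \<in> s \<and> wrap (3 * int k) x = wrap (3 * int k) a"
proof -
  have N: "3 * int k > 0" using k by simp
  obtain x y where xy: "x \<in> s" "y \<in> s" "wrap (3 * int k) a = wrap (3 * int k) x"
    "wrap (3 * int k) (a + d) = wrap (3 * int k) y" using sub by blast
  have dv: "3 * int k dvd fst a - fst x" "3 * int k dvd snd a - snd x"
    "3 * int k dvd fst (a + d) - fst y" "3 * int k dvd snd (a + d) - snd y"
    using xy(3,4) unfolding wrap_eq[OF N] by blast+
  have t: "\<bar>fst y - fst x\<bar> \<le> 1" "\<bar>snd y - snd x\<bar> \<le> 1" using s xy(1,2) unfolding triangular_def by auto
  have "3 * int k dvd (fst (a + d) - fst y) - (fst a - fst x)" by (rule dvd_diff[OF dv(3,1)])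
  moreover have "(fst (a + d) - fst y) - (fst a - fst x) = (fst x + fst d) - fst y" by simp
  ultimately have "3 * int k dvd (fst x + fst d) - fst y" by (simp only:)
  then have 1: "fst x + fst d = fst y" by (rule eq_of_dvd_diff) (use t d k in linarith)
  have "3 * int k dvd (snd (a + d) - snd y) - (snd a - snd x)" by (rule dvd_diff[OF dv(4,2)])
  moreover have "(snd (a + d) - snd y) - (snd a - snd x) = (snd x + snd d) - snd y" by simp
  ultimately have "3 * int k dvd (snd x + snd d) - snd y" by (simp only:)
  then have 2: "snd x + snd d = snd y" by (rule eq_of_dvd_diff) (use t d k in linarith)
  have "x + d = y" using 1 2 by (simp add: prod_eq_iff)
  then show ?thesis using xy by (intro bexI[of _ x]) simp_all
qed

text \<open>Each edge of the planar triangulation lies in exactly two triangles; here are the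
  opposite corners for a vertical edge, and next those for a diagonal.\<close>

lemma triangular_vertical_neighbours:
  assumes "triangular (x - p)" "triangular (x - (p + (0, 1)))"
  shows "x = p \<or> x = p + (0, 1) \<or> x = p + (1, 1) \<or> x = p - (1, 0)"
proof -
  have "u = a \<and> v = b \<or> u = a \<and> v = b + 1 \<or> u = a + 1 \<and> v = b + 1 \<or> u = a - 1 \<and> v = b"
    if "\<bar>u - a\<bar> \<le> 1" "\<bar>v - b\<bar> \<le> 1" "\<bar>u - a - (v - b)\<bar> \<le> 1" "\<bar>v - (b + 1)\<bar> \<le> 1" "\<bar>u - a - (v - (b + 1))\<bar> \<le> 1"
    for u v a b :: int using that by (smt (z3))
  from this[of "fst x" "fst p" "snd x" "snd p"]
    assms[unfolded triangular_def fst_diff snd_diff fst_add snd_add fst_conv snd_conv add_0_right]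
  show ?thesis
    unfolding prod_eq_iff fst_diff snd_diff fst_add snd_add fst_conv snd_conv add_0_right diff_0_right by blast
qed

lemma triangular_diagonal_neighbours:
  assumes "triangular (x - p)" "triangular (x - (p + (1, 1)))"
  shows "x = p \<or> x = p + (1, 1) \<or> x = p + (1, 0) \<or> x = p + (0, 1)"
proof -
  have "u = a \<and> v = b \<or> u = a + 1 \<and> v = b + 1 \<or> u = a + 1 \<and> v = b \<or> u = a \<and> v = b + 1"
    if "\<bar>u - a\<bar> \<le> 1" "\<bar>v - b\<bar> \<le> 1" "\<bar>u - (a + 1)\<bar> \<le> 1" "\<bar>v - (b + 1)\<bar> \<le> 1" "\<bar>u - a - (v - b)\<bar> \<le> 1"
    for u v a b :: int using that by (smt (z3))
  from this[of "fst x" "fst p" "snd x" "snd p"]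
    assms[unfolded triangular_def fst_diff snd_diff fst_add snd_add fst_conv snd_conv add_0_right]
  show ?thesis
    unfolding prod_eq_iff fst_diff snd_diff fst_add snd_add fst_conv snd_conv add_0_right diff_0_right by blast
qed

section \<open>Rows, columns and the marked triangles\<close>

lemma wrap_int: "a < 3 * k \<Longrightarrow> b < 3 * k \<Longrightarrow> wrap (3 * int k) (int a, int b) = (a, b)"
  by (simp add: wrap_def)

lemma range_circle_row:
  assumes "k > 0" "3 * k \<le> fst c" "snd c < 3 * k"
  shows "range (circle k c) = {p. fst p < 3 * k \<and> snd p = snd c}"
proof (intro equalityI subsetI)
  fix p assume "p \<in> range (circle k c)"
  then obtain i where p: "p = wrap (3 * int k) (i, int (snd c))" unfolding circle_def using assms(2) by auto
  have "int (snd p) = int (snd c)" unfolding p snd_wrap[OF assms(1)] using assms(3) by simp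
  then show "p \<in> {p. fst p < 3 * k \<and> snd p = snd c}" using wrap_less(1)[OF assms(1)] unfolding p by simp
next
  fix p assume "p \<in> {p. fst p < 3 * k \<and> snd p = snd c}"
  then have "p = circle k c (int (fst p))"
    unfolding circle_def using assms wrap_int[of "fst p" k "snd c"] by (simp add: prod_eq_iff)
  then show "p \<in> range (circle k c)" by (rule range_eqI)
qed

lemma range_circle_column:
  assumes "k > 0" "\<not> 3 * k \<le> fst c"
  shows "range (circle k c) = {p. fst p = fst c \<and> snd p < 3 * k}"
proof (intro equalityI subsetI)
  fix p assume "p \<in> range (circle k c)"
  then obtain i where p: "p = wrap (3 * int k) (int (fst c), i)" unfolding circle_def using assms(2) by auto
  have "int (fst p) = int (fst c)" unfolding p fst_wrap[OF assms(1)] using assms(2) by simp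
  then show "p \<in> {p. fst p = fst c \<and> snd p < 3 * k}" using wrap_less(2)[OF assms(1)] unfolding p by simp
next
  fix p assume "p \<in> {p. fst p = fst c \<and> snd p < 3 * k}"
  then have "p = circle k c (int (snd p))"
    unfolding circle_def using assms wrap_int[of "fst c" k "snd p"] by (simp add: prod_eq_iff)
  then show "p \<in> range (circle k c)" by (rule range_eqI)
qed

text \<open>The apexes with base 0 over all \<open>3 * k\<close> rows and over column 0. Their cones
  are left intact, since they are needed to contract the rows and the one column joining
  them.\<close>

definition kept_apexes :: "nat \<Rightarrow> (nat \<times> nat) set" where
  "kept_apexes k = insert (0, 3 * k) ({3 * k} \<times> {..<3 * k})"

definition upper_triangle :: "nat \<Rightarrow> int \<times> int \<Rightarrow> (nat \<times> nat) set" where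
  "upper_triangle k p = wrap (3 * int k) ` {p, p + (0, 1), p + (1, 1)}"

text \<open>The edge that closes the circle; without it a path from 0 to \<open>3 * k - 1\<close>
  remains.\<close>

definition last_edge :: "nat \<Rightarrow> nat \<times> nat \<Rightarrow> (nat \<times> nat) set" where
  "last_edge k c = {circle k c (3 * int k - 1), circle k c 0}"

text \<open>One triangle in every strip between consecutive rows, always the one above the diagonal
  of the square starting in column 0. Its removal cuts the annular strip open.\<close>

definition column_triangles :: "nat \<Rightarrow> (nat \<times> nat) set set" where
  "column_triangles k = (\<lambda>j. upper_triangle k (0, int j)) ` {..<3 * k}"

definition cone_triangles :: "nat \<Rightarrow> (nat \<times> nat) set set" where
  "cone_triangles k = (\<lambda>c. insert c (last_edge k c)) ` (apexes k - kept_apexes k)"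

lemma upper_triangle_in_complex: "upper_triangle k p \<in> torus_complex (3 * int k) triangular"
  unfolding upper_triangle_def by (rule torus_complexI) (auto simp: flag_family_def triangular_def)

lemma lower_triangle_in_complex:
  "wrap (3 * int k) ` {p, p + (1, 0), p + (1, 1)} \<in> torus_complex (3 * int k) triangular"
  by (rule torus_complexI) (auto simp: flag_family_def triangular_def)

text \<open>The common neighbours of a diagonal's ends are the corners of its square, and the two
  corners off the diagonal differ by an antidiagonal step, so they never occur together.\<close>

lemma upper_triangle_maximal:
  assumes k: "k > 0" and \<sigma>: "\<sigma> \<in> torus_complex (3 * int k) triangular" "upper_triangle k p \<subseteq> \<sigma>"
  shows "\<sigma> = upper_triangle k p"
proof -
  have "{wrap (3 * int k) p, wrap (3 * int k) (p + (1, 1))} \<subseteq> \<sigma>"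
    using \<sigma>(2) unfolding upper_triangle_def by auto
  then obtain s where s: "s \<in> flag_family triangular" "\<sigma> = wrap (3 * int k) ` s" "p \<in> s" "p + (1, 1) \<in> s"
    using triangular_edge_lift[OF k \<sigma>(1), of p "p + (1, 1)"] by auto
  note Ps = flag_familyD(3)[OF s(1)]
  have "{wrap (3 * int k) p, wrap (3 * int k) (p + (0, 1))} \<subseteq> wrap (3 * int k) ` s"
    using \<sigma>(2) unfolding upper_triangle_def s(2) by auto
  then obtain x where x: "x \<in> s" "x + (0, 1) \<in> s" "wrap (3 * int k) x = wrap (3 * int k) p"
    using edge_in_image[OF k, of s "(0, 1)" p] Ps by auto
  have "3 * int k dvd fst x - fst p" "3 * int k dvd snd x - snd p"
    using x(3) k unfolding wrap_eq[of "3 * int k", simplified] by (simp_all add: wrap_eq)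
  moreover have "\<bar>fst x - fst p\<bar> \<le> 1" "\<bar>snd x - snd p\<bar> \<le> 1" using Ps[OF s(3) x(1)] unfolding triangular_def by auto
  then have "\<bar>fst x - fst p\<bar> < 3 * int k" "\<bar>snd x - snd p\<bar> < 3 * int k" using k by linarith+
  ultimately have "fst x = fst p" "snd x = snd p" by (blast intro: eq_of_dvd_diff)+
  then have "x = p" by (simp add: prod_eq_iff)
  then have q: "p + (0, 1) \<in> s" using x(2) by simp
  have "y = p \<or> y = p + (1, 1) \<or> y = p + (0, 1)" if y: "y \<in> s" for y
  proof -
    have "y \<noteq> p + (1, 0)" using Ps[OF q y] unfolding triangular_def by auto
    then show ?thesis using triangular_diagonal_neighbours[OF Ps[OF s(3) y] Ps[OF s(4) y]] by blast
  qed
  then have "s = {p, p + (0, 1), p + (1, 1)}" using s(3,4) q by blast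
  then show ?thesis unfolding upper_triangle_def s(2) by simp
qed

lemma upper_triangle_not_in_circle:
  assumes k: "k > 0"
  shows "\<not> upper_triangle k p \<subseteq> range (circle k c)"
proof
  assume *: "upper_triangle k p \<subseteq> range (circle k c)"
  have nd: "\<not> 3 * int k dvd 1" using k by (auto dest: zdvd_imp_le)
  have "wrap (3 * int k) p \<in> range (circle k c)" "wrap (3 * int k) (p + (0, 1)) \<in> range (circle k c)"
    "wrap (3 * int k) (p + (1, 1)) \<in> range (circle k c)" using * unfolding upper_triangle_def by auto
  note r = this[unfolded in_range_circle[OF k]]
  show False
  proof (cases "3 * k \<le> fst c")
    case True
    then have "3 * int k dvd snd (p + (0, 1)) - int (snd c)" "3 * int k dvd snd p - int (snd c)"
      using r(1,2) by simp_all
    then have "3 * int k dvd (snd (p + (0, 1)) - int (snd c)) - (snd p - int (snd c))" by (rule dvd_diff)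
    then show False using nd by simp
  next
    case False
    then have "3 * int k dvd fst (p + (1, 1)) - int (fst c)" "3 * int k dvd fst p - int (fst c)"
      using r(1,3) by simp_all
    then have "3 * int k dvd (fst (p + (1, 1)) - int (fst c)) - (fst p - int (fst c))" by (rule dvd_diff)
    then show False using nd by simp
  qed
qed

lemma last_edge_eq: "k > 0 \<Longrightarrow> last_edge k c = circle k c ` {-1, 0}"
  using circle_eq[of k c "3 * int k - 1" "-1"] unfolding last_edge_def by simp

lemma last_edge_in_line: "k > 0 \<Longrightarrow> last_edge k c \<in> line_complex (circle k c) 1"
  unfolding last_edge_eq by (rule line_complexI) auto

lemma last_edge_maximal:
  assumes k: "k > 0" and \<sigma>: "\<sigma> \<in> line_complex (circle k c) 1" "last_edge k c \<subseteq> \<sigma>"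
  shows "\<sigma> = last_edge k c"
proof -
  have e: "circle k c (-1) \<in> \<sigma>" "circle k c 0 \<in> \<sigma>" using \<sigma>(2) unfolding last_edge_eq[OF k] by auto
  obtain s where s: "\<forall>x\<in>s. \<forall>y\<in>s. \<bar>y - x\<bar> \<le> 1" "\<sigma> = circle k c ` s" "0 \<in> s"
    "\<forall>q. circle k c q \<in> \<sigma> \<longrightarrow> \<bar>q - 0\<bar> + 1 < 3 * int k \<longrightarrow> q \<in> s"
    using line_complex_lift[OF circle_eq[OF k] \<sigma>(1) e(2)] by blast
  have m: "-1 \<in> s" using s(4) e(1) k by simp
  have "x = -1 \<or> x = 0" if "x \<in> s" for x
  proof -
    have "\<bar>x - 0\<bar> \<le> 1" "\<bar>x - (-1)\<bar> \<le> 1" using s(1,3) m that by blast+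
    then show ?thesis by linarith
  qed
  then have "s = {-1, 0}" using s(3) m by blast
  then show ?thesis unfolding s(2) last_edge_eq[OF k] by simp
qed

lemma induced_circle_triangular:
  assumes "k > 0"
  shows "{\<sigma>\<in>torus_complex (3 * int k) triangular. \<sigma> \<subseteq> range (circle k c)} = line_complex (circle k c) 1"
  by (rule induced_circle[OF assms short_triangular[OF assms]]) (auto simp: triangular_def)

text \<open>Cone triangles are told apart by their apexes, of which there are \<open>k\<close> over
  each of the \<open>6 * k\<close> rows and columns, and column triangles by their rows. The two
  kinds are disjoint because column triangles contain no apex.\<close>

lemma card_cone_triangles_Un_column_triangles:
  assumes k: "k \<ge> 2"
  shows "card (cone_triangles k \<union> column_triangles k) = 6 * k^2 - 1"
proof -
  have k0: "k > 0" using k by simp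
  have circ: "circle k c i \<notin> apexes k" for c i
    using apexes_disjoint[OF k0] unfolding circle_def by blast
  have "inj_on (\<lambda>c. insert c (last_edge k c)) (apexes k - kept_apexes k)"
  proof (rule inj_onI)
    fix c c' assume c: "c \<in> apexes k - kept_apexes k" "c' \<in> apexes k - kept_apexes k"
      "insert c (last_edge k c) = insert c' (last_edge k c')"
    have "c \<in> insert c' (last_edge k c')" using c(3) by blast
    then consider "c = c'" | "c = circle k c' (3 * int k - 1)" | "c = circle k c' 0"
      unfolding last_edge_def by blast
    then show "c = c'" using c(1) circ by cases blast+
  qed
  then have 1: "card (cone_triangles k) = card (apexes k - kept_apexes k)"
    unfolding cone_triangles_def by (rule card_image)
  have A: "apexes k = {3 * k..<4 * k} \<times> {..<3 * k} \<union> {..<3 * k} \<times> {3 * k..<4 * k}"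
    unfolding apexes_def by auto
  have "card (apexes k) = k * (3 * k) + 3 * k * k"
    unfolding A by (subst card_Un_disjoint) auto
  then have 2: "card (apexes k) = 6 * k^2" by (simp add: power2_eq_square)
  have sub: "kept_apexes k \<subseteq> apexes k" unfolding kept_apexes_def A using k0 by auto
  have "card ({3 * k} \<times> {..<3 * k}) = 3 * k" by simp
  then have 3: "card (kept_apexes k) = 3 * k + 1" unfolding kept_apexes_def using k0 by simp
  have finK: "finite (kept_apexes k)" unfolding kept_apexes_def by simp
  have 4: "card (apexes k - kept_apexes k) = 6 * k^2 - (3 * k + 1)"
    using card_Diff_subset[OF finK sub] 2 3 by simp
  have "inj_on (\<lambda>j. upper_triangle k (0, int j)) {..<3 * k}"
  proof (rule inj_onI)
    fix i j assume ij: "i \<in> {..<3 * k}" "j \<in> {..<3 * k}" "upper_triangle k (0, int i) = upper_triangle k (0, int j)"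
    have "wrap (3 * int k) (1, int i + 1) \<in> upper_triangle k (0, int j)"
      using ij(3) unfolding upper_triangle_def by auto
    moreover have "\<not> 3 * int k dvd 1" using k0 by (auto dest: zdvd_imp_le)
    ultimately have "3 * int k dvd (int i + 1) - (int j + 1)"
      unfolding upper_triangle_def using k0 by (auto simp: wrap_eq)
    then have "int i + 1 = int j + 1" by (rule eq_of_dvd_diff) (use ij(1,2) in auto)
    then show "i = j" by simp
  qed
  then have 5: "card (column_triangles k) = 3 * k" unfolding column_triangles_def by (simp add: card_image)
  have "cone_triangles k \<inter> column_triangles k = {}"
  proof -
    have "c \<notin> upper_triangle k p" if "c \<in> apexes k" for c p
      using apexes_disjoint[OF k0] that unfolding upper_triangle_def by blast
    then show ?thesis unfolding cone_triangles_def column_triangles_def by blast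
  qed
  then have "card (cone_triangles k \<union> column_triangles k) = 6 * k^2 - (3 * k + 1) + 3 * k"
    using 1 4 5 finite_apexes[of k] by (simp add: card_Un_disjoint cone_triangles_def column_triangles_def)
  \<comment> \<open>Subtraction of natural numbers truncates, so this inequality is needed before
    the terms can be cancelled.\<close>
  moreover have "3 * k + 1 \<le> 6 * k^2"
  proof -
    have "3 * k + 1 \<le> 6 * k" using k by simp
    also have "\<dots> \<le> 6 * k^2" using k by (simp add: power2_eq_square)
    finally show ?thesis .
  qed
  ultimately show ?thesis by simp
qed

section \<open>Triangles in the strips between consecutive rows\<close>

lemma wrap_add_cong:
  assumes "k > 0" "wrap (3 * int k) x = wrap (3 * int k) y"
  shows "wrap (3 * int k) (x + d) = wrap (3 * int k) (y + d)"
proof -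
  have N: "3 * int k > 0" using assms(1) by simp
  show ?thesis using assms(2) unfolding wrap_eq[OF N] by simp
qed

lemma wrap_add_neq:
  assumes k: "k > 0" and d: "\<bar>fst d - fst d'\<bar> = 1 \<or> \<bar>snd d - snd d'\<bar> = 1"
  shows "wrap (3 * int k) (p + d) \<noteq> wrap (3 * int k) (p + d')"
proof
  have N: "3 * int k > 0" using k by simp
  have nd: "\<not> 3 * int k dvd x" if x: "\<bar>x\<bar> = 1" for x
  proof
    assume "3 * int k dvd x"
    then have "\<bar>3 * int k\<bar> \<le> \<bar>x\<bar>" by (rule dvd_imp_le_int[rotated]) (use x in auto)
    then show False using x k by linarith
  qed
  assume "wrap (3 * int k) (p + d) = wrap (3 * int k) (p + d')"
  then have "3 * int k dvd fst d - fst d'" "3 * int k dvd snd d - snd d'" unfolding wrap_eq[OF N] by simp_all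
  then show False using d nd by blast
qed

text \<open>An upper triangle contains a single upward vertical edge, which starts at its base
  point; that edge reveals the column.\<close>

lemma upper_triangle_in_column_iff:
  assumes k: "k > 0"
  shows "upper_triangle k p \<in> column_triangles k \<longleftrightarrow> 3 * int k dvd fst p"
proof
  have N: "3 * int k > 0" using k by simp
  assume "upper_triangle k p \<in> column_triangles k"
  then obtain j where j: "upper_triangle k p = upper_triangle k (0, int j)" unfolding column_triangles_def by blast
  define S where "S = {(0 :: int, int j), (0, int j) + (0, 1), (0, int j) + (1, 1)}"
  have tri: "\<forall>x\<in>S. \<forall>y\<in>S. triangular (y - x)" unfolding S_def by (auto simp: triangular_def)
  have "{wrap (3 * int k) p, wrap (3 * int k) (p + (0, 1))} \<subseteq> wrap (3 * int k) ` S"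
    using j unfolding upper_triangle_def S_def by blast
  then have "\<exists>x\<in>S. x + (0, 1) \<in> S \<and> wrap (3 * int k) x = wrap (3 * int k) p"
    by (intro edge_in_image[OF k tri]) simp_all
  then obtain x where x: "x \<in> S" "x + (0, 1) \<in> S" "wrap (3 * int k) x = wrap (3 * int k) p" by blast
  then have "x = (0, int j)" unfolding S_def by auto
  then show "3 * int k dvd fst p" using x(3) unfolding wrap_eq[OF N] by simp
next
  have N: "3 * int k > 0" using k by simp
  assume *: "3 * int k dvd fst p"
  define j where "j = nat (snd p mod (3 * int k))"
  have j: "int j = snd p mod (3 * int k)" unfolding j_def using k by simp
  have "3 * int k dvd snd p mod (3 * int k) - snd p" by (rule mod_eq_dvd_iff[THEN iffD1]) simp
  then have w: "wrap (3 * int k) (0, int j) = wrap (3 * int k) p" unfolding wrap_eq[OF N] using * j by simp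
  have "upper_triangle k (0, int j) = upper_triangle k p"
    unfolding upper_triangle_def by (simp only: image_insert image_empty w wrap_add_cong[OF k w])
  moreover have "j < 3 * k" using j N by (simp add: j_def nat_less_iff)
  ultimately show "upper_triangle k p \<in> column_triangles k" unfolding column_triangles_def by blast
qed

text \<open>In a lower triangle the vertical edge starts one column to the right of where the
  horizontal edge starts, whereas in a column triangle both start in column 0.\<close>

lemma lower_triangle_not_in_column:
  assumes k: "k > 0"
  shows "wrap (3 * int k) ` {p, p + (1, 0), p + (1, 1)} \<notin> column_triangles k"
proof
  have N: "3 * int k > 0" using k by simp
  assume "wrap (3 * int k) ` {p, p + (1, 0), p + (1, 1)} \<in> column_triangles k"
  then obtain j where j: "wrap (3 * int k) ` {p, p + (1, 0), p + (1, 1)} = upper_triangle k (0, int j)"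
    unfolding column_triangles_def by blast
  define S where "S = {(0 :: int, int j), (0, int j) + (0, 1), (0, int j) + (1, 1)}"
  have tri: "\<forall>x\<in>S. \<forall>y\<in>S. triangular (y - x)" unfolding S_def by (auto simp: triangular_def)
  have "{wrap (3 * int k) p, wrap (3 * int k) (p + (1, 0))} \<subseteq> wrap (3 * int k) ` S"
    using j unfolding upper_triangle_def S_def by blast
  then have "\<exists>x\<in>S. x + (1, 0) \<in> S \<and> wrap (3 * int k) x = wrap (3 * int k) p"
    by (intro edge_in_image[OF k tri]) simp_all
  then obtain x where x: "x \<in> S" "x + (1, 0) \<in> S" "wrap (3 * int k) x = wrap (3 * int k) p" by blast
  have e: "p + (1, 0) + (0, 1) = p + (1, 1)" by (simp add: prod_eq_iff)
  have "{wrap (3 * int k) (p + (1, 0)), wrap (3 * int k) (p + (1, 0) + (0, 1))} \<subseteq> wrap (3 * int k) ` S"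
    unfolding e using j unfolding upper_triangle_def S_def by blast
  then have "\<exists>y\<in>S. y + (0, 1) \<in> S \<and> wrap (3 * int k) y = wrap (3 * int k) (p + (1, 0))"
    by (intro edge_in_image[OF k tri]) simp_all
  then obtain y where y: "y \<in> S" "y + (0, 1) \<in> S" "wrap (3 * int k) y = wrap (3 * int k) (p + (1, 0))" by blast
  have "fst x = 0" "fst y = 0" using x(1,2) y(1,2) unfolding S_def by auto
  then have 1: "3 * int k dvd 0 - fst p" "3 * int k dvd 0 - (fst p + 1)" using x(3) y(3) unfolding wrap_eq[OF N] by simp_all
  have "3 * int k dvd (0 - fst p) - (0 - (fst p + 1))" by (rule dvd_diff[OF 1])
  then have "3 * int k dvd 1" by simp
  then show False using k by (auto dest: zdvd_imp_le)
qed

text \<open>The flag selects the diagonal at a point (\<open>True\<close>) or the vertical edge at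
  it (\<open>False\<close>).\<close>

definition strip_face :: "nat \<Rightarrow> bool \<times> int \<times> int \<Rightarrow> (nat \<times> nat) set" where
  "strip_face k i = {wrap (3 * int k) (snd i), wrap (3 * int k) (snd i + (if fst i then (1, 1) else (0, 1)))}"

text \<open>Vertical edges in column 0 are exempt: they remain as the circle that joins the
  rows.\<close>

definition strip_faces :: "nat \<Rightarrow> (bool \<times> int \<times> int) set" where
  "strip_faces k = {i. 0 \<le> fst (snd i) \<and> fst (snd i) < 3 * int k \<and> 0 \<le> snd (snd i) \<and> snd (snd i) < 3 * int k \<and>
     (fst i \<or> 1 \<le> fst (snd i))}"

text \<open>From left to right: the diagonal starting in column 0, then for each later column its
  vertical edge and after that the diagonal starting there.\<close>

definition strip_rank :: "bool \<times> int \<times> int \<Rightarrow> int" where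
  "strip_rank i = (if fst i then 2 * fst (snd i) else 2 * fst (snd i) - 1)"

text \<open>Each strip between two rows has been opened by removing its triangle at column \<open>0\<close>; the
  remaining triangles are folded away from left to right, diagonals and vertical edges alternating.\<close>
lemma collapses_strips:
  assumes k: "k > 0"
  shows "collapses
    (induced_cones (torus_complex (3 * int k) triangular - column_triangles k) (kept_apexes k) (\<lambda>c. range (circle k c)))
    (induced_cones {\<sigma>\<in>torus_complex (3 * int k) triangular - column_triangles k. \<forall>i\<in>strip_faces k. \<not> strip_face k i \<subseteq> \<sigma>}
      (kept_apexes k) (\<lambda>c. range (circle k c)))"
proof (rule collapses_induced_cones[where rk = strip_rank and
      w = "\<lambda>i. wrap (3 * int k) (snd i + (if fst i then (1, 0) else (1, 1)))"])
  have N: "3 * int k > 0" using k by simp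
  let ?wr = "wrap (3 * int k)"
  let ?K = "torus_complex (3 * int k) triangular"
  have kept_apex: "kept_apexes k \<subseteq> apexes k" using k unfolding kept_apexes_def apexes_def by auto
  then have kr: "?wr x \<notin> kept_apexes k" for x using apexes_disjoint[OF k] by blast
  show "finite (strip_faces k)"
    unfolding strip_faces_def
    by (rule finite_subset[of _ "UNIV \<times> {0..3 * int k} \<times> {0..3 * int k}"]) (auto simp: mem_Times_iff)
  show "kept_apexes k \<inter> \<Union>(?K - column_triangles k) = {}"
    using kr unfolding torus_complex_def by blast
  fix i assume i: "i \<in> strip_faces k"
  obtain b p where ib: "i = (b, p)" by (cases i)
  have p: "0 \<le> fst p" "fst p < 3 * int k" "0 \<le> snd p" "snd p < 3 * int k" "b \<or> 1 \<le> fst p"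
    using i unfolding ib strip_faces_def by simp_all
  show "finite (strip_face k i) \<and> strip_face k i \<noteq> {} \<and> kept_apexes k \<inter> strip_face k i = {}"
    using kr unfolding strip_face_def by auto
  show "?wr (snd i + (if fst i then (1, 0) else (1, 1))) \<notin> kept_apexes k" by (rule kr)
  have nd1: "\<not> 3 * int k dvd 1" using k by (auto dest: zdvd_imp_le)
  \<comment> \<open>These edges change rows and none lies inside column 0, so no kept cone stands
    over them and the folds take place in the torus part.\<close>
  have no_circle: "\<not> strip_face k i \<subseteq> range (circle k c)" if c: "c \<in> kept_apexes k" for c
  proof
    assume "strip_face k i \<subseteq> range (circle k c)"
    then have r: "?wr p \<in> range (circle k c)" "?wr (p + (if b then (1, 1) else (0, 1))) \<in> range (circle k c)"
      unfolding strip_face_def ib by auto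
    note r' = r[unfolded in_range_circle[OF k]]
    show False
    proof (cases "3 * k \<le> fst c")
      case True
      then have "3 * int k dvd (snd p + 1) - int (snd c)" "3 * int k dvd snd p - int (snd c)"
        using r' by (auto split: if_splits)
      then have "3 * int k dvd ((snd p + 1) - int (snd c)) - (snd p - int (snd c))" by (rule dvd_diff)
      then show False using nd1 by simp
    next
      case False
      then have c0: "fst c = 0" using c unfolding kept_apexes_def by auto
      show False
      proof (cases b)
        case True
        then have "3 * int k dvd fst p + 1" "3 * int k dvd fst p" using r' False c0 by simp_all
        then have "3 * int k dvd (fst p + 1) - fst p" by (rule dvd_diff)
        then show False using nd1 by simp
      next
        case nb: False
        have "3 * int k dvd fst p" using r'(1) False c0 by simp
        then show False using p nb zdvd_imp_le[of "3 * int k" "fst p"] by auto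
      qed
    qed
  qed
  have "?wr (p + (1, 0)) \<noteq> ?wr (p + (0, 0))" "?wr (p + (1, 0)) \<noteq> ?wr (p + (1, 1))"
    "?wr (p + (1, 1)) \<noteq> ?wr (p + (0, 0))" "?wr (p + (1, 1)) \<noteq> ?wr (p + (0, 1))"
    by (rule wrap_add_neq[OF k]; simp)+
  then have wne: "?wr (p + (1, 0)) \<noteq> ?wr p" "?wr (p + (1, 0)) \<noteq> ?wr (p + (1, 1))"
    "?wr (p + (1, 1)) \<noteq> ?wr p" "?wr (p + (1, 1)) \<noteq> ?wr (p + (0, 1))" by (simp_all flip: zero_prod_def)
  show "?wr (snd i + (if fst i then (1, 0) else (1, 1))) \<notin> strip_face k i \<and>
      (\<forall>c\<in>kept_apexes k. strip_face k i \<subseteq> range (circle k c) \<longrightarrow>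
        ?wr (snd i + (if fst i then (1, 0) else (1, 1))) \<in> range (circle k c))"
  proof (intro conjI ballI impI)
    show "?wr (snd i + (if fst i then (1, 0) else (1, 1))) \<notin> strip_face k i"
      using wne unfolding ib strip_face_def by auto
  qed (use no_circle in blast)
  fix \<sigma> assume \<sigma>: "\<sigma> \<in> ?K - column_triangles k" "strip_face k i \<subseteq> \<sigma>"
    and low: "\<And>i'. i' \<in> strip_faces k \<Longrightarrow> strip_rank i' < strip_rank i \<Longrightarrow> \<not> strip_face k i' \<subseteq> \<sigma>"
  have \<sigma>K: "\<sigma> \<in> ?K" using \<sigma>(1) by simp
  have same: "x = p" if "?wr x = ?wr p" "0 \<le> fst x" "fst x < 3 * int k" "0 \<le> snd x" "snd x < 3 * int k" for x
  proof -
    have "fst x = fst p" "snd x = snd p"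
      using that p unfolding wrap_eq[OF N] by (auto intro!: eq_of_dvd_diff)
    then show ?thesis by (simp add: prod_eq_iff)
  qed
  have edge: "\<exists>x\<in>s. x + (if fst i' then (1, 1) else (0, 1)) \<in> s \<and> ?wr x = ?wr (snd i')"
    if "\<forall>x\<in>s. \<forall>y\<in>s. triangular (y - x)" "strip_face k i' \<subseteq> ?wr ` s" for s i'
    using that(2) unfolding strip_face_def by (intro edge_in_image[OF k that(1)]) auto
  show "insert (?wr (snd i + (if fst i then (1, 0) else (1, 1)))) \<sigma> \<in> ?K - column_triangles k \<and>
      (\<forall>i'\<in>strip_faces k. strip_rank i' \<le> strip_rank i \<longrightarrow>
        ?wr (snd i + (if fst i then (1, 0) else (1, 1))) \<in> strip_face k i' \<longrightarrow>
        \<not> strip_face k i' \<subseteq> insert (?wr (snd i + (if fst i then (1, 0) else (1, 1)))) \<sigma>)"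
  proof (cases b)
    case False
    have sub: "{?wr p, ?wr (p + (0, 1))} \<subseteq> \<sigma>" using \<sigma>(2) False unfolding strip_face_def ib by simp
    have "\<exists>s. s \<in> flag_family triangular \<and> \<sigma> = ?wr ` s \<and> p \<in> s \<and> p + (0, 1) \<in> s"
      by (rule triangular_edge_lift[OF k \<sigma>K sub]) simp_all
    then obtain s where s: "s \<in> flag_family triangular" "\<sigma> = ?wr ` s" "p \<in> s" "p + (0, 1) \<in> s" by blast
    note Ps = flag_familyD(3)[OF s(1)]
    \<comment> \<open>The triangle to the left of the vertical edge contains the diagonal of the
      preceding column, which has already been folded away; only the triangle on the right is
      left.\<close>
    have "p - (1, 0) \<notin> s"
    proof
      assume l: "p - (1, 0) \<in> s"
      have e: "p - (1, 0) + (1, 1) = p + (0, 1)" by (simp add: prod_eq_iff)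
      have "strip_face k (True, p - (1, 0)) = ?wr ` {p - (1, 0), p + (0, 1)}"
        unfolding strip_face_def by (simp only: e fst_conv snd_conv if_True image_insert image_empty)
      then have "strip_face k (True, p - (1, 0)) \<subseteq> \<sigma>" unfolding s(2) using l s(4) by blast
      moreover have "(True, p - (1, 0)) \<in> strip_faces k" using p False unfolding strip_faces_def by simp
      moreover have "strip_rank (True, p - (1, 0)) < strip_rank i" using False unfolding strip_rank_def ib by simp
      ultimately show False using low by blast
    qed
    then have "x = p \<or> x = p + (0, 1) \<or> x = p + (1, 1)" if "x \<in> s" for x
      using triangular_vertical_neighbours[OF Ps[OF s(3) that] Ps[OF s(4) that]] that by blast
    then have "insert (p + (1, 1)) s = {p, p + (0, 1), p + (1, 1)}" using s(3,4) by blast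
    then have eq: "insert (?wr (p + (1, 1))) \<sigma> = upper_triangle k p"
      unfolding s(2) upper_triangle_def image_insert[symmetric] by simp
    have "\<not> 3 * int k dvd fst p" using p False zdvd_imp_le[of "3 * int k" "fst p"] by auto
    then have "insert (?wr (p + (1, 1))) \<sigma> \<in> ?K - column_triangles k"
      unfolding eq using upper_triangle_in_complex upper_triangle_in_column_iff[OF k] by blast
    moreover have "\<not> strip_face k i' \<subseteq> insert (?wr (p + (1, 1))) \<sigma>"
      if i': "i' \<in> strip_faces k" "strip_rank i' \<le> strip_rank i" "?wr (p + (1, 1)) \<in> strip_face k i'" for i'
    proof
      define S where "S = {p, p + (0, 1), p + (1, 1)}"
      have tri: "\<forall>x\<in>S. \<forall>y\<in>S. triangular (y - x)" unfolding S_def by (auto simp: triangular_def)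
      assume "strip_face k i' \<subseteq> insert (?wr (p + (1, 1))) \<sigma>"
      then have "strip_face k i' \<subseteq> ?wr ` S" unfolding eq upper_triangle_def S_def .
      then obtain x where x: "x \<in> S" "x + (if fst i' then (1, 1) else (0, 1)) \<in> S" "?wr x = ?wr (snd i')"
        using edge[OF tri] by blast
      then have xp: "x = p" unfolding S_def by (auto simp: prod_eq_iff split: if_splits)
      show False
      proof (cases "fst i'")
        case True
        have "snd i' = p" using i'(1) x(3) xp unfolding strip_faces_def by (intro same) simp_all
        then show False using i'(2) True False unfolding strip_rank_def ib by simp
      next
        case f: False
        have "?wr (p + (0, 1)) = ?wr (snd i' + (0, 1))" by (rule wrap_add_cong[OF k]) (use x(3) xp in simp)
        then have "?wr (p + (1, 1)) = ?wr p \<or> ?wr (p + (1, 1)) = ?wr (p + (0, 1))"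
          using i'(3) x(3) xp f unfolding strip_face_def by auto
        then show False using wne by blast
      qed
    qed
    ultimately show ?thesis using False unfolding ib by simp
  next
    case True
    have sub: "{?wr p, ?wr (p + (1, 1))} \<subseteq> \<sigma>" using \<sigma>(2) True unfolding strip_face_def ib by simp
    have "\<exists>s. s \<in> flag_family triangular \<and> \<sigma> = ?wr ` s \<and> p \<in> s \<and> p + (1, 1) \<in> s"
      by (rule triangular_edge_lift[OF k \<sigma>K sub]) simp_all
    then obtain s where s: "s \<in> flag_family triangular" "\<sigma> = ?wr ` s" "p \<in> s" "p + (1, 1) \<in> s" by blast
    note Ps = flag_familyD(3)[OF s(1)]
    \<comment> \<open>The triangle above the diagonal is gone: in column 0 it was deleted as a
      marked triangle, in later columns its vertical edge was folded just before.\<close>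
    have "p + (0, 1) \<notin> s"
    proof
      assume l: "p + (0, 1) \<in> s"
      show False
      proof (cases "fst p = 0")
        case True
        have "upper_triangle k p \<subseteq> \<sigma>" unfolding upper_triangle_def s(2) using l s(3,4) by blast
        then have "\<sigma> = upper_triangle k p" by (rule upper_triangle_maximal[OF k \<sigma>K])
        then show False using \<sigma>(1) upper_triangle_in_column_iff[OF k, of p] True by simp
      next
        case f: False
        have "strip_face k (False, p) \<subseteq> \<sigma>" unfolding strip_face_def s(2) using l s(3) by simp
        moreover have "(False, p) \<in> strip_faces k" using p f unfolding strip_faces_def by simp
        moreover have "strip_rank (False, p) < strip_rank i" using True unfolding strip_rank_def ib by simp
        ultimately show False using low by blast
      qed
    qed
    then have "x = p \<or> x = p + (1, 0) \<or> x = p + (1, 1)" if "x \<in> s" for x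
      using triangular_diagonal_neighbours[OF Ps[OF s(3) that] Ps[OF s(4) that]] that by blast
    then have "insert (p + (1, 0)) s = {p, p + (1, 0), p + (1, 1)}" using s(3,4) by blast
    then have eq: "insert (?wr (p + (1, 0))) \<sigma> = ?wr ` {p, p + (1, 0), p + (1, 1)}"
      unfolding s(2) image_insert[symmetric] by simp
    have "insert (?wr (p + (1, 0))) \<sigma> \<in> ?K - column_triangles k"
      unfolding eq using lower_triangle_in_complex lower_triangle_not_in_column[OF k] by blast
    moreover have "\<not> strip_face k i' \<subseteq> insert (?wr (p + (1, 0))) \<sigma>"
      if i': "i' \<in> strip_faces k" "strip_rank i' \<le> strip_rank i" "?wr (p + (1, 0)) \<in> strip_face k i'" for i'
    proof
      define S where "S = {p, p + (1, 0), p + (1, 1)}"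
      have tri: "\<forall>x\<in>S. \<forall>y\<in>S. triangular (y - x)" unfolding S_def by (auto simp: triangular_def)
      assume "strip_face k i' \<subseteq> insert (?wr (p + (1, 0))) \<sigma>"
      then have "strip_face k i' \<subseteq> ?wr ` S" unfolding eq S_def .
      then obtain x where x: "x \<in> S" "x + (if fst i' then (1, 1) else (0, 1)) \<in> S" "?wr x = ?wr (snd i')"
        using edge[OF tri] by blast
      show False
      proof (cases "fst i'")
        case t: True
        then have xp: "x = p" using x(1,2) unfolding S_def by (auto simp: prod_eq_iff)
        have "?wr (p + (1, 1)) = ?wr (snd i' + (1, 1))" by (rule wrap_add_cong[OF k]) (use x(3) xp in simp)
        then have "?wr (p + (1, 0)) = ?wr p \<or> ?wr (p + (1, 0)) = ?wr (p + (1, 1))"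
          using i'(3) x(3) xp t unfolding strip_face_def by auto
        then show False using wne by blast
      next
        case f: False
        then have "x = p + (1, 0)" using x(1,2) unfolding S_def by (auto simp: prod_eq_iff)
        then have "3 * int k dvd (fst p + 1) - fst (snd i')" using x(3) unfolding wrap_eq[OF N] by simp
        \<comment> \<open>For the last column the vertical edge on the right lies in column 0. Since
          column 0 is exempt from the family, the index on the right is at least 1 and no
          wrap-around can occur.\<close>
        moreover have "\<bar>(fst p + 1) - fst (snd i')\<bar> < 3 * int k"
          using p i'(1) f unfolding strip_faces_def by auto
        ultimately have "fst p + 1 = fst (snd i')" by (rule eq_of_dvd_diff)
        then show False using i'(2) f True unfolding strip_rank_def ib by simp
      qed
    qed
    ultimately show ?thesis using True unfolding ib by simp
  qed
qed

text \<open>The only edges still leaving a row are the vertical ones in column 0, so a simplex with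
  a vertex outside column 0 stays in one row.\<close>

lemma opened_strips_row:
  assumes k: "k > 0"
    and \<sigma>: "\<sigma> \<in> torus_complex (3 * int k) triangular" "\<forall>i\<in>strip_faces k. \<not> strip_face k i \<subseteq> \<sigma>"
    and ab: "(a, b) \<in> \<sigma>" "a \<noteq> 0" and v: "v \<in> \<sigma>"
  shows "snd v = b"
proof -
  have N: "3 * int k > 0" using k by simp
  let ?wr = "wrap (3 * int k)"
  have "(a, b) \<in> range ?wr" using ab(1) \<sigma>(1) unfolding torus_complex_def by blast
  then have lt: "a < 3 * k" "b < 3 * k" using wrap_less[OF k] by (metis fst_conv snd_conv rangeE)+
  define p where "p = (int a, int b)"
  have wp: "?wr p = (a, b)" unfolding p_def by (rule wrap_int[OF lt])
  have pr: "1 \<le> fst p" "fst p < 3 * int k" "0 \<le> snd p" "snd p < 3 * int k"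
    using lt ab(2) unfolding p_def by simp_all
  have k': "int k > 0" using k by simp
  have "?wr p \<in> \<sigma>" unfolding wp by (rule ab(1))
  from torus_lift[OF refl k' short_triangular[OF k] \<sigma>(1) this]
  obtain s where s: "s \<in> flag_family triangular" "\<sigma> = ?wr ` s" "p \<in> s" by blast
  note Ps = flag_familyD(3)[OF s(1)]
  obtain x where x: "x \<in> s" "v = ?wr x" using v s(2) by blast
  define norm where "norm = (\<lambda>y. (fst y mod (3 * int k), snd y mod (3 * int k)))"
  have wn: "?wr (norm y) = ?wr y" for y
    unfolding norm_def wrap_def by simp
  have in_faces: "(c, norm y) \<in> strip_faces k" if "c \<or> y = p \<or> fst y = fst p" for c y
    using that N pr unfolding strip_faces_def norm_def by auto
  have no_edge: False if "y \<in> s" "y + (if c then (1, 1) else (0, 1)) \<in> s" "c \<or> y = p \<or> fst y = fst p" for c y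
  proof -
    have "strip_face k (c, norm y) \<subseteq> \<sigma>"
      using that(1,2) wn wrap_add_cong[OF k wn[of y]] unfolding strip_face_def s(2) by auto
    then show False using \<sigma>(2) in_faces[OF that(3)] by blast
  qed
  have "snd x = snd p"
  proof (rule ccontr)
    assume ne: "snd x \<noteq> snd p"
    have t: "\<bar>fst x - fst p\<bar> \<le> 1" "\<bar>snd x - snd p\<bar> \<le> 1" "\<bar>(fst x - fst p) - (snd x - snd p)\<bar> \<le> 1"
      using Ps[OF s(3) x(1)] unfolding triangular_def by simp_all
    have "fst x = fst p + 1 \<and> snd x = snd p + 1 \<or> fst x = fst p \<and> snd x = snd p + 1 \<or>
        fst p = fst x + 1 \<and> snd p = snd x + 1 \<or> fst p = fst x \<and> snd p = snd x + 1"
      using t ne by linarith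
    then have "x = p + (1, 1) \<or> x = p + (0, 1) \<or> p = x + (1, 1) \<or> p = x + (0, 1) \<and> fst x = fst p"
      by (auto simp: prod_eq_iff)
    then show False
      using no_edge[of p True] no_edge[of p False] no_edge[of x True] no_edge[of x False] s(3) x(1) by auto
  qed
  then have "int (snd v) = int b" unfolding x(2) snd_wrap[OF k] p_def using lt by simp
  then show ?thesis by simp
qed

text \<open>Vertices outside column 0 see only their row and fold into its apex. That apex is then
  left with a single neighbour, the vertex of its row in column 0, and folds into it. What remains
  is column 0 under its own cone, which folds to the apex.\<close>

lemma collapses_rows_to_point:
  fixes k :: nat
  assumes k: "k > 0"
  defines "K \<equiv> {\<sigma>\<in>torus_complex (3 * int k) triangular - column_triangles k. \<forall>i\<in>strip_faces k. \<not> strip_face k i \<subseteq> \<sigma>}"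
  shows "collapses (induced_cones K (kept_apexes k) (\<lambda>c. range (circle k c))) {{(0, 3 * k)}}"
proof -
  let ?M = "induced_cones K (kept_apexes k) (\<lambda>c. range (circle k c))"
  define J where "J = {..<3 * k} \<times> {..<3 * k} \<union> {3 * k} \<times> {..<3 * k}"
  \<comment> \<open>The three stages are ranks 0, 1 and 2: row vertices outside column 0, row
    apexes, column 0. Each \<open>w\<close> has larger rank than the vertex it replaces or is the
    final apex, which lies outside \<open>J\<close>.\<close>
  define rk where "rk = (\<lambda>u :: nat \<times> nat. if fst u = 3 * k then 1 else if fst u = 0 then 2 else (0 :: int))"
  define w where "w = (\<lambda>u :: nat \<times> nat. if fst u = 3 * k then (0, snd u) else if fst u = 0 then (0, 3 * k) else (3 * k, snd u))"
  have finJ: "finite J" unfolding J_def by simp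
  have KT: "\<sigma> \<in> torus_complex (3 * int k) triangular" "\<forall>i\<in>strip_faces k. \<not> strip_face k i \<subseteq> \<sigma>" if "\<sigma> \<in> K" for \<sigma>
    using that unfolding K_def by blast+
  have vertex: "fst v < 3 * k" "snd v < 3 * k" if v: "v \<in> \<sigma>" "\<sigma> \<in> K" for v \<sigma>
  proof -
    obtain x where "v = wrap (3 * int k) x" using v(1) KT(1)[OF v(2)] unfolding torus_complex_def by blast
    then show "fst v < 3 * k" "snd v < 3 * k" using wrap_less[OF k] by simp_all
  qed
  have row: "range (circle k (3 * k, b)) = {p. fst p < 3 * k \<and> snd p = b}" if "b < 3 * k" for b
    using range_circle_row[OF k, of "(3 * k, b)"] that by simp
  have col: "range (circle k (0, 3 * k)) = {p. fst p = 0 \<and> snd p < 3 * k}"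
    using range_circle_column[OF k, of "(0, 3 * k)"] k by simp
  have kept: "c = (0, 3 * k) \<or> (\<exists>j<3 * k. c = (3 * k, j))" if "c \<in> kept_apexes k" for c
    using that unfolding kept_apexes_def by auto
  have d_kept: "(0, 3 * k) \<in> kept_apexes k" and r_kept: "j < 3 * k \<Longrightarrow> (3 * k, j) \<in> kept_apexes k" for j
    unfolding kept_apexes_def by auto
  have cone_in: "insert c t \<in> ?M" if "c \<in> kept_apexes k" "t = {} \<or> t \<in> K" "t \<subseteq> range (circle k c)" for c t
    unfolding induced_cones_iff using that by blast
  \<comment> \<open>The vertices of column 0 survive all deletions; the second stage needs the edge
    from a row apex to such a vertex to be still a simplex.\<close>
  have point: "{(0, b)} \<in> K" if b: "b < 3 * k" for b
  proof -
    have wb: "wrap (3 * int k) (0, int b) = (0, b)" using wrap_int[of 0 k b] k b by simp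
    have "{(0, int b)} \<in> flag_family triangular" unfolding flag_family_def triangular_def by simp
    from torus_complexI[OF this, of "3 * int k"] have 1: "{(0, b)} \<in> torus_complex (3 * int k) triangular"
      by (simp add: wb)
    have ne: "wrap (3 * int k) (p + d) \<noteq> wrap (3 * int k) (p + (0, 0))" if "\<bar>snd d\<bar> = 1" for p d
      by (rule wrap_add_neq[OF k]) (use that in simp)
    have ne': "wrap (3 * int k) (p + d) \<noteq> wrap (3 * int k) p" if "\<bar>snd d\<bar> = 1" for p d
      using ne[OF that, of p] by (simp flip: zero_prod_def)
    have nf: "\<not> strip_face k i \<subseteq> {(0, b)}" for i
      using ne'[of "(1, 1)" "snd i"] ne'[of "(0, 1)" "snd i"] unfolding strip_face_def by (cases "fst i") auto
    have nu: "{(0, b)} \<noteq> upper_triangle k p" for p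
      using ne'[of "(0, 1)" p] unfolding upper_triangle_def by auto
    have "{(0, b)} \<notin> column_triangles k"
      unfolding column_triangles_def by (rule notI, erule imageE) (use nu in simp)
    then show ?thesis unfolding K_def using 1 nf by simp
  qed
  have "collapses ?M {\<sigma>\<in>?M. \<forall>u\<in>J. \<not> {u} \<subseteq> \<sigma>}"
  proof (rule collapses_family[where rk = rk])
    fix u assume u: "u \<in> J"
    have low_rank: "\<not> (rk i \<le> rk u \<and> w u \<in> {i})" if "i \<in> J" for i
      using that u k unfolding J_def rk_def w_def by auto
    have ins: "insert (w u) \<sigma> \<in> ?M"
      if \<sigma>: "\<sigma> \<in> ?M" "u \<in> \<sigma>" and low: "\<And>i. i \<in> J \<Longrightarrow> rk i < rk u \<Longrightarrow> i \<notin> \<sigma>" for \<sigma>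
    proof -
      obtain a b where ab: "u = (a, b)" by (cases u)
      have b: "b < 3 * k" and a: "a \<le> 3 * k" using u unfolding J_def ab by auto
      consider (K) "\<sigma> \<in> K" | (cone) c t where "c \<in> kept_apexes k" "t = {} \<or> t \<in> K" "t \<subseteq> range (circle k c)" "\<sigma> = insert c t"
        using \<sigma>(1) unfolding induced_cones_iff by blast
      then show ?thesis
      proof cases
        case K
        have a_lt: "a < 3 * k" using vertex(1)[OF \<sigma>(2) K] ab by simp
        show ?thesis
        proof (cases "a = 0")
          case False
          have "\<sigma> \<subseteq> range (circle k (3 * k, b))"
            unfolding row[OF b]
            using opened_strips_row[OF k KT[OF K], of a b] \<sigma>(2) False vertex(1)[OF _ K] unfolding ab by blast
          moreover have "w u = (3 * k, b)" using a_lt False unfolding w_def ab by simp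
          ultimately show ?thesis using cone_in[OF r_kept[OF b], of \<sigma>] K by simp
        next
          case True
          have "fst v = 0" if v: "v \<in> \<sigma>" for v
          proof (rule ccontr)
            assume "fst v \<noteq> 0"
            then have "v \<in> J" "rk v < rk u"
              using vertex[OF v K] True k unfolding J_def rk_def ab by (auto simp: mem_Times_iff)
            then show False using low v by blast
          qed
          then have "\<sigma> \<subseteq> range (circle k (0, 3 * k))" unfolding col using vertex(2)[OF _ K] by blast
          moreover have "w u = (0, 3 * k)" using True k unfolding w_def ab by simp
          ultimately show ?thesis using cone_in[OF d_kept, of \<sigma>] K by simp
        qed
      next
        case cone
        have tK: "t \<in> K" if "x \<in> t" for x using cone(2) that by blast
        consider (d) "c = (0, 3 * k)" | (r) j where "j < 3 * k" "c = (3 * k, j)" using kept[OF cone(1)] by blast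
        then show ?thesis
        proof cases
          case d
          have ut: "u \<in> t" using \<sigma>(2) cone(4) u k unfolding d J_def by auto
          then have "u \<in> range (circle k (0, 3 * k))" using cone(3) unfolding d by blast
          then have "a = 0" unfolding col ab by simp
          then have "w u = c" using k unfolding w_def ab d by simp
          then show ?thesis using \<sigma>(1) cone(4) by simp
        next
          case r
          have tr: "fst v < 3 * k" "snd v = j" if "v \<in> t" for v using that cone(3) row[OF r(1)] unfolding r(2) by blast+
          show ?thesis
          proof (cases "u = c")
            case True
            then have u': "a = 3 * k" "b = j" using ab r(2) by simp_all
            have "v = (0, b)" if v: "v \<in> t" for v
            proof (rule ccontr)
              assume "v \<noteq> (0, b)"
              then have "fst v \<noteq> 0" using tr(2)[OF v] u'(2) by (auto simp: prod_eq_iff)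
              then have "v \<in> J" "rk v < rk u"
                using tr[OF v] r(1) u' unfolding J_def rk_def ab by (auto simp: mem_Times_iff)
              then show False using low v cone(4) by blast
            qed
            then have "insert (w u) \<sigma> = insert c {(0, b)}"
              using cone(4) u' unfolding w_def ab by auto
            moreover have "{(0, b)} \<subseteq> range (circle k c)" unfolding r(2) row[OF r(1)] using u'(2) k by simp
            ultimately show ?thesis using cone_in[OF cone(1), of "{(0, b)}"] point[OF b] by simp
          next
            case False
            then have ut: "u \<in> t" using \<sigma>(2) cone(4) by blast
            have ur: "a < 3 * k" "b = j" using tr[OF ut] ab by simp_all
            show ?thesis
            proof (cases "a = 0")
              case True
              have "rk c < rk u" "c \<in> J" using True r k unfolding rk_def ab J_def by auto
              then show ?thesis using low[of c] cone(4) by blast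
            next
              case False
              then have "w u = c" using ur r(2) unfolding w_def ab by simp
              then show ?thesis using \<sigma>(1) cone(4) by simp
            qed
          qed
        qed
      qed
    qed
    have "w u \<notin> {u}" using u k unfolding J_def w_def by auto
    then show "\<exists>w. w \<notin> {u} \<and> (\<forall>\<sigma>\<in>?M. {u} \<subseteq> \<sigma> \<longrightarrow> (\<forall>i\<in>J. rk i < rk u \<longrightarrow> \<not> {i} \<subseteq> \<sigma>) \<longrightarrow>
        insert w \<sigma> \<in> ?M \<and> (\<forall>i\<in>J. rk i \<le> rk u \<longrightarrow> w \<in> {i} \<longrightarrow> \<not> {i} \<subseteq> insert w \<sigma>))"
      using ins low_rank by (intro exI[of _ "w u"]) blast
  qed (use finJ in auto)
  moreover have "{\<sigma>\<in>?M. \<forall>u\<in>J. \<not> {u} \<subseteq> \<sigma>} = {{(0, 3 * k)}}"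
  proof (intro equalityI subsetI)
    fix \<sigma> assume "\<sigma> \<in> {\<sigma>\<in>?M. \<forall>u\<in>J. \<not> {u} \<subseteq> \<sigma>}"
    then have \<sigma>: "\<sigma> \<in> ?M" "\<And>u. u \<in> J \<Longrightarrow> u \<notin> \<sigma>" by blast+
    have no: "v \<notin> \<sigma>" if "fst v < 3 * k" "snd v < 3 * k" for v
      using \<sigma>(2)[of v] that unfolding J_def by (auto simp: mem_Times_iff)
    consider (K) "\<sigma> \<in> K" | (cone) c t where "c \<in> kept_apexes k" "t = {} \<or> t \<in> K" "\<sigma> = insert c t"
      using \<sigma>(1) unfolding induced_cones_iff by blast
    then show "\<sigma> \<in> {{(0, 3 * k)}}"
    proof cases
      case K
      then have "\<sigma> \<noteq> {}" using simplicial_complex_nonempty[OF simplicial_complex_torus_complex KT(1)[OF K]] by simp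
      then obtain v where "v \<in> \<sigma>" by blast
      then show ?thesis using no vertex[OF _ K] by blast
    next
      case cone
      have "t = {}"
      proof (rule ccontr)
        assume "t \<noteq> {}"
        then obtain v where v: "v \<in> t" by blast
        then have "t \<in> K" using cone(2) by blast
        then show False using no[OF vertex[OF v]] v cone(3) by blast
      qed
      moreover have "c = (0, 3 * k)"
      proof (rule ccontr)
        assume "c \<noteq> (0, 3 * k)"
        then have "c \<in> J" using kept[OF cone(1)] unfolding J_def by auto
        then show False using \<sigma>(2) cone(3) by blast
      qed
      ultimately show ?thesis using cone(3) by simp
    qed
  next
    fix \<sigma> assume "\<sigma> \<in> {{(0 :: nat, 3 * k)}}"
    then have \<sigma>: "\<sigma> = insert (0, 3 * k) {}" by simp
    have "\<sigma> \<in> ?M" unfolding \<sigma> by (rule cone_in[OF d_kept]) simp_all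
    moreover have "(0, 3 * k) \<notin> J" using k unfolding J_def by auto
    ultimately show "\<sigma> \<in> {\<sigma>\<in>?M. \<forall>u\<in>J. \<not> {u} \<subseteq> \<sigma>}" using \<sigma> by auto
  qed
  ultimately show ?thesis by simp
qed

text \<open>A cone triangle is maximal because its apex is joined only to its own circle, and a
  column triangle because it lies in no circle and hence under no apex. After their removal each
  cone that is not kept stands over an open path and disappears; the kept cones contract the
  rest.\<close>

lemma spherical_torus_with_cones:
  assumes k: "k \<ge> 2"
  shows "spherical (torus_with_cones k triangular) (cone_triangles k \<union> column_triangles k)"
proof -
  have k0: "k > 0" using k by simp
  let ?K = "torus_complex (3 * int k) triangular"
  let ?Z = "torus_with_cones k triangular"
  let ?T = "cone_triangles k \<union> column_triangles k"
  define L where "L = (\<lambda>c. line_complex (circle k c) 1)"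
  have L: "{\<sigma>\<in>?K. \<sigma> \<subseteq> range (circle k c)} = L c" for c
    unfolding L_def by (rule induced_circle_triangular[OF k0])
  have Z_iff: "\<sigma> \<in> ?Z \<longleftrightarrow> \<sigma> \<in> ?K \<or> (\<exists>c\<in>apexes k. \<exists>t. (t = {} \<or> t \<in> L c) \<and> \<sigma> = insert c t)" for \<sigma>
    unfolding induced_cones_iff L[symmetric] by auto
  have apex_wrap: "wrap (3 * int k) x \<notin> apexes k" for x using apexes_disjoint[OF k0] by blast
  have apex_K: "c \<notin> \<sigma>" if "\<sigma> \<in> ?K" "c \<in> apexes k" for \<sigma> c
    using that apex_wrap unfolding torus_complex_def by blast
  have LK: "L c \<subseteq> ?K" for c using L by blast
  have col_K: "column_triangles k \<subseteq> ?K"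
    unfolding column_triangles_def using upper_triangle_in_complex by blast
  have edge_L: "last_edge k c \<in> L c" for c unfolding L_def by (rule last_edge_in_line[OF k0])
  have ascZ: "simplicial_complex ?Z" by (rule simplicial_complex_induced_cones[OF simplicial_complex_torus_complex])
  have finZ: "finite ?Z"
  proof (rule finite_subset)
    let ?V = "{..<4 * k} \<times> {..<4 * k}"
    have VK: "v \<in> ?V" if v: "v \<in> \<sigma>" "\<sigma> \<in> ?K" for v \<sigma>
    proof -
      obtain x where "v = wrap (3 * int k) x" using v unfolding torus_complex_def by blast
      then have "fst v < 3 * k" "snd v < 3 * k" using wrap_less[OF k0] by simp_all
      then show ?thesis by (simp add: mem_Times_iff)
    qed
    have VI: "c \<in> ?V" if "c \<in> apexes k" for c
      using that unfolding apexes_def by (auto simp: mem_Times_iff)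
    show "?Z \<subseteq> Pow ?V"
    proof (intro subsetI PowI)
      fix \<sigma> v assume \<sigma>: "\<sigma> \<in> ?Z" and v: "v \<in> \<sigma>"
      from \<sigma> consider "\<sigma> \<in> ?K" | c t where "c \<in> apexes k" "t = {} \<or> t \<in> L c" "\<sigma> = insert c t"
        unfolding Z_iff by blast
      then show "v \<in> ?V"
      proof cases
        case 1
        then show ?thesis by (rule VK[OF v])
      next
        case 2
        then consider "v = c" | "v \<in> t" "t \<in> L c" using v by blast
        then show ?thesis
        proof cases
          case 1
          then show ?thesis using VI[OF 2(1)] by simp
        next
          case 2
          then have "t \<in> ?K" using LK by blast
          then show ?thesis by (rule VK[OF 2(1)])
        qed
      qed
    qed
  qed simp
  have TZ: "?T \<subseteq> ?Z"
  proof
    fix \<tau> assume "\<tau> \<in> ?T"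
    then show "\<tau> \<in> ?Z" unfolding Z_iff cone_triangles_def using col_K edge_L by blast
  qed
  have last_ne: "circle k c (3 * int k - 1) \<noteq> circle k c 0" for c
  proof
    assume "circle k c (3 * int k - 1) = circle k c 0"
    then have "3 * int k dvd (3 * int k - 1) - 0" unfolding circle_eq[OF k0] .
    then show False using k zdvd_imp_le[of "3 * int k" "3 * int k - 1"] by simp
  qed
  have circ_apex: "circle k c i \<notin> apexes k" for c i unfolding circle_def by (rule apex_wrap)
  have T: "card \<tau> = 3 \<and> (\<forall>\<sigma>\<in>?Z. \<tau> \<subseteq> \<sigma> \<longrightarrow> \<sigma> = \<tau>)" if \<tau>: "\<tau> \<in> ?T" for \<tau>
    using \<tau>
  proof
    assume "\<tau> \<in> cone_triangles k"
    then obtain c where c: "c \<in> apexes k" "\<tau> = insert c (last_edge k c)" unfolding cone_triangles_def by blast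
    have "c \<noteq> circle k c (3 * int k - 1)" "c \<noteq> circle k c 0" using circ_apex c(1) by metis+
    then have "card \<tau> = 3" unfolding c(2) last_edge_def using last_ne by simp
    moreover have "\<sigma> = \<tau>" if \<sigma>: "\<sigma> \<in> ?Z" "\<tau> \<subseteq> \<sigma>" for \<sigma>
    proof -
      have "\<sigma> \<notin> ?K" using apex_K[of \<sigma> c] c \<sigma>(2) by blast
      then obtain c' t where t: "c' \<in> apexes k" "t = {} \<or> t \<in> L c'" "\<sigma> = insert c' t" using \<sigma>(1) unfolding Z_iff by blast
      have "c \<in> \<sigma>" using c(2) \<sigma>(2) by blast
      moreover have "c \<notin> t" using t(2) apex_K[OF _ c(1)] LK by blast
      ultimately have cc: "c' = c" using t(3) by blast
      have "c \<notin> last_edge k c" using apex_K[OF _ c(1)] edge_L LK by blast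
      then have "last_edge k c \<subseteq> t" using \<sigma>(2) unfolding c(2) t(3) cc by blast
      moreover from this have "t \<in> L c" using t(2) cc unfolding last_edge_def by auto
      ultimately have "t = last_edge k c" using last_edge_maximal[OF k0] unfolding L_def by blast
      then show ?thesis unfolding t(3) cc c(2) by simp
    qed
    ultimately show ?thesis by blast
  next
    assume "\<tau> \<in> column_triangles k"
    then obtain p where p: "\<tau> = upper_triangle k p" unfolding column_triangles_def by blast
    have "wrap (3 * int k) (p + (0, 1)) \<noteq> wrap (3 * int k) (p + (0, 0))"
      "wrap (3 * int k) (p + (1, 1)) \<noteq> wrap (3 * int k) (p + (0, 0))"
      "wrap (3 * int k) (p + (1, 1)) \<noteq> wrap (3 * int k) (p + (0, 1))"
      by (rule wrap_add_neq[OF k0]; simp)+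
    then have ne: "wrap (3 * int k) (p + (0, 1)) \<noteq> wrap (3 * int k) p"
      "wrap (3 * int k) (p + (1, 1)) \<noteq> wrap (3 * int k) p"
      "wrap (3 * int k) (p + (1, 1)) \<noteq> wrap (3 * int k) (p + (0, 1))" by (simp_all flip: zero_prod_def)
    have "\<tau> = {wrap (3 * int k) p, wrap (3 * int k) (p + (0, 1)), wrap (3 * int k) (p + (1, 1))}"
      unfolding p upper_triangle_def by simp
    then have "card \<tau> = 3" using ne[symmetric] by (simp add: card_insert_if)
    moreover have "\<sigma> = \<tau>" if \<sigma>: "\<sigma> \<in> ?Z" "\<tau> \<subseteq> \<sigma>" for \<sigma>
    proof -
      have "\<sigma> \<in> ?K"
      proof (rule ccontr)
        assume "\<sigma> \<notin> ?K"
        then obtain c t where t: "c \<in> apexes k" "t = {} \<or> t \<in> L c" "\<sigma> = insert c t" using \<sigma>(1) unfolding Z_iff by blast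
        have "c \<notin> upper_triangle k p" using apex_K[OF upper_triangle_in_complex t(1)] .
        then have "upper_triangle k p \<subseteq> t" using \<sigma>(2) unfolding p t(3) by blast
        moreover have "t \<subseteq> range (circle k c)" using t(2) L[of c] by blast
        ultimately show False using upper_triangle_not_in_circle[OF k0, of p c] by blast
      qed
      then show ?thesis using upper_triangle_maximal[OF k0 _ \<sigma>(2)[unfolded p]] p by blast
    qed
    ultimately show ?thesis by blast
  qed
  define K' where "K' = ?K - column_triangles k"
  \<comment> \<open>Deleting the marked triangle of a cone amounts to dropping the closing edge from
    the base of that cone; the edge itself stays in \<open>K'\<close>. The bases \<open>R'\<close>
    are what is left after the open paths are folded to their end vertex.\<close>
  define R where "R = (\<lambda>c. L c - (if c \<in> kept_apexes k then {} else {last_edge k c}))"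
  define R' where "R' = (\<lambda>c. if c \<in> kept_apexes k then L c else {{circle k c (3 * int k - 1)}})"
  have ascK': "simplicial_complex K'"
    unfolding K'_def
  proof (rule simplicial_complex_diff_maximal[OF simplicial_complex_torus_complex])
    fix \<tau> \<sigma> assume "\<tau> \<in> column_triangles k" "\<sigma> \<in> ?K" "\<tau> \<subseteq> \<sigma>"
    then show "\<sigma> = \<tau>" using upper_triangle_maximal[OF k0] unfolding column_triangles_def by blast
  qed
  have LK': "L c \<subseteq> K'" for c
    unfolding K'_def column_triangles_def using L[of c] upper_triangle_not_in_circle[OF k0] by blast
  have ascL: "simplicial_complex (L c)" for c unfolding L_def by (rule simplicial_complex_line_complex)
  have ascR: "simplicial_complex (R c)" for c
    unfolding R_def
  proof (rule simplicial_complex_diff_maximal[OF ascL])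
    fix \<tau> \<sigma> assume "\<tau> \<in> (if c \<in> kept_apexes k then {} else {last_edge k c})" "\<sigma> \<in> L c" "\<tau> \<subseteq> \<sigma>"
    then show "\<sigma> = \<tau>" using last_edge_maximal[OF k0] unfolding L_def by (auto split: if_splits)
  qed
  have RL: "R c \<subseteq> L c" for c unfolding R_def by blast
  have colR: "collapses (R c) (R' c)" for c
  proof (cases "c \<in> kept_apexes k")
    case True
    then show ?thesis unfolding R_def R'_def by simp
  next
    case False
    have "collapses (line_complex (circle k c) 1 - {{circle k c (3 * int k - 1), circle k c 0}}) {{circle k c (3 * int k - 1)}}"
      by (rule collapses_path_to_point) (use k circle_eq[OF k0] in simp_all)
    then show ?thesis using False unfolding R_def R'_def L_def last_edge_def by simp
  qed
  have apex_K': "apexes k \<inter> \<Union>K' = {}" using apex_K unfolding K'_def by blast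
  have ZT: "?Z - ?T = cones K' (apexes k) R"
  proof (rule set_eqI)
    fix \<sigma>
    have cones_iff: "\<sigma> \<in> cones K' (apexes k) R \<longleftrightarrow> \<sigma> \<in> K' \<or> (\<exists>c\<in>apexes k. \<exists>t. (t = {} \<or> t \<in> R c) \<and> \<sigma> = insert c t)"
      unfolding cones_def by auto
    show "\<sigma> \<in> ?Z - ?T \<longleftrightarrow> \<sigma> \<in> cones K' (apexes k) R"
    proof (cases "\<sigma> \<in> ?K")
      case True
      then have n1: "\<sigma> \<notin> cone_triangles k" using apex_K unfolding cone_triangles_def by blast
      have "\<not> (\<exists>c\<in>apexes k. \<exists>t. (t = {} \<or> t \<in> R c) \<and> \<sigma> = insert c t)" using apex_K[OF True] by blast
      then have "\<sigma> \<in> cones K' (apexes k) R \<longleftrightarrow> \<sigma> \<in> K'" using cones_iff by (simp only: simp_thms)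
      moreover have "\<sigma> \<in> K' \<longleftrightarrow> \<sigma> \<notin> column_triangles k" using True unfolding K'_def by simp
      moreover have "\<sigma> \<in> ?Z" unfolding Z_iff using True by (rule disjI1)
      ultimately show ?thesis using n1 by simp
    next
      case False
      then have nc: "\<sigma> \<notin> column_triangles k" "\<sigma> \<notin> K'" using col_K unfolding K'_def by blast+
      show ?thesis
      proof
        assume "\<sigma> \<in> ?Z - ?T"
        then have \<sigma>: "\<sigma> \<in> ?Z" "\<sigma> \<notin> cone_triangles k" by blast+
        then obtain c t where t: "c \<in> apexes k" "t = {} \<or> t \<in> L c" "\<sigma> = insert c t" using False unfolding Z_iff by blast
        have "t = {} \<or> t \<in> R c"
        proof (cases "c \<in> kept_apexes k")
          case nk: False
          then have "t \<noteq> last_edge k c" using \<sigma>(2) t(1,3) unfolding cone_triangles_def by blast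
          then show ?thesis using t(2) nk unfolding R_def by simp
        qed (use t(2) in \<open>simp add: R_def\<close>)
        then show "\<sigma> \<in> cones K' (apexes k) R" unfolding cones_iff using t by blast
      next
        assume "\<sigma> \<in> cones K' (apexes k) R"
        then obtain c t where t: "c \<in> apexes k" "t = {} \<or> t \<in> R c" "\<sigma> = insert c t" using nc unfolding cones_iff by blast
        have ct: "c \<notin> t" using t(2) RL LK apex_K[OF _ t(1)] by blast
        have "\<sigma> \<notin> cone_triangles k"
        proof
          assume "\<sigma> \<in> cone_triangles k"
          then obtain c' where c': "c' \<in> apexes k" "c' \<notin> kept_apexes k" "insert c t = insert c' (last_edge k c')"
            unfolding cone_triangles_def t(3) by blast
          have n1: "c' \<notin> t" using t(2) RL LK apex_K[OF _ c'(1)] by blast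
          have n3: "c' \<notin> last_edge k c'" using apex_K[OF _ c'(1)] edge_L LK by blast
          have "c' \<in> insert c t" unfolding c'(3) by simp
          then have cc: "c = c'" using n1 by simp
          have te: "t = last_edge k c'"
            by (rule insert_ident[THEN iffD1, OF ct[unfolded cc] n3 c'(3)[unfolded cc]])
          then have "t \<noteq> {}" unfolding last_edge_def by simp
          then show False using t(2) te cc c'(2) unfolding R_def by simp
        qed
        moreover have "\<sigma> \<in> ?Z" unfolding Z_iff using t RL by blast
        ultimately show "\<sigma> \<in> ?Z - ?T" using nc by blast
      qed
    qed
  qed
  have c1: "collapses (cones K' (apexes k) R) (cones K' (apexes k) R')"
    by (rule collapses_cones[OF finite_apexes ascK' _ apex_K']) (use ascR RL LK' colR in blast)
  \<comment> \<open>An apex that is not kept is now joined to a single vertex of its circle and is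
    folded into it.\<close>
  have "collapses (cones K' (apexes k) R') {\<sigma>\<in>cones K' (apexes k) R'. \<forall>c\<in>apexes k - kept_apexes k. \<not> {c} \<subseteq> \<sigma>}"
  proof (rule collapses_family_apex)
    fix c assume c: "c \<in> apexes k - kept_apexes k"
    let ?w = "circle k c (3 * int k - 1)"
    have ins: "insert ?w \<sigma> \<in> cones K' (apexes k) R'" if \<sigma>: "\<sigma> \<in> cones K' (apexes k) R'" "{c} \<subseteq> \<sigma>" for \<sigma>
    proof -
      have "\<sigma> \<notin> K'" using apex_K' c \<sigma>(2) by blast
      then obtain c' t where t: "c' \<in> apexes k" "t = {} \<or> t \<in> R' c'" "\<sigma> = insert c' t"
        using \<sigma>(1) unfolding cones_def by blast
      have "R' c' \<subseteq> ?K" using RL LK collapses_subset[OF colR[of c']] by blast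
      then have "c \<notin> t" using t(2) apex_K[of t c] c by blast
      then have cc: "c' = c" using \<sigma>(2) t(3) by blast
      then have "t = {} \<or> t = {?w}" using t(2) c unfolding R'_def by auto
      then have "insert ?w \<sigma> = insert c {?w}" unfolding t(3) cc by auto
      moreover have "{?w} \<in> R' c" using c unfolding R'_def by simp
      then have "insert c {?w} \<in> insert c ` insert {} (R' c)" by (intro imageI insertI2)
      then have "insert c {?w} \<in> cones K' (apexes k) R'" unfolding cones_def using c by blast
      ultimately show ?thesis by simp
    qed
    show "\<exists>w. (\<forall>i\<in>apexes k - kept_apexes k. w \<notin> {i}) \<and>
        (\<forall>\<sigma>\<in>cones K' (apexes k) R'. {c} \<subseteq> \<sigma> \<longrightarrow> insert w \<sigma> \<in> cones K' (apexes k) R')"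
    proof (intro exI[of _ ?w] conjI ballI impI)
      show "?w \<notin> {i}" if "i \<in> apexes k - kept_apexes k" for i using that circ_apex[of c "3 * int k - 1"] by auto
    qed (rule ins)
  qed (use finite_apexes in auto)
  moreover have "{\<sigma>\<in>cones K' (apexes k) R'. \<forall>c\<in>apexes k - kept_apexes k. \<not> {c} \<subseteq> \<sigma>} = cones K' (kept_apexes k) L" (is "?A = ?B")
  proof (intro equalityI subsetI)
    fix \<sigma> assume "\<sigma> \<in> ?A"
    then have \<sigma>: "\<sigma> \<in> cones K' (apexes k) R'" "\<And>c. c \<in> apexes k \<Longrightarrow> c \<notin> kept_apexes k \<Longrightarrow> c \<notin> \<sigma>" by blast+
    consider "\<sigma> \<in> K'" | c t where "c \<in> apexes k" "t \<in> insert {} (R' c)" "\<sigma> = insert c t"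
      using \<sigma>(1) unfolding cones_def by blast
    then show "\<sigma> \<in> ?B"
    proof cases
      case 2
      then have c: "c \<in> kept_apexes k" using \<sigma>(2) by blast
      then have "R' c = L c" unfolding R'_def by simp
      then show ?thesis unfolding cones_def using 2(2,3) c by blast
    qed (simp add: cones_def)
  next
    have kept_apex: "kept_apexes k \<subseteq> apexes k" using k0 unfolding kept_apexes_def apexes_def by auto
    fix \<sigma> assume "\<sigma> \<in> ?B"
    then consider "\<sigma> \<in> K'" | c t where "c \<in> kept_apexes k" "t \<in> insert {} (L c)" "\<sigma> = insert c t"
      unfolding cones_def by blast
    then show "\<sigma> \<in> ?A"
    proof cases
      case 1
      then have "c \<notin> \<sigma>" if "c \<in> apexes k" for c using apex_K'  that by blast
      then show ?thesis using 1 unfolding cones_def by blast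
    next
      case 2
      have "c' \<notin> \<sigma>" if c': "c' \<in> apexes k" "c' \<notin> kept_apexes k" for c'
      proof -
        have "c' \<notin> t" using 2(2) LK apex_K[OF _ c'(1)] by blast
        then show ?thesis using 2(1,3) c'(2) by blast
      qed
      moreover have "t \<in> insert {} (R' c)" using 2(1,2) unfolding R'_def by simp
      then have "\<sigma> \<in> cones K' (apexes k) R'" unfolding cones_def using 2(1,3) kept_apex by blast
      ultimately show ?thesis by blast
    qed
  qed
  moreover have "{\<sigma>\<in>K'. \<sigma> \<subseteq> range (circle k c)} = L c" for c
    using LK'[of c] L[of c] unfolding K'_def by blast
  then have "cones K' (kept_apexes k) L = induced_cones K' (kept_apexes k) (\<lambda>c. range (circle k c))"
    unfolding induced_cones_def by simp
  ultimately have c2: "collapses (cones K' (apexes k) R') (induced_cones K' (kept_apexes k) (\<lambda>c. range (circle k c)))"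
    by simp
  have c3: "collapses (induced_cones K' (kept_apexes k) (\<lambda>c. range (circle k c))) {{(0, 3 * k)}}"
    unfolding K'_def by (rule rtranclp_trans[OF collapses_strips[OF k0] collapses_rows_to_point[OF k0]])
  have "collapses (?Z - ?T) {{(0, 3 * k)}}"
    unfolding ZT by (rule rtranclp_trans[OF c1 rtranclp_trans[OF c2 c3]])
  then show ?thesis unfolding spherical_def using ascZ finZ TZ T by blast
qed

theorem theorem5p10:
  fixes k :: nat
  assumes "k \<ge> 2"
  shows "geometric_realization (torus_vertices (3*k))
           (vietoris_rips (torus_vertices (3*k)) (torus_dist (3*k)) k)
         homotopy_equivalent_space wedge_of_2spheres (6*k^2 - 1)"
proof -
  let ?VR = "vietoris_rips (torus_vertices (3 * k)) (torus_dist (3 * k)) k"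
  let ?T = "cone_triangles k \<union> column_triangles k"
  have "?T \<noteq> {}" using assms unfolding column_triangles_def by (auto simp: lessThan_empty_iff)
  \<comment> \<open>The vertex type \<open>nat \<times> nat\<close> is infinite, which supplies the
    fresh vertices for the subdivisions and for the last cone.\<close>
  then have "top_of_set (realization (torus_with_cones k triangular)) homotopy_equivalent_space wedge_of_2spheres (card ?T)"
    by (intro spherical_homotopy_equivalent_wedge spherical_torus_with_cones assms) (simp add: finite_prod)
  with vietoris_rips_homotopy_equivalent_torus_with_cones[OF assms]
  have "top_of_set (realization ?VR) homotopy_equivalent_space wedge_of_2spheres (card ?T)"
    by (rule homotopy_eqv_trans)
  moreover have "geometric_realization (torus_vertices (3 * k)) ?VR = top_of_set (realization ?VR)"
    by (rule geometric_realization_eq_realization) (auto simp: torus_vertices_def vietoris_rips_def)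
  ultimately show ?thesis
    by (simp only: card_cone_triangles_Un_column_triangles[OF assms])
qed

end
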